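(* Let $\omega\in\mathbb{T}^1=\mathbb{R}/\mathbb{Z}$ be Diophantine. For $\alpha\geq 0$ let $f:\mathbb{T}^1\times[0,1]\to\mathbb{T}^1\times[0,1]$, $f(\theta,x)=(\theta+\omega \bmod 1,\ \tanh(\alpha x)\cdot\sin(\pi\theta))$. If $\alpha$ is sufficiently large, then there exists a set $\Omega\subseteq\mathbb{T}^1$ of full Lebesgue measure, invariant under the rotation by angle $\omega$, such that $$0\ <\ \underline{\mathrm{ac}}\big(f|_{\Omega\times[0,1]}\big)\ \le\ \overline{\mathrm{ac}}\big(f|_{\Omega\times[0,1]}\big)\ <\ \infty.$$ In contrast to this, for every $\varepsilon>0$ and every $\alpha\ge0$ for which the map $f^\varepsilon(\theta,x)=(\theta+\omega\bmod 1,\ \tanh(\alpha x)\cdot(\sin(\pi\theta)+\varepsilon))$ is a self-map of $\mathbb{T}^1\times[0,1]$, we have $\mathrm{ac}(f^\varepsilon)=0$.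
   Context: $\omega\in\mathbb{T}^1$ is Diophantine if there exist constants $c,d_0>0$ such that $d(n\omega,0)\ge c\,n^{-d_0}$ for all $n\in\mathbb{N}$, $n\geq 1$, where $d$ is the usual metric on $\mathbb{T}^1$. In the formulas, $\theta\in\mathbb{T}^1$ is represented by its representative in $[0,1)$. $\mathbb{T}^1\times[0,1]$ carries the maximum product metric, and subsets carry the restricted metric. Amorphic complexity. Let $(X,d)$ be a metric space and $f:X\to X$. For $x,y\in X$, $\delta>0$, $n\in\mathbb{N}$ let $S_n(f,\delta,x,y)=\#\{0\le k<n \mid d(f^k(x),f^k(y))\ge\delta\}$. For $\nu\in(0,1]$, points $x,y$ are $(f,\delta,\nu)$-separated if $\limsup_{n\to\infty} S_n(f,\delta,x,y)/n\ge\nu$. A subset is $(f,\delta,\nu)$-separated if all pairs of distinct points of it are. $\operatorname{Sep}(f,\delta,\nu)$ is the largest cardinality (possibly $\infty$) of an $(f,\delta,\nu)$-separated subset of $X$. Set $\underline{\mathrm{ac}}(f)=\sup_{\delta>0}\liminf_{\nu\to0}\frac{\log\operatorname{Sep}(f,\delta,\nu)}{-\log\nu}$ and $\overline{\mathrm{ac}}(f)=\sup_{\delta>0}\limsup_{\nu\to0}\frac{\log\operatorname{Sep}(f,\delta,\nu)}{-\log\nu}$; if they coincide, the common value is $\mathrm{ac}(f)$. *)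

theory Defs
  imports "HOL-Analysis.Analysis"
begin

section \<open>Amorphic complexity\<close>

definition sep_count :: "'a metric \<Rightarrow> ('a \<Rightarrow> 'a) \<Rightarrow> real \<Rightarrow> 'a \<Rightarrow> 'a \<Rightarrow> nat \<Rightarrow> nat" where
  "sep_count m f \<delta> x y n = card {k. k < n \<and> mdist m ((f ^^ k) x) ((f ^^ k) y) \<ge> \<delta>}"

definition separated_points :: "'a metric \<Rightarrow> ('a \<Rightarrow> 'a) \<Rightarrow> real \<Rightarrow> real \<Rightarrow> 'a \<Rightarrow> 'a \<Rightarrow> bool" where
  "separated_points m f \<delta> \<nu> x y \<longleftrightarrow>
     limsup (\<lambda>n. ereal (real (sep_count m f \<delta> x y n) / real n)) \<ge> ereal \<nu>"

definition separated_set :: "'a metric \<Rightarrow> ('a \<Rightarrow> 'a) \<Rightarrow> real \<Rightarrow> real \<Rightarrow> 'a set \<Rightarrow> bool" where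
  "separated_set m f \<delta> \<nu> S \<longleftrightarrow>
     S \<subseteq> mspace m \<and> (\<forall>x\<in>S. \<forall>y\<in>S. x \<noteq> y \<longrightarrow> separated_points m f \<delta> \<nu> x y)"

text \<open>Infinite separated sets are counted with cardinality \<open>\<infinity>\<close>; they must be treated
  separately since \<open>card\<close> is \<open>0\<close> on infinite sets.\<close>

definition Sep :: "'a metric \<Rightarrow> ('a \<Rightarrow> 'a) \<Rightarrow> real \<Rightarrow> real \<Rightarrow> enat" where
  "Sep m f \<delta> \<nu> =
     (SUP S\<in>{S. separated_set m f \<delta> \<nu> S}. if finite S then enat (card S) else \<infinity>)"

definition log_enat :: "enat \<Rightarrow> ereal" where
  "log_enat N = (case N of enat k \<Rightarrow> if k = 0 then -\<infinity> else ereal (ln (real k)) | \<infinity> \<Rightarrow> \<infinity>)"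

definition lower_ac :: "'a metric \<Rightarrow> ('a \<Rightarrow> 'a) \<Rightarrow> ereal" where
  "lower_ac m f =
     (SUP \<delta>\<in>{0<..}. Liminf (at_right 0) (\<lambda>\<nu>. log_enat (Sep m f \<delta> \<nu>) / ereal (- ln \<nu>)))"

definition upper_ac :: "'a metric \<Rightarrow> ('a \<Rightarrow> 'a) \<Rightarrow> ereal" where
  "upper_ac m f =
     (SUP \<delta>\<in>{0<..}. Limsup (at_right 0) (\<lambda>\<nu>. log_enat (Sep m f \<delta> \<nu>) / ereal (- ln \<nu>)))"

definition has_ac :: "'a metric \<Rightarrow> ('a \<Rightarrow> 'a) \<Rightarrow> ereal \<Rightarrow> bool" where
  "has_ac m f a \<longleftrightarrow> lower_ac m f = a \<and> upper_ac m f = a"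


section \<open>The circle and the phase space\<close>

text \<open>The circle \<open>\<real>/\<int>\<close> is represented by \<open>[0,1)\<close>; \<open>infdist (s - t) \<int>\<close> is the quotient
  metric \<open>inf\<^sub>k \<bar>s - t - k\<bar>\<close>.\<close>

definition circle_metric :: "real metric" where
  "circle_metric = metric ({0..<1}, \<lambda>s t. infdist (s - t) \<int>)"

lemma le_infdist_Ints:
  fixes x :: real
  assumes "\<And>a. a \<in> \<int> \<Longrightarrow> c \<le> dist x a"
  shows "c \<le> infdist x \<int>"
proof -
  have ne: "(\<int> :: real set) \<noteq> {}" using Ints_0 by blast
  show ?thesis unfolding infdist_notempty[OF ne] by (rule cINF_greatest) (use ne assms in auto)
qed

lemma Metric_space_circle: "Metric_space {0..<1} (\<lambda>s t::real. infdist (s - t) \<int>)"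
proof
  show "0 \<le> infdist (s - t) \<int>" for s t :: real
    by (rule infdist_nonneg)
next
  have "infdist (s - t) \<int> \<le> infdist (t - s) \<int>" for s t :: real
  proof -
    have "infdist (s - t) \<int> \<le> dist (t - s) a" if "a \<in> \<int>" for a
      using infdist_le[of "-a" \<int> "s - t"] that by (simp add: dist_real_def abs_minus_commute)
    then show ?thesis
      by (rule le_infdist_Ints)
  qed
  then show "infdist (s - t) \<int> = infdist (t - s) \<int>" for s t :: real
    by (simp add: order_antisym)
next
  fix s t :: real assume st: "s \<in> {0..<1}" "t \<in> {0..<1}"
  have "infdist (s - t) \<int> = 0 \<longleftrightarrow> s - t \<in> \<int>"
    using in_closed_iff_infdist_zero[of "\<int>::real set"] closed_Ints by blast
  also have "\<dots> \<longleftrightarrow> s = t"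
  proof
    assume "s - t \<in> \<int>"
    then obtain k :: int where "s - t = of_int k" by (auto elim: Ints_cases)
    moreover from this st have "k < 1" "k > -1" by auto
    ultimately show "s = t" by simp
  qed simp
  finally show "infdist (s - t) \<int> = 0 \<longleftrightarrow> s = t" .
next
  fix s t u :: real
  have "infdist (s - u) \<int> \<le> dist (s - t) a + dist (t - u) b" if "a \<in> \<int>" "b \<in> \<int>" for a b
  proof -
    have "infdist (s - u) \<int> \<le> dist (s - u) (a + b)"
      by (rule infdist_le) (use that in auto)
    also have "\<dots> \<le> dist (s - t) a + dist (t - u) b"
      by (simp add: dist_real_def)
    finally show ?thesis .
  qed
  then have "infdist (s - u) \<int> - dist (s - t) a \<le> infdist (t - u) \<int>" if "a \<in> \<int>" for a
    using that by (intro le_infdist_Ints) (simp add: algebra_simps)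
  then have "infdist (s - u) \<int> - infdist (t - u) \<int> \<le> infdist (s - t) \<int>"
    by (intro le_infdist_Ints) (simp add: algebra_simps)
  then show "infdist (s - u) \<int> \<le> infdist (s - t) \<int> + infdist (t - u) \<int>"
    by simp
qed

lemma mspace_circle [simp]: "mspace circle_metric = {0..<1}"
  and mdist_circle: "mdist circle_metric s t = infdist (s - t) \<int>"
  by (simp_all add: circle_metric_def Metric_space.mspace_metric[OF Metric_space_circle]
      Metric_space.mdist_metric[OF Metric_space_circle])

text \<open>The library's \<open>prod_metric\<close> is the Euclidean product, so the maximum metric is
  introduced here.\<close>

definition max_prod_metric :: "'a metric \<Rightarrow> 'b metric \<Rightarrow> ('a \<times> 'b) metric" where
  "max_prod_metric m1 m2 = metric (mspace m1 \<times> mspace m2,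
     \<lambda>p q. max (mdist m1 (fst p) (fst q)) (mdist m2 (snd p) (snd q)))"

lemma Metric_space_max_prod:
  "Metric_space (mspace m1 \<times> mspace m2)
     (\<lambda>p q. max (mdist m1 (fst p) (fst q)) (mdist m2 (snd p) (snd q)))"
proof
  show "0 \<le> max (mdist m1 (fst p) (fst q)) (mdist m2 (snd p) (snd q))" for p q
    by (simp add: le_max_iff_disj)
  show "max (mdist m1 (fst p) (fst q)) (mdist m2 (snd p) (snd q)) =
        max (mdist m1 (fst q) (fst p)) (mdist m2 (snd q) (snd p))" for p q
    by (simp add: mdist_commute)
  show "max (mdist m1 (fst p) (fst q)) (mdist m2 (snd p) (snd q)) = 0 \<longleftrightarrow> p = q"
    if "p \<in> mspace m1 \<times> mspace m2" "q \<in> mspace m1 \<times> mspace m2" for p q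
  proof -
    have "max a b = 0 \<longleftrightarrow> a = 0 \<and> b = 0" if "0 \<le> a" "0 \<le> b" for a b :: real
      using that by auto
    then show ?thesis using that by (auto simp: prod_eq_iff)
  qed
  show "max (mdist m1 (fst p) (fst r)) (mdist m2 (snd p) (snd r)) \<le>
        max (mdist m1 (fst p) (fst q)) (mdist m2 (snd p) (snd q)) +
        max (mdist m1 (fst q) (fst r)) (mdist m2 (snd q) (snd r))"
    if "p \<in> mspace m1 \<times> mspace m2" "q \<in> mspace m1 \<times> mspace m2" "r \<in> mspace m1 \<times> mspace m2"
    for p q r
    using mdist_triangle[of "fst p" m1 "fst q" "fst r"]
      mdist_triangle[of "snd p" m2 "snd q" "snd r"] that
    by auto
qed

lemma mspace_max_prod [simp]: "mspace (max_prod_metric m1 m2) = mspace m1 \<times> mspace m2"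
  and mdist_max_prod: "mdist (max_prod_metric m1 m2) p q =
        max (mdist m1 (fst p) (fst q)) (mdist m2 (snd p) (snd q))"
  by (simp_all add: max_prod_metric_def Metric_space.mspace_metric[OF Metric_space_max_prod]
      Metric_space.mdist_metric[OF Metric_space_max_prod])

definition annulus_metric :: "(real \<times> real) metric" where
  "annulus_metric = max_prod_metric circle_metric (submetric euclidean_metric {0..1})"

lemma mspace_annulus [simp]: "mspace annulus_metric = {0..<1} \<times> {0..1}"
  by (simp add: annulus_metric_def)


section \<open>Quasiperiodically forced maps\<close>

definition rotation :: "real \<Rightarrow> real \<Rightarrow> real" where
  "rotation \<omega> \<theta> = frac (\<theta> + \<omega>)"

definition diophantine :: "real \<Rightarrow> bool" where
  "diophantine \<omega> \<longleftrightarrow>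
     (\<exists>c d0. c > 0 \<and> d0 > 0 \<and>
        (\<forall>n::nat. n \<ge> 1 \<longrightarrow> mdist circle_metric (frac (real n * \<omega>)) 0 \<ge> c * real n powr (- d0)))"

definition pinched_map :: "real \<Rightarrow> real \<Rightarrow> real \<times> real \<Rightarrow> real \<times> real" where
  "pinched_map \<omega> \<alpha> = (\<lambda>(\<theta>, x). (rotation \<omega> \<theta>, tanh (\<alpha> * x) * sin (pi * \<theta>)))"

definition perturbed_map :: "real \<Rightarrow> real \<Rightarrow> real \<Rightarrow> real \<times> real \<Rightarrow> real \<times> real" where
  "perturbed_map \<omega> \<alpha> \<epsilon> = (\<lambda>(\<theta>, x). (rotation \<omega> \<theta>, tanh (\<alpha> * x) * (sin (pi * \<theta>) + \<epsilon>)))"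

lemma pinched_map_self_map:
  assumes "\<alpha> \<ge> 0"
  shows "pinched_map \<omega> \<alpha> \<in> mspace annulus_metric \<rightarrow> mspace annulus_metric"
proof
  fix p assume "p \<in> mspace annulus_metric"
  then obtain \<theta> x where p: "p = (\<theta>, x)" "0 \<le> \<theta>" "\<theta> < 1" "0 \<le> x" "x \<le> 1" by auto
  have "0 \<le> sin (pi * \<theta>)" using p by (intro sin_ge_zero) (auto simp: mult_le_cancel_left1)
  moreover have "0 \<le> tanh (\<alpha> * x)" using assms p by simp
  moreover have "tanh (\<alpha> * x) \<le> 1" using tanh_real_lt_1[of "\<alpha> * x"] by simp
  ultimately have "0 \<le> tanh (\<alpha> * x) * sin (pi * \<theta>)" "tanh (\<alpha> * x) * sin (pi * \<theta>) \<le> 1"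
    by (auto intro: mult_le_one)
  then show "pinched_map \<omega> \<alpha> p \<in> mspace annulus_metric"
    by (simp add: p(1) pinched_map_def rotation_def frac_lt_1)
qed

end

theory Submission
  imports Defs
begin

text \<open>In the coordinate \<open>ln x\<close> every fibre map is a translation composed with a map that
  contracts, uniformly as long as the two points are \<open>\<delta>\<close>-apart. So the time that two fibre orbits
  spend \<open>\<delta>\<close>-apart is bounded by the accumulated difference of the forcing terms.

  For the pinched map this difference is \<open>\<bar>ln (sin (\<pi>\<theta>)) - ln (sin (\<pi>\<theta>'))\<bar>\<close> summed along
  the orbits; the Diophantine condition separates close returns to the singularity, so its time
  average is at most a power of the distance of the base points, and separated sets grow at most
  polynomially in \<open>1 / \<nu>\<close>. Conversely, let \<open>\<theta>' = \<theta> + s\<close>. With a frequency that is at least a power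
  of \<open>s\<close> the orbit of \<open>\<theta>\<close> passes much closer to the singularity than \<open>s\<close>. Both orbits stay
  away from it for a time of order \<open>ln (1 / s)\<close> before and after such a passage, and for large
  \<open>\<alpha>\<close> this lets the fibre point over \<open>\<theta>'\<close> recover to size \<open>1 / \<alpha>\<close> while the one over \<open>\<theta>\<close> is
  still pinched. Hence roughly \<open>1 / s\<close> points are separated with frequency a power of \<open>s\<close>.

  For \<open>\<epsilon> > 0\<close> the forcing is Lipschitz. Either some Birkhoff sum of
  \<open>ln (\<alpha> (\<bar>sin (\<pi>\<theta>)\<bar> + \<epsilon>))\<close> is bounded below by a positive constant, and then orbits stay
  away from \<open>0\<close>, where the contraction is uniform; or these sums are \<open>o(n)\<close> from above, and
  then the fibre points are small except on a set of times of density zero.\<close>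

section \<open>Distance to the integers\<close>

text \<open>The forcing has a logarithmic singularity, so its time averages are not uniform in the
  base point. Cut off at a height J they are: visits above height R are at least of order exp (R /
  d0) steps apart, and summing over the levels gives J plus a constant times the length, for every
  starting point and every time segment. All estimates for the pinched map rest on this bound, which
  takes the place of an ergodic theorem. The set \<Omega> controls the single highest spike before
  time n, which Borel-Cantelli keeps at O(ln n). The same bound fixes the size of \<alpha>: apart
  from the forcing, a step below 1 / \<alpha> gains at least ln \<alpha> - ln 2, and this has to
  exceed the bound for the mean height by 1. In the lower bound the natural unit is x = - ln s.
  Recovery times are linear in x, whereas the radius \<rho> of the close passage is exponentially
  small in x, because the pinched orbit may regain a factor \<alpha> in every step of the recovery;
  hence the frequency is a power of s. Since ln 0 carries no distance, fibre points at 0 are kept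
  apart from the others; this only doubles the number of cells in the upper bounds.\<close>

abbreviation circle_norm :: "real \<Rightarrow> real" where
  "circle_norm y \<equiv> infdist y \<int>"

lemma circle_norm_le: "circle_norm y \<le> \<bar>y - of_int m\<bar>"
  using infdist_le[of "of_int m" \<int> y] by (simp add: dist_real_def)

lemma circle_norm_eq_round: "circle_norm y = \<bar>y - of_int (round y)\<bar>"
proof (rule antisym[OF circle_norm_le])
  show "\<bar>y - of_int (round y)\<bar> \<le> circle_norm y"
    by (rule le_infdist_Ints) (auto simp: dist_real_def abs_minus_commute intro: round_diff_minimal elim!: Ints_cases)
qed

lemma circle_norm_obtain:
  obtains m :: int where "circle_norm y = \<bar>y - of_int m\<bar>"
  using circle_norm_eq_round by blast

lemma circle_norm_le_half: "circle_norm y \<le> 1/2"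
  unfolding circle_norm_eq_round by (metis abs_minus_commute of_int_round_abs_le)

lemma circle_norm_add_of_int: "circle_norm (y + of_int m) = circle_norm y"
proof (rule antisym)
  show "circle_norm (y + of_int m) \<le> circle_norm y"
  proof -
    obtain k where "circle_norm y = \<bar>y - of_int k\<bar>"
      by (rule circle_norm_obtain)
    then show ?thesis using circle_norm_le[of "y + of_int m" "k + m"] by (simp add: algebra_simps)
  qed
  show "circle_norm y \<le> circle_norm (y + of_int m)"
  proof -
    obtain k where "circle_norm (y + of_int m) = \<bar>y + of_int m - of_int k\<bar>"
      by (rule circle_norm_obtain)
    then show ?thesis using circle_norm_le[of y "k - m"] by (simp add: algebra_simps)
  qed
qed

lemma circle_norm_minus: "circle_norm (- y) = circle_norm y"
proof -
  have "circle_norm (- z) \<le> circle_norm z" for z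
  proof -
    obtain k where "circle_norm z = \<bar>z - of_int k\<bar>" by (rule circle_norm_obtain)
    then show ?thesis using circle_norm_le[of "-z" "- k"] by (simp add: algebra_simps abs_minus_commute)
  qed
  from this[of y] this[of "- y"] show ?thesis by simp
qed

lemma circle_norm_diff_commute: "circle_norm (y - z) = circle_norm (z - y)"
  using circle_norm_minus[of "y - z"] by simp

lemma circle_norm_triangle: "circle_norm (y + z) \<le> circle_norm y + circle_norm z"
proof -
  obtain k where "circle_norm y = \<bar>y - of_int k\<bar>" by (rule circle_norm_obtain)
  moreover obtain l where "circle_norm z = \<bar>z - of_int l\<bar>" by (rule circle_norm_obtain)
  ultimately show ?thesis using circle_norm_le[of "y + z" "k + l"] by simp
qed

lemma circle_norm_triangle_diff: "circle_norm (y - z) \<le> circle_norm y + circle_norm z"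
  using circle_norm_triangle[of y "- z"] by (simp add: circle_norm_minus)

lemma circle_norm_le_abs: "circle_norm y \<le> \<bar>y\<bar>"
  using circle_norm_le[of y 0] by simp

lemma circle_norm_frac_diff: "circle_norm (frac y - frac z) = circle_norm (y - z)"
  using circle_norm_add_of_int[of "y - z" "\<lfloor>z\<rfloor> - \<lfloor>y\<rfloor>"] by (simp add: frac_def algebra_simps)

lemma circle_norm_pos_iff: "circle_norm y > 0 \<longleftrightarrow> y \<notin> \<int>"
proof -
  have "y \<in> \<int> \<longleftrightarrow> circle_norm y = 0"
    using in_closed_iff_infdist_zero[of "\<int> :: real set" y] closed_Ints Ints_0 by blast
  then show ?thesis using infdist_nonneg[of y "\<int>"] by linarith
qed

lemma abs_sin_pi_add_of_int: "\<bar>sin (pi * (y + of_int m))\<bar> = \<bar>sin (pi * y)\<bar>"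
proof -
  have "sin (pi * (y + of_int m)) = sin (pi * y) * cos (pi * of_int m)"
    by (simp add: ring_distribs sin_add sin_times_pi_eq_0 mult.commute[of pi])
  moreover have "\<bar>cos (pi * of_int m)\<bar> = 1"
    using cos_npi_int[of m] by (auto simp: mult.commute)
  ultimately show ?thesis by (simp add: abs_mult)
qed

lemma abs_sin_pi_le: "\<bar>sin (pi * y)\<bar> \<le> pi * circle_norm y"
proof -
  obtain m where m: "circle_norm y = \<bar>y - of_int m\<bar>" by (rule circle_norm_obtain)
  have "\<bar>sin (pi * y)\<bar> = \<bar>sin (pi * (y - of_int m))\<bar>"
    using abs_sin_pi_add_of_int[of y "- m"] by simp
  also have "\<dots> \<le> \<bar>pi * (y - of_int m)\<bar>" by (rule abs_sin_x_le_abs_x)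
  finally show ?thesis using m by (simp add: abs_mult)
qed

text \<open>Jordan's inequality: a concave function lies above its chord, here the one from 0 to
  1/2.\<close>

lemma sin_pi_ge:
  assumes "0 \<le> z" "z \<le> 1/2"
  shows "2 * z \<le> sin (pi * z)"
proof -
  have cc: "concave_on {0..1/2} (\<lambda>z. sin (pi * z))"
  proof (rule f''_le0_imp_concave)
    show "((\<lambda>z. sin (pi * z)) has_real_derivative pi * cos (pi * x)) (at x)" for x
      by (auto intro!: derivative_eq_intros)
    show "((\<lambda>z. pi * cos (pi * z)) has_real_derivative - pi\<^sup>2 * sin (pi * x)) (at x)" for x
      by (auto intro!: derivative_eq_intros simp: power2_eq_square)
    show "- pi\<^sup>2 * sin (pi * x) \<le> 0" if "x \<in> {0..1/2}" for x
      using that by (auto intro!: mult_nonneg_nonneg sin_ge_zero simp: mult_le_cancel_left1)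
  qed simp
  show ?thesis
    using concave_onD_Icc'[OF cc, of z] assms by (simp add: sin_pi_half)
qed

lemma abs_sin_pi_ge: "2 * circle_norm y \<le> \<bar>sin (pi * y)\<bar>"
proof -
  obtain m where m: "circle_norm y = \<bar>y - of_int m\<bar>" by (rule circle_norm_obtain)
  have "2 * \<bar>y - of_int m\<bar> \<le> sin (pi * \<bar>y - of_int m\<bar>)"
    by (rule sin_pi_ge) (use m circle_norm_le_half[of y] in auto)
  also have "\<dots> \<le> \<bar>sin (pi * \<bar>y - of_int m\<bar>)\<bar>" by simp
  also have "\<dots> = \<bar>sin (pi * (y - of_int m))\<bar>"
  proof (cases "0 \<le> y - of_int m")
    case False
    then have "pi * \<bar>y - of_int m\<bar> = - (pi * (y - of_int m))" by (simp add: algebra_simps)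
    then show ?thesis by (simp only: sin_minus abs_minus_cancel)
  qed simp
  also have "\<dots> = \<bar>sin (pi * y)\<bar>"
    using abs_sin_pi_add_of_int[of y "- m"] by simp
  finally show ?thesis using m by simp
qed

lemma abs_sin_pi_diff_le: "\<bar>\<bar>sin (pi * y)\<bar> - \<bar>sin (pi * z)\<bar>\<bar> \<le> pi * circle_norm (y - z)"
proof -
  obtain m where m: "circle_norm (y - z) = \<bar>y - z - of_int m\<bar>" by (rule circle_norm_obtain)
  have "\<bar>\<bar>sin (pi * y)\<bar> - \<bar>sin (pi * z)\<bar>\<bar> = \<bar>\<bar>sin (pi * y)\<bar> - \<bar>sin (pi * (z + of_int m))\<bar>\<bar>"
    by (simp only: abs_sin_pi_add_of_int)
  also have "\<dots> \<le> \<bar>sin (pi * y) - sin (pi * (z + of_int m))\<bar>" by (rule abs_triangle_ineq3)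
  also have "\<dots> = \<bar>2 * sin ((pi * y - pi * (z + of_int m)) / 2) * cos ((pi * y + pi * (z + of_int m)) / 2)\<bar>"
    by (simp add: sin_diff_sin)
  also have "\<dots> \<le> 2 * \<bar>(pi * y - pi * (z + of_int m)) / 2\<bar> * 1"
    unfolding abs_mult by (intro mult_mono abs_cos_le_one abs_sin_x_le_abs_x) auto
  also have "\<dots> = \<bar>pi * (y - z - of_int m)\<bar>"
    by (simp add: algebra_simps)
  also have "\<dots> = pi * circle_norm (y - z)" by (simp add: abs_mult m)
  finally show ?thesis .
qed

lemma sin_pi_frac: "sin (pi * frac y) = \<bar>sin (pi * y)\<bar>"
proof -
  have "0 \<le> sin (pi * frac y)"
    by (rule sin_ge_zero) (use frac_ge_0[of y] frac_lt_1[of y] in \<open>auto simp: mult_le_cancel_left1\<close>)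
  then have "sin (pi * frac y) = \<bar>sin (pi * frac y)\<bar>" by simp
  also have "\<dots> = \<bar>sin (pi * y)\<bar>"
    using abs_sin_pi_add_of_int[of y "- \<lfloor>y\<rfloor>"] by (simp add: frac_def)
  finally show ?thesis .
qed

section \<open>Iterates of the forced maps\<close>

text \<open>The base point is an arbitrary real lift: the absolute value makes the forcing
  1-periodic and agrees with \<open>sin (pi * frac y)\<close>, so no reduction mod 1 is carried
  along. The value \<open>\<epsilon> = 0\<close> gives the pinched map.\<close>

primrec fibre_orbit :: "real \<Rightarrow> real \<Rightarrow> real \<Rightarrow> real \<Rightarrow> real \<Rightarrow> nat \<Rightarrow> real" where
  "fibre_orbit \<omega> \<alpha> \<epsilon> y x 0 = x"
| "fibre_orbit \<omega> \<alpha> \<epsilon> y x (Suc n) =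
     tanh (\<alpha> * fibre_orbit \<omega> \<alpha> \<epsilon> y x n) * (\<bar>sin (pi * (y + real n * \<omega>))\<bar> + \<epsilon>)"

lemma pinched_eq_perturbed: "pinched_map \<omega> \<alpha> = perturbed_map \<omega> \<alpha> 0"
  by (auto simp: pinched_map_def perturbed_map_def)

lemma frac_add_frac: "frac (frac y + z) = frac (y + z :: real)"
  by (rule frac_add_simps)

lemma perturbed_map_iterate:
  "(perturbed_map \<omega> \<alpha> \<epsilon> ^^ n) (frac y, x) = (frac (y + real n * \<omega>), fibre_orbit \<omega> \<alpha> \<epsilon> y x n)"
proof (induction n)
  case (Suc n)
  have "frac (frac (y + real n * \<omega>) + \<omega>) = frac (y + real (Suc n) * \<omega>)"
    by (simp add: frac_add_frac algebra_simps)
  then show ?case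
    using Suc by (simp add: perturbed_map_def rotation_def sin_pi_frac)
qed simp

lemma mdist_annulus:
  "mdist annulus_metric p q = max (circle_norm (fst p - fst q)) \<bar>snd p - snd q\<bar>"
  by (simp add: annulus_metric_def mdist_max_prod mdist_circle dist_real_def)

lemma mdist_annulus_iterate:
  assumes "y \<in> {0..<1}" "z \<in> {0..<1}"
  shows "mdist annulus_metric ((perturbed_map \<omega> \<alpha> \<epsilon> ^^ n) (y, x)) ((perturbed_map \<omega> \<alpha> \<epsilon> ^^ n) (z, x'))
    = max (circle_norm (y - z)) \<bar>fibre_orbit \<omega> \<alpha> \<epsilon> y x n - fibre_orbit \<omega> \<alpha> \<epsilon> z x' n\<bar>"
proof -
  have "y = frac y" "z = frac z" using assms by (simp_all add: frac_eq)
  then show ?thesis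
    using perturbed_map_iterate[of n \<omega> \<alpha> \<epsilon> y x] perturbed_map_iterate[of n \<omega> \<alpha> \<epsilon> z x']
    by (simp add: mdist_annulus circle_norm_frac_diff)
qed

definition fibre_gap_count :: "real \<Rightarrow> real \<Rightarrow> real \<Rightarrow> real \<Rightarrow> real \<times> real \<Rightarrow> real \<times> real \<Rightarrow> nat \<Rightarrow> nat" where
  "fibre_gap_count \<omega> \<alpha> \<epsilon> \<delta> p q n =
     card {k. k < n \<and> \<bar>fibre_orbit \<omega> \<alpha> \<epsilon> (fst p) (snd p) k - fibre_orbit \<omega> \<alpha> \<epsilon> (fst q) (snd q) k\<bar> \<ge> \<delta>}"

text \<open>The rotation is an isometry, so base points that start less than \<delta> apart remain
  so, and the maximum in the metric reaches \<delta> only through the fibres.\<close>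

lemma sep_count_eq_fibre_gap_count:
  assumes "fst p \<in> {0..<1}" "fst q \<in> {0..<1}" "circle_norm (fst p - fst q) < \<delta>"
  shows "sep_count (submetric annulus_metric S) (perturbed_map \<omega> \<alpha> \<epsilon>) \<delta> p q n =
    fibre_gap_count \<omega> \<alpha> \<epsilon> \<delta> p q n"
  using assms mdist_annulus_iterate[of "fst p" "fst q" _ \<omega> \<alpha> \<epsilon> "snd p" "snd q"]
  unfolding sep_count_def fibre_gap_count_def
  by (intro arg_cong[of _ _ card]) (auto simp: le_max_iff_disj)

lemma fibre_gap_count_le_sep_count:
  assumes "fst p \<in> {0..<1}" "fst q \<in> {0..<1}"
  shows "fibre_gap_count \<omega> \<alpha> \<epsilon> \<delta> p q n
    \<le> sep_count (submetric annulus_metric S) (perturbed_map \<omega> \<alpha> \<epsilon>) \<delta> p q n"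
  using assms mdist_annulus_iterate[of "fst p" "fst q" _ \<omega> \<alpha> \<epsilon> "snd p" "snd q"]
  unfolding sep_count_def fibre_gap_count_def
  by (intro card_mono) (auto simp: le_max_iff_disj)

lemma sep_count_eq_all:
  assumes "fst p \<in> {0..<1}" "fst q \<in> {0..<1}" "circle_norm (fst p - fst q) \<ge> \<delta>"
  shows "sep_count (submetric annulus_metric S) (perturbed_map \<omega> \<alpha> \<epsilon>) \<delta> p q n = n"
proof -
  have "{k. k < n \<and> mdist (submetric annulus_metric S) ((perturbed_map \<omega> \<alpha> \<epsilon> ^^ k) p)
     ((perturbed_map \<omega> \<alpha> \<epsilon> ^^ k) q) \<ge> \<delta>} = {..<n}"
    using assms mdist_annulus_iterate[of "fst p" "fst q" _ \<omega> \<alpha> \<epsilon> "snd p" "snd q"]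
    by (auto simp: le_max_iff_disj)
  then show ?thesis by (simp add: sep_count_def)
qed

lemma fibre_orbit_zero: "fibre_orbit \<omega> \<alpha> \<epsilon> y 0 n = 0"
  by (induction n) auto

lemma fibre_orbit_pinched_bounds:
  assumes "\<alpha> \<ge> 0" "0 \<le> x" "x \<le> 1"
  shows "0 \<le> fibre_orbit \<omega> \<alpha> 0 y x n" "fibre_orbit \<omega> \<alpha> 0 y x n \<le> 1"
proof -
  have "0 \<le> fibre_orbit \<omega> \<alpha> 0 y x n \<and> fibre_orbit \<omega> \<alpha> 0 y x n \<le> 1"
  proof (induction n)
    case (Suc n)
    have "tanh (\<alpha> * fibre_orbit \<omega> \<alpha> 0 y x n) \<le> 1"
      using tanh_real_lt_1 less_imp_le by blast
    then show ?case using Suc assms by (auto intro!: mult_le_one)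
  qed (use assms in auto)
  then show "0 \<le> fibre_orbit \<omega> \<alpha> 0 y x n" "fibre_orbit \<omega> \<alpha> 0 y x n \<le> 1" by auto
qed

section \<open>The logarithmic contraction of the fibre maps\<close>

text \<open>Insert \<open>exp (2 * y) \<ge> 1 + 2 * y\<close> into
  \<open>tanh y = 1 - 2 / (1 + exp (2 * y))\<close>.\<close>

lemma tanh_lower:
  fixes y :: real
  assumes "0 \<le> y"
  shows "y / (1 + y) \<le> tanh y"
proof -
  have "1 + 2 * y \<le> exp (2 * y)" by (rule exp_ge_add_one_self)
  then have "1 - 2 / (2 + 2 * y) \<le> 1 - 2 / (1 + exp (2 * y))"
    using assms by (intro diff_left_mono divide_left_mono) (auto simp: add_pos_pos)
  moreover have "1 - 2 / (2 + 2 * y) = y / (1 + y)" using assms by (simp add: field_simps)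
  moreover have "tanh y = 1 - 2 / (1 + exp (2 * y))"
  proof -
    have "(1 - 1 / e) / (1 + 1 / e) = 1 - 2 / (1 + e)" if "0 < e" for e :: real
    proof -
      have "(1 - 1 / e) / (1 + 1 / e) = (e * (1 - 1 / e)) / (e * (1 + 1 / e))" using that by simp
      also have "\<dots> = (e - 1) / (1 + e)" using that by (simp add: ring_distribs add.commute)
      also have "\<dots> = 1 - 2 / (1 + e)" using that by (simp add: field_simps)
      finally show ?thesis .
    qed
    from this[of "exp (2 * y)"] show ?thesis
      by (simp add: tanh_real_altdef exp_minus inverse_eq_divide)
  qed
  ultimately show ?thesis by simp
qed

text \<open>This says that the logarithmic derivative of tanh is below 1, the infinitesimal form of
  the contraction in the coordinate ln. The difference of the two sides vanishes at 0 and is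
  increasing.\<close>

lemma tanh_derivative_bound:
  fixes y :: real
  assumes "0 < y"
  shows "y * (1 - (tanh y)\<^sup>2) < tanh y"
proof -
  have "tanh 0 - 0 * (1 - (tanh 0)\<^sup>2) < tanh y - y * (1 - (tanh y)\<^sup>2)"
  proof (rule DERIV_pos_imp_increasing_open[OF assms])
    fix u :: real assume u: "0 < u" "u < y"
    have "((\<lambda>y. tanh y - y * (1 - (tanh y)\<^sup>2)) has_real_derivative
       2 * u * tanh u * (1 - (tanh u)\<^sup>2)) (at u)"
      by (rule derivative_eq_intros refl | simp add: algebra_simps power2_eq_square)+
    moreover have "(tanh u)\<^sup>2 < 1\<^sup>2"
      by (rule power_strict_mono) (use u tanh_real_lt_1 in auto)
    then have "0 < 2 * u * tanh u * (1 - (tanh u)\<^sup>2)" using u by (intro mult_pos_pos) auto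
    ultimately show "\<exists>d. ((\<lambda>y. tanh y - y * (1 - (tanh y)\<^sup>2)) has_real_derivative d) (at u) \<and> 0 < d"
      by blast
  qed (auto intro!: continuous_intros)
  then show ?thesis by simp
qed

text \<open>How far tanh falls short of the identity in the coordinate ln. As it is increasing, tanh
  brings two points closer by exactly the difference of their drops.\<close>

definition log_drop :: "real \<Rightarrow> real" where
  "log_drop y = ln y - ln (tanh y)"

lemma log_drop_strict_mono:
  assumes "0 < y" "y < z"
  shows "log_drop y < log_drop z"
proof (rule DERIV_pos_imp_increasing[OF assms(2)])
  fix u :: real assume u: "y \<le> u" "u \<le> z"
  then have "u > 0" using assms by simp
  have "(log_drop has_real_derivative 1 / u - (1 - (tanh u)\<^sup>2) / tanh u) (at u)"
    unfolding log_drop_def[abs_def]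
    using \<open>u > 0\<close> by (auto intro!: derivative_eq_intros simp: field_simps)
  moreover have "0 < 1 / u - (1 - (tanh u)\<^sup>2) / tanh u"
    using tanh_derivative_bound[OF \<open>u > 0\<close>] \<open>u > 0\<close> by (simp add: field_simps)
  ultimately show "\<exists>d. (log_drop has_real_derivative d) (at u) \<and> 0 < d" by blast
qed

lemma log_drop_mono: "0 < y \<Longrightarrow> y \<le> z \<Longrightarrow> log_drop y \<le> log_drop z"
  using log_drop_strict_mono[of y z] by (cases "y = z") auto

lemma log_drop_le: 
  assumes "0 < y"
  shows "log_drop y \<le> y"
proof -
  have "ln (y / (1 + y)) \<le> ln (tanh y)"
    using assms tanh_lower[of y] by (subst ln_le_cancel_iff) auto
  then have "log_drop y \<le> ln (1 + y)"
    using assms by (simp add: log_drop_def ln_div)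
  also have "\<dots> \<le> y" using assms by (intro ln_add_one_self_le_self) auto
  finally show ?thesis .
qed

lemma tanh_le_self:
  fixes y :: real
  assumes "0 \<le> y"
  shows "tanh y \<le> y"
proof -
  have "tanh y - y \<le> tanh 0 - 0"
  proof (rule DERIV_nonpos_imp_nonincreasing[OF assms])
    fix u :: real
    have "((\<lambda>y. tanh y - y) has_real_derivative - (tanh u)\<^sup>2) (at u)"
      by (auto intro!: derivative_eq_intros)
    then show "\<exists>d. ((\<lambda>y. tanh y - y) has_real_derivative d) (at u) \<and> d \<le> 0" by force
  qed
  then show ?thesis by simp
qed

lemma log_drop_nonneg: "0 < y \<Longrightarrow> 0 \<le> log_drop y"
  using tanh_le_self[of y] by (simp add: log_drop_def)

lemma log_drop_pos: "0 < y \<Longrightarrow> 0 < log_drop y"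
  using log_drop_strict_mono[of "y/2" y] log_drop_nonneg[of "y/2"] by simp

text \<open>The pairs in question do not form a compact set, since x' may tend to 0. By monotonicity
  x' may be replaced by \<open>x - \<delta>/2\<close>, and the resulting function of x alone is
  continuous and positive on the compact interval from \<delta> to 1.\<close>

lemma log_drop_gap:
  assumes "\<alpha> > 0" "\<delta> > 0"
  obtains \<gamma> where "\<gamma> > 0" "\<gamma> \<le> 1"
    "\<And>x x'. 0 < x' \<Longrightarrow> x \<le> 1 \<Longrightarrow> x - x' \<ge> \<delta> \<Longrightarrow> log_drop (\<alpha> * x) - log_drop (\<alpha> * x') \<ge> \<gamma>"
proof (cases "\<delta> \<le> 1")
  case True
  define h where "h x = log_drop (\<alpha> * x) - log_drop (\<alpha> * (x - \<delta>/2))" for x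
  have "continuous_on {\<delta>..1} h"
    unfolding h_def log_drop_def using assms
    by (intro continuous_intros) (auto simp: less_imp_neq[symmetric] mult_le_0_iff)
  then obtain x0 where x0: "x0 \<in> {\<delta>..1}" "\<And>x. x \<in> {\<delta>..1} \<Longrightarrow> h x0 \<le> h x"
    using continuous_attains_inf[of "{\<delta>..1}" h] True by auto
  have "h x0 > 0"
    using x0 assms log_drop_strict_mono[of "\<alpha> * (x0 - \<delta>/2)" "\<alpha> * x0"] by (auto simp: h_def)
  show thesis
  proof (rule that[of "min (h x0) 1"])
    fix x x' :: real assume x: "0 < x'" "x \<le> 1" "x - x' \<ge> \<delta>"
    have "log_drop (\<alpha> * x') \<le> log_drop (\<alpha> * (x - \<delta>/2))"
      using x assms by (intro log_drop_mono) auto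
    then have "h x \<le> log_drop (\<alpha> * x) - log_drop (\<alpha> * x')" by (simp add: h_def)
    then show "min (h x0) 1 \<le> log_drop (\<alpha> * x) - log_drop (\<alpha> * x')"
      using x0(2)[of x] x assms by auto
  qed (use \<open>h x0 > 0\<close> in auto)
next
  case False
  then show thesis by (intro that[of 1]) auto
qed

text \<open>An equality, because \<open>ln\<close>, \<open>log_drop\<close> and
  \<open>ln (tanh _)\<close> are all increasing: the three differences have the same sign, so their
  absolute values subtract like the differences themselves.\<close>

lemma log_tanh_contraction:
  assumes "\<alpha> > 0" "0 < x" "0 < x'"
  shows "\<bar>ln (tanh (\<alpha> * x)) - ln (tanh (\<alpha> * x'))\<bar>
      = \<bar>ln x - ln x'\<bar> - \<bar>log_drop (\<alpha> * x) - log_drop (\<alpha> * x')\<bar>"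
proof -
  have *: "\<bar>ln (tanh (\<alpha> * u)) - ln (tanh (\<alpha> * v))\<bar>
      = \<bar>ln u - ln v\<bar> - \<bar>log_drop (\<alpha> * u) - log_drop (\<alpha> * v)\<bar>" if "0 < v" "v \<le> u" for u v
  proof -
    have "log_drop (\<alpha> * v) \<le> log_drop (\<alpha> * u)" using that assms by (intro log_drop_mono) auto
    moreover have "ln (tanh (\<alpha> * v)) \<le> ln (tanh (\<alpha> * u))" using that assms by simp
    moreover have "ln v \<le> ln u" using that by simp
    moreover have "ln (\<alpha> * u) - ln (\<alpha> * v) = ln u - ln v" using that assms by (simp add: ln_mult)
    ultimately show ?thesis unfolding log_drop_def by linarith
  qed
  show ?thesis
  proof (cases "x' \<le> x")
    case True
    then show ?thesis by (rule *[OF assms(3)])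
  next
    case False
    then show ?thesis
      using *[of x x'] assms(2) by (simp only: abs_minus_commute[of "ln x"] abs_minus_commute[of "ln (tanh (\<alpha> * x))"]
          abs_minus_commute[of "log_drop (\<alpha> * x)"])
  qed
qed

lemma fibre_orbit_pos:
  assumes "\<alpha> > 0" "0 < x" "\<And>k. k < n \<Longrightarrow> 0 < \<bar>sin (pi * (y + real k * \<omega>))\<bar> + \<epsilon>"
  shows "0 < fibre_orbit \<omega> \<alpha> \<epsilon> y x n"
  using assms(3)
proof (induction n)
  case (Suc n)
  then have "0 < fibre_orbit \<omega> \<alpha> \<epsilon> y x n" by simp
  then show ?case using Suc.prems[of n] assms by simp
qed (use assms in simp)

lemma fibre_orbit_log_gap_step:
  fixes \<omega> \<alpha> \<epsilon> y x z x' :: real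
  defines "X \<equiv> fibre_orbit \<omega> \<alpha> \<epsilon> y x" and "Z \<equiv> fibre_orbit \<omega> \<alpha> \<epsilon> z x'"
  assumes "\<alpha> > 0" "0 < X n" "0 < Z n"
    and "0 < \<bar>sin (pi * (y + real n * \<omega>))\<bar> + \<epsilon>" "0 < \<bar>sin (pi * (z + real n * \<omega>))\<bar> + \<epsilon>"
  shows "\<bar>ln (X (Suc n)) - ln (Z (Suc n))\<bar> \<le> \<bar>ln (X n) - ln (Z n)\<bar>
      - \<bar>log_drop (\<alpha> * X n) - log_drop (\<alpha> * Z n)\<bar>
      + \<bar>ln (\<bar>sin (pi * (y + real n * \<omega>))\<bar> + \<epsilon>) - ln (\<bar>sin (pi * (z + real n * \<omega>))\<bar> + \<epsilon>)\<bar>"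
proof -
  have "ln (X (Suc n)) = ln (tanh (\<alpha> * X n)) + ln (\<bar>sin (pi * (y + real n * \<omega>))\<bar> + \<epsilon>)"
    unfolding X_def fibre_orbit.simps by (subst ln_mult_pos) (use assms in \<open>auto simp flip: X_def\<close>)
  moreover have "ln (Z (Suc n)) = ln (tanh (\<alpha> * Z n)) + ln (\<bar>sin (pi * (z + real n * \<omega>))\<bar> + \<epsilon>)"
    unfolding Z_def fibre_orbit.simps by (subst ln_mult_pos) (use assms in \<open>auto simp flip: Z_def\<close>)
  moreover have "\<bar>(a + p) - (b + q)\<bar> \<le> \<bar>a - b\<bar> + \<bar>p - q\<bar>" for a b p q :: real
    by linarith
  ultimately show ?thesis
    using log_tanh_contraction[OF assms(3-5)] by metis
qed

section \<open>Visits of a Diophantine rotation near the singularity\<close>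

text \<open>At an exact hit of the singularity the convention \<open>ln 0 = 0\<close> gives height 0
  instead of \<infinity>, so the counting bounds below hold for every \<open>y\<close>.\<close>

definition sing_height :: "real \<Rightarrow> real \<Rightarrow> nat \<Rightarrow> real" where
  "sing_height \<omega> y k = - ln \<bar>sin (pi * (y + real k * \<omega>))\<bar>"

lemma sing_height_nonneg: "0 \<le> sing_height \<omega> y k"
proof (cases "sin (pi * (y + real k * \<omega>)) = 0")
  case False
  then have "ln \<bar>sin (pi * (y + real k * \<omega>))\<bar> \<le> ln 1"
    by (subst ln_le_cancel_iff) auto
  then show ?thesis by (simp add: sing_height_def)
qed (simp add: sing_height_def)

lemma circle_norm_less_if_sing_height:
  assumes "R < sing_height \<omega> y k"
  shows "circle_norm (y + real k * \<omega>) < exp (- R) / 2"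
proof -
  define s where "s = \<bar>sin (pi * (y + real k * \<omega>))\<bar>"
  have "s < exp (- R)"
  proof (cases "s = 0")
    case False
    then have "0 < s" by (simp add: s_def)
    then have "s = exp (- sing_height \<omega> y k)" by (simp add: sing_height_def s_def)
    then show ?thesis using assms by simp
  qed simp
  then show ?thesis using abs_sin_pi_ge[of "y + real k * \<omega>"] by (simp add: s_def)
qed

lemma sing_height_le:
  assumes "0 < b" "b \<le> circle_norm (y + real k * \<omega>)"
  shows "sing_height \<omega> y k \<le> - ln b"
proof -
  have "b \<le> \<bar>sin (pi * (y + real k * \<omega>))\<bar>"
    using assms abs_sin_pi_ge[of "y + real k * \<omega>"] by linarith
  then show ?thesis using assms by (simp add: sing_height_def)
qed

text \<open>Pigeonhole: cut the time interval into cells of length M; each cell, indexed by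
  \<open>f\<close>, contains at most one element.\<close>

lemma card_spaced_le:
  fixes A :: "nat set" and M :: real
  assumes "A \<subseteq> {m..<n}" "M > 0" "m \<le> n"
    and gap: "\<And>k k'. k \<in> A \<Longrightarrow> k' \<in> A \<Longrightarrow> k < k' \<Longrightarrow> M \<le> real (k' - k)"
  shows "real (card A) \<le> 1 + (real n - real m) / M"
proof -
  define f where "f k = \<lfloor>(real k - real m) / M\<rfloor>" for k
  have lt: "f k < f k'" if "k \<in> A" "k' \<in> A" "k < k'" for k k'
  proof -
    have "M \<le> real k' - real k" using gap[OF that] that by simp
    then have "(real k - real m) / M + 1 \<le> (real k' - real m) / M"
      using assms(2) by (simp add: le_divide_eq distrib_right)
    then show ?thesis unfolding f_def by linarith
  qed
  have inj: "inj_on f A"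
    by (rule inj_onI) (metis lt less_irrefl nat_neq_iff)
  have sub: "f ` A \<subseteq> {0..\<lfloor>(real n - real m) / M\<rfloor>}"
    using assms(1,2) by (auto simp: f_def divide_simps subset_iff intro!: floor_mono)
  have "card A = card (f ` A)" using inj by (simp add: card_image)
  also have "\<dots> \<le> card {0..\<lfloor>(real n - real m) / M\<rfloor>}"
    using sub by (intro card_mono) auto
  also have "real \<dots> \<le> 1 + (real n - real m) / M"
    using assms(2,3) by simp
  finally show ?thesis by simp
qed

text \<open>Layer-cake decomposition into unit levels. It reduces a sum of heights to counts of
  visits above a level, and the cut-off at J leaves only finitely many levels.\<close>

lemma min_le_sum_indicator:
  fixes v R :: real
  shows "min (max 0 (v - R)) (real J) \<le> (\<Sum>j<J. of_bool (R + real j < v))"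
proof (induction J)
  case (Suc J)
  show ?case
  proof (cases "R + real J < v")
    case True
    then have "(\<Sum>j<Suc J. of_bool (R + real j < v)) = (\<Sum>j<Suc J. (1::real))"
      by (intro sum.cong) auto
    then show ?thesis by simp
  next
    case False
    then show ?thesis using Suc by (auto simp: min_def max_def split: if_splits)
  qed
qed simp

text \<open>The condition on the two-sided orbit gives invariance under the inverse rotation as
  well. In the second condition the bound is summable in k, so that Borel-Cantelli applies, and it
  limits the heights before time n to \<open>2 * ln n\<close> plus a constant.\<close>

definition generic_base :: "real \<Rightarrow> real set" where
  "generic_base \<omega> = {\<theta>\<in>{0..<1}. (\<forall>k::int. \<theta> + of_int k * \<omega> \<notin> \<int>) \<and>
     (\<exists>C>0. \<forall>k::nat. C / (real k + 1)\<^sup>2 \<le> circle_norm (\<theta> + real k * \<omega>))}"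

text \<open>A shift of time by one only changes the constant: forwards by the factor 4, from
  \<open>(k + 2)^2 \<le> 4 * (k + 1)^2\<close>; backwards one new time appears, whose distance to
  the integers is positive by the two-sided condition.\<close>

lemma rotation_generic_base: "rotation \<omega> ` generic_base \<omega> = generic_base \<omega>"
proof
  have shift: "frac z + w \<in> \<int> \<longleftrightarrow> z + w \<in> \<int>" for z w :: real
    using frac_eq_0_iff[of "frac z + w"] frac_eq_0_iff[of "z + w"] by simp
  have norm: "circle_norm (frac z + w) = circle_norm (z + w)" for z w
    using circle_norm_frac_diff[of "frac z + w" 0] circle_norm_frac_diff[of "z + w" 0]
    by simp
  show "rotation \<omega> ` generic_base \<omega> \<subseteq> generic_base \<omega>"
  proof
    fix \<theta>' assume "\<theta>' \<in> rotation \<omega> ` generic_base \<omega>"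
    then obtain \<theta> C where t: "\<theta>' = frac (\<theta> + \<omega>)" "\<And>k::int. \<theta> + of_int k * \<omega> \<notin> \<int>"
      "C > 0" "\<And>k::nat. C / (real k + 1)\<^sup>2 \<le> circle_norm (\<theta> + real k * \<omega>)"
      by (auto simp: generic_base_def rotation_def)
    have "\<theta>' + of_int k * \<omega> \<notin> \<int>" for k :: int
      using t(2)[of "k + 1"] by (simp add: t(1) shift algebra_simps)
    moreover have "(C / 4) / (real k + 1)\<^sup>2 \<le> circle_norm (\<theta>' + real k * \<omega>)" for k :: nat
    proof -
      have "(real k + 2)\<^sup>2 \<le> (2 * (real k + 1))\<^sup>2" by (rule power_mono) auto
      then have "(real k + 2)\<^sup>2 \<le> 4 * (real k + 1)\<^sup>2" by (simp only: power_mult_distrib) simp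
      then have "(C / 4) / (real k + 1)\<^sup>2 \<le> C / (real k + 2)\<^sup>2"
        using t(3) by (simp add: divide_simps)
      also have "\<dots> \<le> circle_norm (\<theta> + real (Suc k) * \<omega>)" using t(4)[of "Suc k"] by (simp add: add.commute)
      also have "\<dots> = circle_norm (\<theta>' + real k * \<omega>)" by (simp add: t(1) norm algebra_simps)
      finally show ?thesis .
    qed
    ultimately show "\<theta>' \<in> generic_base \<omega>"
      using t(1,3) by (auto simp: generic_base_def frac_lt_1 intro!: exI[of _ "C / 4"])
  qed
  show "generic_base \<omega> \<subseteq> rotation \<omega> ` generic_base \<omega>"
  proof
    fix \<theta> assume "\<theta> \<in> generic_base \<omega>"
    then obtain C where t: "\<theta> \<in> {0..<1}" "\<And>k::int. \<theta> + of_int k * \<omega> \<notin> \<int>"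
      "C > 0" "\<And>k::nat. C / (real k + 1)\<^sup>2 \<le> circle_norm (\<theta> + real k * \<omega>)"
      by (auto simp: generic_base_def)
    define \<theta>' where "\<theta>' = frac (\<theta> - \<omega>)"
    define C' where "C' = min C (circle_norm (\<theta> - \<omega>))"
    have pos: "0 < circle_norm (\<theta> - \<omega>)" using t(2)[of "-1"] by (simp add: circle_norm_pos_iff)
    have "rotation \<omega> \<theta>' = \<theta>" using t(1) by (simp add: rotation_def \<theta>'_def frac_eq)
    moreover have "\<theta>' + of_int k * \<omega> \<notin> \<int>" for k :: int
      using t(2)[of "k - 1"] by (simp add: \<theta>'_def shift algebra_simps)
    moreover have "C' / (real k + 1)\<^sup>2 \<le> circle_norm (\<theta>' + real k * \<omega>)" for k :: nat
    proof (cases k)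
      case 0
      then show ?thesis using norm[of "\<theta> - \<omega>" 0] by (simp add: \<theta>'_def C'_def)
    next
      case (Suc j)
      have "C' / (real k + 1)\<^sup>2 \<le> C / (real j + 1)\<^sup>2"
        using t(3) pos Suc by (intro frac_le power_mono) (auto simp: C'_def)
      also have "\<dots> \<le> circle_norm (\<theta> + real j * \<omega>)" by (rule t(4))
      also have "\<dots> = circle_norm (\<theta>' + real k * \<omega>)"
        using norm[of "\<theta> - \<omega>" "real k * \<omega>"] by (simp add: \<theta>'_def Suc algebra_simps)
      finally show ?thesis .
    qed
    moreover have "C' > 0" using t(3) pos by (simp add: C'_def)
    ultimately show "\<theta> \<in> rotation \<omega> ` generic_base \<omega>"
      by (intro image_eqI[of _ _ \<theta>']) (auto simp: generic_base_def \<theta>'_def frac_lt_1)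
  qed
qed

lemma generic_base_full_measure: "{0..<1} - generic_base \<omega> \<in> null_sets lebesgue"
proof -
  define r where "r k = 1 / (real k + 1)\<^sup>2" for k :: nat
  define I where "I k i = {of_int (\<lfloor>real k * \<omega>\<rfloor> + i) - real k * \<omega> - r k <..<
      of_int (\<lfloor>real k * \<omega>\<rfloor> + i) - real k * \<omega> + r k}" for k :: nat and i :: int
  \<comment> \<open>The integer nearest to \<open>x + k * \<omega>\<close> with x in [0,1) differs
    from the floor of \<open>k * \<omega>\<close> by an amount within this range. The five intervals
    of length \<open>2 * r k\<close> cover the points too close at time k and have total length at
    most \<open>10 * r k\<close>.\<close>
  define A where "A k = (\<Union>i\<in>{-1..3}. I k i)" for k
  have r_nonneg: "r k \<ge> 0" for k by (simp add: r_def)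
  have A_sets: "A k \<in> sets lborel" for k by (auto simp: A_def I_def)
  have mI: "measure lborel (I k i) = 2 * r k" for k i
    unfolding I_def using r_nonneg[of k] by simp
  have finI: "emeasure lborel (I k i) < \<infinity>" for k i
    unfolding I_def using r_nonneg[of k] by simp
  have finA: "emeasure lborel (A k) < \<infinity>" for k
  proof -
    have "bounded (A k)" unfolding A_def I_def by (intro bounded_UN) auto
    then show ?thesis by (rule emeasure_bounded_finite)
  qed
  have mA: "measure lborel (A k) \<le> 10 * r k" for k
  proof -
    have "measure lborel (A k) \<le> (\<Sum>i\<in>{-1..3::int}. measure lborel (I k i))"
      unfolding A_def by (rule measure_UNION_le) (auto simp: I_def)
    also have "\<dots> = 10 * r k" by (simp add: mI)
    finally show ?thesis .
  qed
  have "summable (\<lambda>k. 10 * r k)"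
    unfolding r_def using summable_Suc_iff[THEN iffD2, OF inverse_power_summable[of 2, where 'a = real]]
    by (intro summable_mult) (simp add: inverse_eq_divide power_one_over add.commute)
  then have summ: "summable (\<lambda>k. measure lborel (A k))"
    by (rule summable_comparison_test') (use mA in auto)
  have "AE x in lborel. eventually (\<lambda>k. x \<in> space lborel - A k) sequentially"
    by (rule borel_cantelli_AE1) (use A_sets finA summ in auto)
  moreover
  define N where "N = (\<Union>k::int. \<Union>m::int. {of_int m - of_int k * \<omega>})"
  have "N \<in> null_sets lborel"
    unfolding N_def by (intro countable_imp_null_set_lborel countable_UN) auto
  then have "AE x in lborel. x \<notin> N" by (rule AE_not_in)
  ultimately have "AE x in lborel. x \<in> {0..<1} \<longrightarrow> x \<in> generic_base \<omega>"
  proof eventually_elim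
    case (elim x)
    show ?case
    proof
      assume x: "x \<in> {0..<1}"
      have notin: "x + of_int k * \<omega> \<notin> \<int>" for k :: int
      proof
        assume "x + of_int k * \<omega> \<in> \<int>"
        then obtain m where "x + of_int k * \<omega> = of_int m" by (auto elim: Ints_cases)
        then have "x = of_int m - of_int k * \<omega>" by simp
        then show False using elim(2) by (auto simp: N_def)
      qed
      obtain k0 where k0: "\<And>k. k \<ge> k0 \<Longrightarrow> x \<notin> A k"
        using elim(1) by (auto simp: eventually_sequentially)
      have large: "r k \<le> circle_norm (x + real k * \<omega>)" if "k \<ge> k0" for k
      proof (rule ccontr)
        assume *: "\<not> r k \<le> circle_norm (x + real k * \<omega>)"
        define m where "m = round (x + real k * \<omega>)"
        have m: "\<bar>x + real k * \<omega> - of_int m\<bar> < r k"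
          using * by (simp add: m_def circle_norm_eq_round)
        have "\<bar>x + real k * \<omega> - of_int m\<bar> \<le> 1/2"
          unfolding m_def by (metis abs_minus_commute of_int_round_abs_le)
        then have "m - \<lfloor>real k * \<omega>\<rfloor> \<in> {-1..3}" using x by (auto; linarith)
        moreover have "x \<in> I k (m - \<lfloor>real k * \<omega>\<rfloor>)" using m by (auto simp: I_def abs_less_iff)
        ultimately have "x \<in> A k" by (auto simp: A_def)
        with k0[OF that] show False by contradiction
      qed
      \<comment> \<open>From \<open>k0\<close> on the constant 1 works by Borel-Cantelli; the
        finitely many earlier distances are positive because x avoids the countable set N.\<close>
      define C where "C = Min (insert 1 ((\<lambda>k. circle_norm (x + real k * \<omega>)) ` {..<k0}))"
      have "C > 0"
        using notin[of "int _"] by (auto simp: C_def circle_norm_pos_iff)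
      moreover have "C / (real k + 1)\<^sup>2 \<le> circle_norm (x + real k * \<omega>)" for k :: nat
      proof (cases "k < k0")
        case True
        have "C / (real k + 1)\<^sup>2 \<le> C / 1"
          using \<open>C > 0\<close> by (intro divide_left_mono) auto
        also have "C / 1 \<le> circle_norm (x + real k * \<omega>)"
          unfolding C_def div_by_1 by (intro Min_le) (use True in auto)
        finally show ?thesis .
      next
        case False
        have "C \<le> 1" unfolding C_def by (intro Min_le) auto
        then have "C / (real k + 1)\<^sup>2 \<le> r k" by (simp add: r_def divide_right_mono)
        then show ?thesis using large[of k] False by simp
      qed
      ultimately show "x \<in> generic_base \<omega>" using x notin by (auto simp: generic_base_def)
    qed
  qed
  then obtain N' where "N' \<in> null_sets lborel" "{x. \<not> (x \<in> {0..<1} \<longrightarrow> x \<in> generic_base \<omega>)} \<subseteq> N'"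
    unfolding eventually_ae_filter by auto
  then show ?thesis
    using null_sets_completion_subset[of "{0..<1} - generic_base \<omega>" N' lborel]
      null_sets_completionI[of N' lborel] by (simp add: subset_iff)
qed

lemma generic_base_sing_height:
  assumes "\<theta> \<in> generic_base \<omega>"
  obtains D where "\<And>n k. k < n \<Longrightarrow> sing_height \<omega> \<theta> k \<le> D + 2 * ln (real n)"
proof -
  obtain C where C: "C > 0" "\<And>k::nat. C / (real k + 1)\<^sup>2 \<le> circle_norm (\<theta> + real k * \<omega>)"
    using assms by (auto simp: generic_base_def)
  show thesis
  proof (rule that[of "- ln C"])
    fix n k :: nat assume "k < n"
    have "C / (real n)\<^sup>2 \<le> C / (real k + 1)\<^sup>2"
      using C(1) \<open>k < n\<close> by (intro divide_left_mono power_mono) auto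
    also have "\<dots> \<le> circle_norm (\<theta> + real k * \<omega>)" by (rule C(2))
    finally have "sing_height \<omega> \<theta> k \<le> - ln (C / (real n)\<^sup>2)"
      using C(1) \<open>k < n\<close> by (intro sing_height_le) auto
    also have "\<dots> = - ln C + 2 * ln (real n)"
      using C(1) \<open>k < n\<close> by (simp add: ln_div ln_realpow)
    finally show "sing_height \<omega> \<theta> k \<le> - ln C + 2 * ln (real n)" .
  qed
qed

lemma generic_base_sin_pos:
  assumes "\<theta> \<in> generic_base \<omega>"
  shows "0 < \<bar>sin (pi * (\<theta> + real k * \<omega>))\<bar>"
proof -
  have "0 < circle_norm (\<theta> + real k * \<omega>)"
    using assms by (auto simp: generic_base_def circle_norm_pos_iff dest: spec[of _ "int k"])
  then show ?thesis using abs_sin_pi_ge[of "\<theta> + real k * \<omega>"] by linarith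
qed

text \<open>Each of the disjoint blocks of length K contributes a visit; the 1 pays for the
  incomplete last block.\<close>

lemma card_visits_ge:
  assumes "K > 0" "\<And>m. \<exists>k\<in>{m..<m + K}. P k"
  shows "real n / real K - 1 \<le> real (card {k\<in>{m..<m + n}. P k})"
proof -
  have blocks: "b \<le> card {k\<in>{m..<m + b * K}. P k}" for b
  proof (induction b)
    case (Suc b)
    obtain k where k: "k \<in> {m + b * K..<m + b * K + K}" "P k" using assms(2) by blast
    have "Suc b \<le> card (insert k {k\<in>{m..<m + b * K}. P k})"
      using Suc k by (subst card_insert_disjoint) auto
    also have "\<dots> \<le> card {k\<in>{m..<m + Suc b * K}. P k}"
      using k by (intro card_mono) auto
    finally show ?case .
  qed simp
  have "real n / real K - 1 \<le> real (n div K)"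
    using floor_divide_of_nat_eq[of n K, where ?'a = real] by linarith
  also have "\<dots> \<le> real (card {k\<in>{m..<m + (n div K) * K}. P k})" using blocks by simp
  also have "\<dots> \<le> real (card {k\<in>{m..<m + n}. P k})"
    unfolding of_nat_le_iff by (intro card_mono) (auto intro: order.strict_trans2 add_left_mono)
  finally show ?thesis .
qed

section \<open>Frequency of close approaches under the Diophantine condition\<close>

locale diophantine_rotation =
  fixes \<omega> c d0 :: real
  assumes c_pos: "c > 0" and d0_pos: "d0 > 0"
    and diophantine_bound: "\<And>n::nat. n \<ge> 1 \<Longrightarrow> c * real n powr (- d0) \<le> circle_norm (real n * \<omega>)"
begin

text \<open>The geometric series over j of the frequencies
  \<open>c powr (- (1 / d0)) * exp (- (j / d0))\<close> with which height j can be exceeded; it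
  bounds the mean of the truncated heights for every base point.\<close>

definition sing_const :: real where
  "sing_const = c powr (- (1 / d0)) / (1 - exp (- (1 / d0)))"

lemma sing_const_pos: "sing_const > 0"
  using c_pos d0_pos by (simp add: sing_const_def)

text \<open>At a height above R the orbit is within exp (- R) / 2 of an integer. Hence if two such
  times differ by g, then \<open>g * \<omega>\<close> is within exp (- R) of an integer, and the
  Diophantine bound forces g to be at least M.\<close>

lemma card_high_le:
  assumes "m \<le> n"
  shows "real (card {k\<in>{m..<n}. R < sing_height \<omega> y k})
    \<le> 1 + (real n - real m) * (c powr (- (1 / d0)) * exp (- (R / d0)))"
proof -
  define M where "M = (c * exp R) powr (1 / d0)"
  have "M > 0" using c_pos by (simp add: M_def)
  have "real (card {k\<in>{m..<n}. R < sing_height \<omega> y k}) \<le> 1 + (real n - real m) / M"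
  proof (rule card_spaced_le[OF _ \<open>M > 0\<close> assms])
    fix k k' assume k: "k \<in> {k\<in>{m..<n}. R < sing_height \<omega> y k}"
      "k' \<in> {k\<in>{m..<n}. R < sing_height \<omega> y k}" "k < k'"
    define g where "g = real (k' - k)"
    have "g > 0" using k by (simp add: g_def)
    have "c * g powr (- d0) \<le> circle_norm (g * \<omega>)"
      unfolding g_def using k by (intro diophantine_bound) auto
    also have "g * \<omega> = (y + real k' * \<omega>) - (y + real k * \<omega>)"
      using k by (simp add: g_def algebra_simps of_nat_diff)
    also have "circle_norm \<dots> \<le> circle_norm (y + real k' * \<omega>) + circle_norm (y + real k * \<omega>)"
      by (rule circle_norm_triangle_diff)
    also have "\<dots> < exp (- R)"
      using circle_norm_less_if_sing_height[of R \<omega> y k] circle_norm_less_if_sing_height[of R \<omega> y k'] k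
      by simp
    finally have "c * exp R < g powr d0"
      using \<open>g > 0\<close> by (simp add: powr_minus exp_minus field_simps)
    then have "M \<le> (g powr d0) powr (1 / d0)"
      unfolding M_def using c_pos d0_pos by (intro powr_mono2) auto
    also have "\<dots> = g" using d0_pos \<open>g > 0\<close> by (simp add: powr_powr)
    finally show "M \<le> real (k' - k)" by (simp add: g_def)
  qed auto
  also have "(real n - real m) / M = (real n - real m) * (c powr (- (1 / d0)) * exp (- (R / d0)))"
    unfolding M_def using c_pos by (simp add: powr_mult powr_minus exp_minus exp_powr_real divide_simps)
  finally show ?thesis .
qed

text \<open>The visit frequencies decay geometrically over the levels \<open>R + j\<close>, and the
  additive 1 in each count is paid once per level, J times in all. The cut-off cannot be dropped for
  arbitrary \<open>y\<close>, as a single passage may be arbitrarily high.\<close>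

lemma sum_truncated_excess_le:
  assumes "m \<le> n"
  shows "(\<Sum>k\<in>{m..<n}. min (max 0 (sing_height \<omega> y k - R)) (real J))
     \<le> real J + (real n - real m) * (sing_const * exp (- (R / d0)))"
proof -
  define B where "B = (real n - real m) * (c powr (- (1 / d0)) * exp (- (R / d0)))"
  have "B \<ge> 0" using assms by (simp add: B_def)
  have "(\<Sum>k\<in>{m..<n}. min (max 0 (sing_height \<omega> y k - R)) (real J))
     \<le> (\<Sum>k\<in>{m..<n}. \<Sum>j<J. of_bool (R + real j < sing_height \<omega> y k))"
    by (intro sum_mono min_le_sum_indicator)
  also have "\<dots> = (\<Sum>j<J. \<Sum>k\<in>{m..<n}. of_bool (R + real j < sing_height \<omega> y k))"
    by (rule sum.swap)
  also have "\<dots> = (\<Sum>j<J. real (card {k\<in>{m..<n}. R + real j < sing_height \<omega> y k}))"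
    by (simp add: sum_of_bool_eq Int_def)
  also have "\<dots> \<le> (\<Sum>j<J. 1 + B * exp (- (1 / d0)) ^ j)"
  proof (rule sum_mono)
    fix j
    have "exp (- ((R + real j) / d0)) = exp (- (R / d0)) * exp (- (1 / d0)) ^ j"
      by (simp add: add_divide_distrib flip: exp_add exp_of_nat_mult)
    then show "real (card {k\<in>{m..<n}. R + real j < sing_height \<omega> y k}) \<le> 1 + B * exp (- (1 / d0)) ^ j"
      using card_high_le[OF assms, of "R + real j" y] by (simp add: B_def mult.assoc)
  qed
  also have "\<dots> = real J + B * (\<Sum>j<J. exp (- (1 / d0)) ^ j)"
    by (simp add: sum.distrib sum_distrib_left)
  also have "\<dots> \<le> real J + B * (1 / (1 - exp (- (1 / d0))))"
  proof -
    have "(\<Sum>j<J. exp (- (1 / d0)) ^ j) \<le> (\<Sum>j. exp (- (1 / d0)) ^ j)"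
      using d0_pos by (intro sum_le_suminf summable_geometric) auto
    also have "\<dots> = 1 / (1 - exp (- (1 / d0)))" using d0_pos by (intro suminf_geometric) auto
    finally show ?thesis using \<open>B \<ge> 0\<close> by (intro add_left_mono mult_left_mono)
  qed
  also have "\<dots> = real J + (real n - real m) * (sing_const * exp (- (R / d0)))"
    by (simp add: B_def sing_const_def)
  finally show ?thesis .
qed

text \<open>On the generic base no height before time n exceeds a logarithm of n plus a constant. A
  cut-off J at that level changes nothing, and its cost J is o(n).\<close>

lemma eventually_sum_excess_le:
  assumes "\<theta> \<in> generic_base \<omega>" "e > 0"
  shows "\<forall>\<^sub>F n in sequentially. (\<Sum>k<n. max 0 (sing_height \<omega> \<theta> k - R))
     \<le> real n * (sing_const * exp (- (R / d0)) + e)"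
proof -
  obtain D where D: "\<And>n k. k < n \<Longrightarrow> sing_height \<omega> \<theta> k \<le> D + 2 * ln (real n)"
    using generic_base_sing_height[OF assms(1)] by blast
  have "((\<lambda>n. (\<bar>D - R\<bar> + 1) / real n + 2 * (ln (real n) / real n)) \<longlongrightarrow> 0 + 2 * 0) sequentially"
    using lim_ln_over_n
    by (intro tendsto_intros tendsto_divide_0[OF tendsto_const] filterlim_at_top_imp_at_infinity
        filterlim_real_sequentially)
  then have "\<forall>\<^sub>F n in sequentially. (\<bar>D - R\<bar> + 1) / real n + 2 * (ln (real n) / real n) < e"
    using assms(2) by (auto dest: order_tendstoD(2)[where a = e])
  moreover have "\<forall>\<^sub>F n in sequentially. n > 0" by (rule eventually_gt_at_top)
  ultimately show ?thesis
  proof eventually_elim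
    case (elim n)
    define J where "J = nat \<lceil>\<bar>D - R\<bar> + 2 * ln (real n)\<rceil>"
    have "0 \<le> ln (real n)" using elim by simp
    then have J: "\<bar>D - R\<bar> + 2 * ln (real n) \<le> real J" "real J \<le> \<bar>D - R\<bar> + 2 * ln (real n) + 1"
      unfolding J_def by linarith+
    have "(\<Sum>k<n. max 0 (sing_height \<omega> \<theta> k - R))
       = (\<Sum>k\<in>{0..<n}. min (max 0 (sing_height \<omega> \<theta> k - R)) (real J))"
    proof (rule sum.cong)
      fix k assume "k \<in> {0..<n}"
      then have "sing_height \<omega> \<theta> k - R \<le> real J" using D[of k n] J(1) by simp
      then show "max 0 (sing_height \<omega> \<theta> k - R) = min (max 0 (sing_height \<omega> \<theta> k - R)) (real J)"
        by simp
    qed auto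
    also have "\<dots> \<le> real J + (real n - real 0) * (sing_const * exp (- (R / d0)))"
      by (rule sum_truncated_excess_le) simp
    also have "real J \<le> real n * e"
    proof -
      have "(\<bar>D - R\<bar> + 1 + 2 * ln (real n)) / real n < e"
        using elim by (simp add: add_divide_distrib)
      then have "\<bar>D - R\<bar> + 1 + 2 * ln (real n) < e * real n"
        using elim by (simp add: divide_less_eq)
      then show ?thesis using J(2) by (simp add: mult.commute)
    qed
    finally show ?case by (simp add: algebra_simps)
  qed
qed

text \<open>A walk on the circle with steps shorter than \<rho> cannot jump over a window of length
  \<rho>. For v > 0 the lift in (-1,0] is moved up to its first positive value, for v < 0 the lift
  in (0,1] is moved down to its last positive value.\<close>

lemma small_step:
  fixes v :: real
  assumes "0 < \<bar>v\<bar>" "\<bar>v\<bar> < \<rho>" "\<bar>v\<bar> \<le> 1"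
  obtains j :: nat and m :: int where "real j \<le> 2 / \<bar>v\<bar>" "0 < y + real j * v - of_int m" "y + real j * v - of_int m < \<rho>"
proof (cases "v > 0")
  case True
  define y0 where "y0 = y - of_int \<lceil>y\<rceil>"
  have y0: "-1 < y0" "y0 \<le> 0" unfolding y0_def by linarith+
  define j where "j = nat (\<lfloor>- y0 / v\<rfloor> + 1)"
  have "0 \<le> \<lfloor>- y0 / v\<rfloor>" using y0 True by (simp add: divide_le_0_iff)
  then have j: "real j = of_int \<lfloor>- y0 / v\<rfloor> + 1" by (simp add: j_def)
  then have "- y0 / v < real j" "real j \<le> - y0 / v + 1" by linarith+
  then have *: "- y0 < real j * v" "real j * v \<le> - y0 + v"
    using True by (simp_all add: field_simps)
  have "real j * v \<le> 2" using * y0 assms by simp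
  then have "real j \<le> 2 / \<bar>v\<bar>" using True by (simp add: field_simps)
  then show thesis
    by (rule that[of _ "\<lceil>y\<rceil>"]) (use * assms True in \<open>auto simp: y0_def\<close>)
next
  case False
  define w where "w = - v"
  have w: "w > 0" "w < \<rho>" "\<bar>v\<bar> = w" using False assms by (auto simp: w_def)
  define y0 where "y0 = y - of_int (\<lceil>y\<rceil> - 1)"
  have y0: "0 < y0" "y0 \<le> 1" unfolding y0_def by linarith+
  define j where "j = nat (\<lceil>y0 / w\<rceil> - 1)"
  have "1 \<le> \<lceil>y0 / w\<rceil>" using y0 w by simp
  then have j: "real j = of_int \<lceil>y0 / w\<rceil> - 1" by (simp add: j_def)
  then have "real j < y0 / w" "y0 / w \<le> real j + 1" by linarith+
  then have *: "real j * w < y0" "y0 \<le> real j * w + w"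
    using w by (simp_all add: field_simps)
  have "real j * w \<le> 2" using * y0 by simp
  then have "real j \<le> 2 / \<bar>v\<bar>" using w by (simp add: field_simps)
  then show thesis
    by (rule that[of _ "\<lceil>y\<rceil> - 1"]) (use * w in \<open>auto simp: y0_def w_def\<close>)
qed

text \<open>Dirichlet's theorem with N of order 1 / \<rho> gives q \<le> N such that
  \<open>q * \<omega>\<close> is a step v shorter than \<rho>. The Diophantine condition bounds v
  below by a multiple of \<open>N powr (- d0)\<close>, so about \<open>N powr d0\<close> multiples
  of q, of at most N steps each, go round the circle.\<close>

lemma visiting_time:
  assumes "0 < \<rho>" "\<rho> \<le> 1"
  obtains K :: nat where "0 < K" "real K \<le> 8 / c * (2 / \<rho>) powr (1 + d0)"
    "\<And>y. \<exists>k<K. \<exists>m::int. 0 < y + real k * \<omega> - of_int m \<and> y + real k * \<omega> - of_int m < \<rho>"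
proof -
  define N where "N = nat \<lceil>1 / \<rho>\<rceil>"
  have N: "1 / \<rho> \<le> real N" "real N \<le> 2 / \<rho>" "N > 0"
  proof -
    have "1 \<le> 1 / \<rho>" using assms by simp
    then show "1 / \<rho> \<le> real N" "real N \<le> 2 / \<rho>" "N > 0" unfolding N_def by linarith+
  qed
  obtain h q where hq: "0 < q" "q \<le> int N" "\<bar>of_int q * \<omega> - of_int h\<bar> < 1 / real N"
    using Dirichlet_approx[OF \<open>N > 0\<close>] by metis
  define v where "v = of_int q * \<omega> - of_int h"
  define q' where "q' = nat q"
  have q': "1 \<le> q'" "q' \<le> N" "of_int q = real q'" using hq by (auto simp: q'_def)
  have "c * real N powr (- d0) \<le> c * real q' powr (- d0)"
    using q' c_pos d0_pos by (intro mult_left_mono powr_mono2') auto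
  also have "\<dots> \<le> circle_norm (real q' * \<omega>)" by (rule diophantine_bound[OF q'(1)])
  also have "\<dots> \<le> \<bar>v\<bar>" using circle_norm_le[of "real q' * \<omega>" h] by (simp add: v_def q')
  finally have v_low: "c * real N powr (- d0) \<le> \<bar>v\<bar>" .
  have v_pos: "0 < \<bar>v\<bar>" using v_low c_pos N(3) by (smt (verit) mult_pos_pos powr_gt_zero of_nat_0_less_iff)
  have "1 / real N \<le> \<rho>" using N assms by (simp add: field_simps)
  then have v_rho: "\<bar>v\<bar> < \<rho>" using hq by (simp add: v_def)
  then have v_le1: "\<bar>v\<bar> \<le> 1" using assms by simp
  define K where "K = nat \<lceil>2 * real N / \<bar>v\<bar>\<rceil> + 1"
  have big: "2 \<le> 2 * real N / \<bar>v\<bar>" using v_pos v_le1 N(3) by (simp add: field_simps)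
  show thesis
  proof (rule that[of K])
    show "0 < K" by (simp add: K_def)
    have "real K \<le> 2 * real N / \<bar>v\<bar> + 2" unfolding K_def using big by linarith
    also have "\<dots> \<le> 4 * real N / \<bar>v\<bar>" using big by simp
    also have "\<dots> \<le> 4 * real N / (c * real N powr (- d0))"
      using v_low c_pos N(3) v_pos by (intro divide_left_mono) auto
    also have "\<dots> = 4 / c * real N powr (1 + d0)"
      using N(3) c_pos by (simp add: powr_add powr_minus field_simps)
    also have "\<dots> \<le> 4 / c * (2 / \<rho>) powr (1 + d0)"
      using N c_pos d0_pos by (intro mult_left_mono powr_mono2) auto
    also have "\<dots> \<le> 8 / c * (2 / \<rho>) powr (1 + d0)"
      using c_pos by (intro mult_right_mono divide_right_mono) auto
    finally show "real K \<le> 8 / c * (2 / \<rho>) powr (1 + d0)" .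
    fix y
    obtain j m where jm: "real j \<le> 2 / \<bar>v\<bar>" "0 < y + real j * v - of_int m" "y + real j * v - of_int m < \<rho>"
      using small_step[OF v_pos v_rho v_le1, of y] by metis
    have "real (q' * j) \<le> real N * (2 / \<bar>v\<bar>)"
      unfolding of_nat_mult using jm q' by (intro mult_mono) auto
    then have "real (q' * j) \<le> 2 * real N / \<bar>v\<bar>" by (simp add: mult.commute)
    then have "q' * j < K" unfolding K_def by linarith
    moreover have "y + real j * v = y + real (q' * j) * \<omega> - of_int (int j * h)"
      by (simp add: v_def q' algebra_simps)
    ultimately show "\<exists>k<K. \<exists>m::int. 0 < y + real k * \<omega> - of_int m \<and> y + real k * \<omega> - of_int m < \<rho>"
      using jm by (intro exI[of _ "q' * j"] conjI exI[of _ "m + int j * h"]) (auto simp: algebra_simps)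
  qed
qed

end

section \<open>Growth rates of separated sets\<close>

lemma not_separated_points:
  assumes "\<forall>\<^sub>F n in sequentially. real (sep_count m f \<delta> x y n) \<le> real n * b" "b < \<nu>"
  shows "\<not> separated_points m f \<delta> \<nu> x y"
proof -
  have "limsup (\<lambda>n. ereal (real (sep_count m f \<delta> x y n) / real n)) \<le> ereal b"
  proof (rule Limsup_bounded)
    show "\<forall>\<^sub>F n in sequentially. ereal (real (sep_count m f \<delta> x y n) / real n) \<le> ereal b"
      using assms(1) eventually_gt_at_top[of 0]
      by eventually_elim (simp add: divide_le_eq mult.commute)
  qed
  also have "\<dots> < ereal \<nu>" using assms(2) by simp
  finally show ?thesis by (simp add: separated_points_def)
qed

lemma separated_pointsI:
  assumes "\<forall>\<^sub>F n in sequentially. real n * \<nu> \<le> real (sep_count m f \<delta> x y n)"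
  shows "separated_points m f \<delta> \<nu> x y"
  unfolding separated_points_def
proof (rule le_Limsup)
  show "\<forall>\<^sub>F n in sequentially. ereal \<nu> \<le> ereal (real (sep_count m f \<delta> x y n) / real n)"
    using assms eventually_gt_at_top[of 0]
    by eventually_elim (simp add: le_divide_eq mult.commute)
qed simp

lemma sep_count_commute: "sep_count m f \<delta> x y n = sep_count m f \<delta> y x n"
  by (simp add: sep_count_def mdist_commute)

lemma separated_points_commute: "separated_points m f \<delta> \<nu> x y \<longleftrightarrow> separated_points m f \<delta> \<nu> y x"
  by (simp add: separated_points_def sep_count_commute)

lemma Sep_ge:
  assumes "separated_set m f \<delta> \<nu> T" "finite T"
  shows "enat (card T) \<le> Sep m f \<delta> \<nu>"
  unfolding Sep_def by (rule SUP_upper2[of T]) (use assms in auto)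

text \<open>Pigeonhole with cells that record the base point up to \<eta> and whether the fibre
  coordinate vanishes. The size of a positive fibre coordinate need not be recorded: it enters the
  later estimates as an additive constant, or only through the time after which they hold, and so
  does not affect frequencies.\<close>

lemma Sep_le_if_close_not_separated:
  fixes S :: "(real \<times> real) set"
  assumes S: "S \<subseteq> {0..<1} \<times> {0..1}" and "\<eta> > 0"
    and close: "\<And>p q. p \<in> S \<Longrightarrow> q \<in> S \<Longrightarrow> p \<noteq> q \<Longrightarrow> (snd p = 0 \<longleftrightarrow> snd q = 0) \<Longrightarrow>
      circle_norm (fst p - fst q) < \<eta> \<Longrightarrow> \<not> separated_points (submetric annulus_metric S) f \<delta> \<nu> p q"
  shows "Sep (submetric annulus_metric S) f \<delta> \<nu> \<le> enat (2 * (nat \<lfloor>1 / \<eta>\<rfloor> + 1))"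
  unfolding Sep_def
proof (rule SUP_least)
  fix T assume "T \<in> {T. separated_set (submetric annulus_metric S) f \<delta> \<nu> T}"
  then have T: "T \<subseteq> S" "\<And>p q. p \<in> T \<Longrightarrow> q \<in> T \<Longrightarrow> p \<noteq> q \<Longrightarrow>
      separated_points (submetric annulus_metric S) f \<delta> \<nu> p q"
    by (auto simp: separated_set_def)
  define g :: "real \<times> real \<Rightarrow> bool \<times> int" where "g p = (snd p = 0, \<lfloor>fst p / \<eta>\<rfloor>)" for p
  have "inj_on g T"
  proof (rule inj_onI, rule ccontr)
    fix p q assume pq: "p \<in> T" "q \<in> T" "g p = g q" "p \<noteq> q"
    then have "\<bar>fst p / \<eta> - fst q / \<eta>\<bar> < 1" unfolding g_def prod.inject by linarith
    then have "\<bar>fst p - fst q\<bar> < \<eta>" using \<open>\<eta> > 0\<close> by (simp add: field_simps abs_less_iff)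
    then have "circle_norm (fst p - fst q) < \<eta>" using circle_norm_le_abs[of "fst p - fst q"] by linarith
    then show False using close[of p q] T pq by (auto simp: g_def)
  qed
  have sub: "g ` T \<subseteq> UNIV \<times> {0..\<lfloor>1 / \<eta>\<rfloor>}"
  proof
    fix u assume "u \<in> g ` T"
    then obtain p where p: "p \<in> T" "u = g p" by auto
    then have "0 \<le> fst p" "fst p \<le> 1" using T(1) S by force+
    then have "0 \<le> fst p / \<eta>" "fst p / \<eta> \<le> 1 / \<eta>" using \<open>\<eta> > 0\<close> by (simp_all add: divide_right_mono)
    then show "u \<in> UNIV \<times> {0..\<lfloor>1 / \<eta>\<rfloor>}" using p by (auto simp: g_def intro: floor_mono)
  qed
  have fin: "finite ((UNIV :: bool set) \<times> {0..\<lfloor>1 / \<eta>\<rfloor>})" by simp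
  have "finite T" using finite_imageD[OF finite_subset[OF sub fin] \<open>inj_on g T\<close>] .
  have "card T = card (g ` T)" using \<open>inj_on g T\<close> by (simp add: card_image)
  also have "\<dots> \<le> card ((UNIV :: bool set) \<times> {0..\<lfloor>1 / \<eta>\<rfloor>})" using sub fin by (rule card_mono[rotated])
  also have "\<dots> = 2 * (nat \<lfloor>1 / \<eta>\<rfloor> + 1)" using \<open>\<eta> > 0\<close>
    by (simp add: card_cartesian_product card_UNIV_bool nat_add_distrib)
  finally show "(if finite T then enat (card T) else \<infinity>) \<le> enat (2 * (nat \<lfloor>1 / \<eta>\<rfloor> + 1))"
    using \<open>finite T\<close> by simp
qed

lemma real_bin_count_le:
  assumes "0 < \<eta>" "\<eta> \<le> 1"
  shows "real (2 * (nat \<lfloor>1 / \<eta>\<rfloor> + 1)) \<le> 4 / \<eta>"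
proof -
  have "1 \<le> 1 / \<eta>" using assms by simp
  then have "real (2 * (nat \<lfloor>1 / \<eta>\<rfloor> + 1)) \<le> 4 * (1 / \<eta>)"
    by simp linarith
  then show ?thesis by simp
qed

lemma eventually_at_right_0: "\<epsilon> > 0 \<Longrightarrow> (\<And>\<nu>. 0 < \<nu> \<Longrightarrow> \<nu> < \<epsilon> \<Longrightarrow> P \<nu>) \<Longrightarrow> eventually P (at_right (0::real))"
  unfolding eventually_at_right_field by blast

text \<open>The constant C may depend on \<delta>, the exponent may not: as \<nu> tends to 0, ln C
  is absorbed by an arbitrarily small e times - ln \<nu>, and the supremum over \<delta>
  follows.\<close>

lemma upper_ac_le:
  assumes "\<And>\<delta>. \<delta> > 0 \<Longrightarrow> \<exists>C>0. \<forall>\<nu>\<in>{0<..<1}. \<exists>N. Sep m f \<delta> \<nu> \<le> enat N \<and> real N \<le> C * \<nu> powr (- p)"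
  shows "upper_ac m f \<le> ereal p"
  unfolding upper_ac_def
proof (rule SUP_least, rule ereal_le_epsilon2)
  fix \<delta> e :: real assume "\<delta> \<in> {0<..}" "0 < e"
  then obtain C where C: "C > 0"
    "\<And>\<nu>. \<nu> \<in> {0<..<1} \<Longrightarrow> \<exists>N. Sep m f \<delta> \<nu> \<le> enat N \<and> real N \<le> C * \<nu> powr (- p)"
    using assms[of \<delta>] by auto
  have "Limsup (at_right 0) (\<lambda>\<nu>. log_enat (Sep m f \<delta> \<nu>) / ereal (- ln \<nu>)) \<le> ereal (p + e)"
  proof (rule Limsup_bounded, rule eventually_at_right_0)
    fix \<nu> :: real assume \<nu>: "0 < \<nu>" "\<nu> < min (1/2) (exp (- (ln C / e)))"
    then have "\<nu> \<in> {0<..<1}" by auto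
    then obtain N where N: "Sep m f \<delta> \<nu> \<le> enat N" "real N \<le> C * \<nu> powr (- p)" using C by blast
    have "ln \<nu> < ln (exp (- (ln C / e)))" using \<nu> by (subst ln_less_cancel_iff) auto
    then have lnC: "ln C \<le> e * (- ln \<nu>)" using \<open>0 < e\<close> by (simp add: field_simps)
    have neg: "- ln \<nu> > 0" using \<nu> by simp
    obtain k where k: "Sep m f \<delta> \<nu> = enat k" "k \<le> N" using N(1) by (cases "Sep m f \<delta> \<nu>") auto
    show "log_enat (Sep m f \<delta> \<nu>) / ereal (- ln \<nu>) \<le> ereal (p + e)"
    proof (cases "k = 0")
      case True
      then show ?thesis using k neg by (simp add: log_enat_def)
    next
      case False
      have "ln (real k) \<le> ln (C * \<nu> powr (- p))"
        using False k N C(1) \<nu> by (subst ln_le_cancel_iff) auto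
      also have "\<dots> = ln C + p * (- ln \<nu>)" using C(1) \<nu> by (simp add: ln_mult ln_powr)
      also have "\<dots> \<le> (p + e) * (- ln \<nu>)" using lnC by (simp add: algebra_simps)
      finally have "ln (real k) / (- ln \<nu>) \<le> p + e" unfolding pos_divide_le_eq[OF neg] .
      then show ?thesis using False k neg by (simp add: log_enat_def)
    qed
  qed simp
  then show "Limsup (at_right 0) (\<lambda>\<nu>. log_enat (Sep m f \<delta> \<nu>) / ereal (- ln \<nu>)) \<le> ereal p + ereal e"
    by simp
qed

text \<open>Half of the exponent is given away to absorb the constant C for small \<nu>; this is
  harmless where only positivity is at stake.\<close>

lemma lower_ac_ge:
  assumes "\<delta> > 0" "C > 0" "q > 0" "\<nu>0 > 0"
    "\<And>\<nu>. 0 < \<nu> \<Longrightarrow> \<nu> < \<nu>0 \<Longrightarrow> \<exists>N. enat N \<le> Sep m f \<delta> \<nu> \<and> C * \<nu> powr (- q) \<le> real N"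
  shows "ereal (q / 2) \<le> lower_ac m f"
  unfolding lower_ac_def
proof (rule SUP_upper2[of \<delta>])
  show "ereal (q / 2) \<le> Liminf (at_right 0) (\<lambda>\<nu>. log_enat (Sep m f \<delta> \<nu>) / ereal (- ln \<nu>))"
  proof (rule Liminf_bounded, rule eventually_at_right_0)
    fix \<nu> :: real assume \<nu>: "0 < \<nu>" "\<nu> < min (min (1/2) \<nu>0) (exp (2 / q * ln C))"
    then obtain N where N: "enat N \<le> Sep m f \<delta> \<nu>" "C * \<nu> powr (- q) \<le> real N" using assms(5)[of \<nu>] by auto
    have "ln \<nu> < ln (exp (2 / q * ln C))" using \<nu> by (subst ln_less_cancel_iff) auto
    then have lnC: "q / 2 * ln \<nu> \<le> ln C" using \<open>0 < q\<close> by (simp add: field_simps)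
    have neg: "- ln \<nu> > 0" using \<nu> by simp
    have "0 < C * \<nu> powr (- q)" using assms \<nu> by simp
    then have "N > 0" using N(2) by linarith
    show "ereal (q / 2) \<le> log_enat (Sep m f \<delta> \<nu>) / ereal (- ln \<nu>)"
    proof (cases "Sep m f \<delta> \<nu>")
      case (enat k)
      then have "N \<le> k" using N(1) by simp
      have "q / 2 * (- ln \<nu>) \<le> ln C + q * (- ln \<nu>)" using lnC by (simp add: algebra_simps)
      also have "\<dots> = ln (C * \<nu> powr (- q))" using assms \<nu> by (simp add: ln_mult ln_powr)
      also have "\<dots> \<le> ln (real k)"
        using \<open>0 < C * \<nu> powr (- q)\<close> N(2) \<open>N \<le> k\<close> \<open>N > 0\<close> by (subst ln_le_cancel_iff) auto
      finally have "q / 2 \<le> ln (real k) / (- ln \<nu>)" unfolding pos_le_divide_eq[OF neg] .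
      then show ?thesis using enat \<open>N > 0\<close> \<open>N \<le> k\<close> neg by (simp add: log_enat_def)
    next
      case infinity
      then show ?thesis using neg by (simp add: log_enat_def)
    qed
  qed (use assms in auto)
qed (use assms in auto)

lemma lower_ac_nonneg:
  assumes "x \<in> mspace m"
  shows "0 \<le> lower_ac m f"
  unfolding lower_ac_def
proof (rule SUP_upper2[of 1])
  show "0 \<le> Liminf (at_right 0) (\<lambda>\<nu>. log_enat (Sep m f 1 \<nu>) / ereal (- ln \<nu>))"
  proof (rule Liminf_bounded, rule eventually_at_right_0)
    fix \<nu> :: real assume \<nu>: "0 < \<nu>" "\<nu> < 1"
    have "enat (card {x}) \<le> Sep m f 1 \<nu>"
      by (rule Sep_ge) (use assms in \<open>auto simp: separated_set_def\<close>)
    then have "0 \<le> log_enat (Sep m f 1 \<nu>)"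
      by (cases "Sep m f 1 \<nu>") (auto simp: log_enat_def one_enat_def zero_ereal_def)
    then show "0 \<le> log_enat (Sep m f 1 \<nu>) / ereal (- ln \<nu>)"
      using \<nu> by (intro zero_le_divide_ereal) auto
  qed simp
qed simp

lemma lower_ac_le_upper_ac: "lower_ac m f \<le> upper_ac m f"
  unfolding lower_ac_def upper_ac_def by (intro SUP_mono' Liminf_le_Limsup) auto

section \<open>Finiteness of the upper amorphic complexity\<close>

lemma fibre_gap_count_Suc:
  "fibre_gap_count \<omega> \<alpha> \<epsilon> \<delta> p q (Suc n) = fibre_gap_count \<omega> \<alpha> \<epsilon> \<delta> p q n +
     (if \<delta> \<le> \<bar>fibre_orbit \<omega> \<alpha> \<epsilon> (fst p) (snd p) n - fibre_orbit \<omega> \<alpha> \<epsilon> (fst q) (snd q) n\<bar> then 1 else 0)"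
proof -
  let ?D = "\<lambda>n. {k. k < n \<and> \<bar>fibre_orbit \<omega> \<alpha> \<epsilon> (fst p) (snd p) k - fibre_orbit \<omega> \<alpha> \<epsilon> (fst q) (snd q) k\<bar> \<ge> \<delta>}"
  have "?D (Suc n) = (if \<delta> \<le> \<bar>fibre_orbit \<omega> \<alpha> \<epsilon> (fst p) (snd p) n - fibre_orbit \<omega> \<alpha> \<epsilon> (fst q) (snd q) n\<bar>
      then insert n (?D n) else ?D n)"
    by (auto simp: less_Suc_eq)
  then show ?thesis by (simp add: fibre_gap_count_def)
qed

lemma fibre_gap_count_0 [simp]: "fibre_gap_count \<omega> \<alpha> \<epsilon> \<delta> p q 0 = 0"
  by (simp add: fibre_gap_count_def)

lemma fibre_gap_count_zero_fibres:
  assumes "snd p = 0" "snd q = 0" "\<delta> > 0"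
  shows "fibre_gap_count \<omega> \<alpha> \<epsilon> \<delta> p q n = 0"
  using assms by (simp add: fibre_gap_count_def fibre_orbit_zero)

text \<open>The distance of the two fibre orbits in logarithmic coordinates is a potential: it can only
  grow by the forcing term, and loses \<open>\<gamma>\<close> at each time at which the orbits are \<open>\<delta>\<close>-apart.\<close>

lemma fibre_gap_count_potential:
  fixes \<omega> \<alpha> \<epsilon> :: real and p q :: "real \<times> real"
  defines "X \<equiv> fibre_orbit \<omega> \<alpha> \<epsilon> (fst p) (snd p)" and "Z \<equiv> fibre_orbit \<omega> \<alpha> \<epsilon> (fst q) (snd q)"
    and "a \<equiv> \<lambda>k. \<bar>sin (pi * (fst p + real k * \<omega>))\<bar> + \<epsilon>" and "b \<equiv> \<lambda>k. \<bar>sin (pi * (fst q + real k * \<omega>))\<bar> + \<epsilon>"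
  assumes "\<alpha> > 0" and ab: "\<And>k. 0 < a k" "\<And>k. 0 < b k" and pos: "0 < snd p" "0 < snd q"
    and le1: "\<And>k. X k \<le> 1" "\<And>k. Z k \<le> 1"
    and gap: "\<And>x x'. 0 < x' \<Longrightarrow> x \<le> 1 \<Longrightarrow> x - x' \<ge> \<delta> \<Longrightarrow> log_drop (\<alpha> * x) - log_drop (\<alpha> * x') \<ge> \<gamma>"
  shows "\<gamma> * real (fibre_gap_count \<omega> \<alpha> \<epsilon> \<delta> p q n) + \<bar>ln (X n) - ln (Z n)\<bar>
    \<le> \<bar>ln (snd p) - ln (snd q)\<bar> + (\<Sum>k<n. \<bar>ln (a k) - ln (b k)\<bar>)"
proof (induction n)
  case 0
  then show ?case by (simp add: X_def Z_def)
next
  case (Suc n)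
  have XZ: "0 < X n" "0 < Z n"
    unfolding X_def Z_def using assms by (auto intro!: fibre_orbit_pos)
  have step: "\<bar>ln (X (Suc n)) - ln (Z (Suc n))\<bar> \<le> \<bar>ln (X n) - ln (Z n)\<bar>
      - \<bar>log_drop (\<alpha> * X n) - log_drop (\<alpha> * Z n)\<bar> + \<bar>ln (a n) - ln (b n)\<bar>"
    unfolding a_def b_def X_def Z_def
    by (rule fibre_orbit_log_gap_step) (use assms XZ in auto)
  have drop: "\<gamma> \<le> \<bar>log_drop (\<alpha> * X n) - log_drop (\<alpha> * Z n)\<bar>" if "\<delta> \<le> \<bar>X n - Z n\<bar>"
  proof (cases "Z n \<le> X n")
    case True
    then show ?thesis using gap[of "Z n" "X n"] that XZ le1[of n] by simp
  next
    case False
    then show ?thesis using gap[of "X n" "Z n"] that XZ le1[of n] by simp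
  qed
  have "\<gamma> * real (fibre_gap_count \<omega> \<alpha> \<epsilon> \<delta> p q (Suc n)) \<le> \<gamma> * real (fibre_gap_count \<omega> \<alpha> \<epsilon> \<delta> p q n)
      + \<bar>log_drop (\<alpha> * X n) - log_drop (\<alpha> * Z n)\<bar>"
    using drop by (auto simp: fibre_gap_count_Suc X_def Z_def ring_distribs)
  then show ?case using step Suc by simp
qed

lemma abs_ln_diff_le:
  assumes "m > 0" "m \<le> s" "m \<le> (s'::real)"
  shows "\<bar>ln s - ln s'\<bar> \<le> \<bar>s - s'\<bar> / m"
proof -
  have *: "ln u - ln v \<le> \<bar>u - v\<bar> / m" if "m \<le> u" "m \<le> v" for u v
  proof -
    have "ln u - ln v \<le> (u - v) / v" using that assms by (intro ln_diff_le) auto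
    also have "\<dots> \<le> \<bar>u - v\<bar> / m" using that assms by (intro frac_le) auto
    finally show ?thesis .
  qed
  show ?thesis using *[of s s'] *[of s' s] assms by (simp add: abs_le_iff abs_minus_commute)
qed

text \<open>Two regimes. Away from the singularity ln is Lipschitz with constant 2 exp R. Otherwise
  closeness forces both values below exp (- R); then - ln s \<ge> R, so that - ln s is at most twice
  its excess over R / 2.\<close>

lemma log_forcing_gap_le:
  fixes s s' h R :: real
  assumes "0 < s" "s \<le> 1" "0 < s'" "s' \<le> 1" "\<bar>s - s'\<bar> \<le> h" "h \<le> exp (- R) / 2" "R \<ge> 0"
  shows "\<bar>ln s - ln s'\<bar> \<le> 2 * h * exp R + 2 * max 0 (- ln s - R / 2) + 2 * max 0 (- ln s' - R / 2)"
proof (cases "exp (- R) / 2 \<le> s \<and> exp (- R) / 2 \<le> s'")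
  case True
  then have "\<bar>ln s - ln s'\<bar> \<le> \<bar>s - s'\<bar> / (exp (- R) / 2)" by (intro abs_ln_diff_le) auto
  also have "\<dots> \<le> h / (exp (- R) / 2)" using assms by (intro divide_right_mono) auto
  also have "\<dots> = 2 * h * exp R" by (simp add: exp_minus field_simps)
  also have "2 * h * exp R \<le> 2 * h * exp R + (2 * max 0 (- ln s - R / 2) + 2 * max 0 (- ln s' - R / 2))"
    unfolding le_add_same_cancel1 by (intro add_nonneg_nonneg) auto
  finally show ?thesis by (simp only: add.assoc)
next
  case False
  then have "s \<le> exp (- R)" "s' \<le> exp (- R)" using assms by auto
  then have "ln s \<le> ln (exp (- R))" "ln s' \<le> ln (exp (- R))"
    using assms ln_le_cancel_iff[OF _ exp_gt_zero] by blast+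
  then have "ln s \<le> - R" "ln s' \<le> - R" by simp_all
  moreover have "ln s \<le> 0" "ln s' \<le> 0" using assms by auto
  moreover have "0 \<le> 2 * h * exp R" using assms by simp
  moreover have "\<bar>x - y\<bar> \<le> E + 2 * M + 2 * N"
    if "x \<le> - R" "y \<le> - R" "x \<le> 0" "y \<le> 0" "0 \<le> E"
      "- x - R / 2 \<le> M" "- y - R / 2 \<le> N" "0 \<le> M" "0 \<le> N" for x y E M N :: real
    using that by linarith
  ultimately show ?thesis by simp
qed

lemma eventually_const_le_mult:
  fixes r \<tau> :: real
  assumes "\<tau> > 0"
  shows "\<forall>\<^sub>F n in sequentially. r \<le> real n * \<tau>"
proof -
  have "\<forall>\<^sub>F n in sequentially. r / \<tau> \<le> real n"
    using eventually_ge_at_top[of "nat \<lceil>r / \<tau>\<rceil>"] by eventually_elim linarith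
  then show ?thesis using assms by (simp add: pos_divide_le_eq)
qed

section \<open>Gap frequency over nearby base points\<close>

context diophantine_rotation
begin

text \<open>Averages the forcing bound along both orbits. The base distance enters through an upper
  bound \<tau> > 0, which also covers pairs over the same base point.\<close>

lemma eventually_fibre_gap_count_le:
  fixes p q :: "real \<times> real"
  defines "r \<equiv> 1 / max 2 (4 * d0)"
  assumes "\<alpha> > 0" "\<gamma> > 0"
    and gap: "\<And>x x'. 0 < x' \<Longrightarrow> x \<le> 1 \<Longrightarrow> x - x' \<ge> \<delta> \<Longrightarrow> log_drop (\<alpha> * x) - log_drop (\<alpha> * x') \<ge> \<gamma>"
    and p: "fst p \<in> generic_base \<omega>" "0 < snd p" "snd p \<le> 1"
    and q: "fst q \<in> generic_base \<omega>" "0 < snd q" "snd q \<le> 1"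
    and t: "circle_norm (fst p - fst q) \<le> \<tau>" "0 < \<tau>" "\<tau> \<le> 1 / (2 * pi)\<^sup>2"
  shows "\<forall>\<^sub>F n in sequentially. \<gamma> * real (fibre_gap_count \<omega> \<alpha> 0 \<delta> p q n)
    \<le> real n * ((6 + 4 * sing_const * (2 * pi) powr (1 / (2 * d0))) * \<tau> powr r)"
proof -
  \<comment> \<open>With exp (- R) of order sqrt \<tau> the Lipschitz regime costs sqrt \<tau> per
    step, and the excess over R / 2 has mean of order exp (- R / (2 d0)), that is
    \<open>\<tau> powr (1 / (4 * d0))\<close>. The exponent \<open>r\<close> is the smaller of 1/2
    and 1 / (4 d0).\<close>
  define R where "R = - ln (2 * pi * sqrt \<tau>)"
  have pos: "0 < 2 * pi * sqrt \<tau>" using t by simp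
  have eR: "exp (- R) = 2 * pi * sqrt \<tau>" using pos by (simp add: R_def)
  have "sqrt \<tau> \<le> sqrt (1 / (2 * pi)\<^sup>2)" using t by (intro real_sqrt_le_mono)
  then have "sqrt \<tau> \<le> 1 / (2 * pi)" by (simp only: real_sqrt_divide real_sqrt_abs real_sqrt_one) simp
  then have "2 * pi * sqrt \<tau> \<le> 1" by (simp add: field_simps)
  then have R0: "R \<ge> 0" using pos by (simp add: R_def)
  have tau1: "\<tau> \<le> 1"
  proof -
    have "(1::real)\<^sup>2 \<le> (2 * pi)\<^sup>2" using pi_ge_two by (intro power_mono) auto
    then have "1 / (2 * pi)\<^sup>2 \<le> 1" by simp
    then show ?thesis using t by linarith
  qed
  have eRp: "2 * (pi * \<tau>) * exp R = sqrt \<tau>"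
  proof -
    have "exp R * exp (- R) = 1" by (simp flip: exp_add)
    then have "exp R * (2 * pi * sqrt \<tau>) = 1" by (simp add: eR)
    moreover have "2 * (pi * \<tau>) = 2 * pi * sqrt \<tau> * sqrt \<tau>" using t by simp
    ultimately show ?thesis by (metis mult.assoc mult.commute mult.left_neutral)
  qed
  have r_le: "r \<le> 1 / 2" "r \<le> 1 / (4 * d0)" "r > 0"
    using d0_pos by (auto simp: r_def intro!: divide_left_mono)
  have sq: "sqrt \<tau> \<le> \<tau> powr r"
    using t tau1 r_le by (simp add: powr_half_sqrt[symmetric] powr_mono')
  have "\<tau> * 2 * pi = sqrt \<tau> * (2 * pi * sqrt \<tau>)" using t by simp
  also have "\<dots> \<le> 1 * (2 * pi * sqrt \<tau>)"
    using pos tau1 by (intro mult_right_mono) (auto intro: less_imp_le)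
  finally have h: "pi * \<tau> \<le> exp (- R) / 2" by (simp add: eR)
  have "exp (- (R / 2 / d0)) = (2 * pi * sqrt \<tau>) powr (1 / (2 * d0))"
    using pos t by (simp add: R_def powr_def)
  also have "\<dots> = (2 * pi) powr (1 / (2 * d0)) * \<tau> powr (1 / (4 * d0))"
    using t by (simp add: powr_mult powr_half_sqrt[symmetric] powr_powr)
  also have "\<dots> \<le> (2 * pi) powr (1 / (2 * d0)) * \<tau> powr r"
    using t tau1 r_le by (intro mult_left_mono powr_mono') auto
  finally have ex: "exp (- (R / 2 / d0)) \<le> (2 * pi) powr (1 / (2 * d0)) * \<tau> powr r" .
  define T where "T = \<tau> powr r"
  have "T > 0" using t by (simp add: T_def)
  define U where "U = sing_const * ((2 * pi) powr (1 / (2 * d0)) * T)"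
  define u0 where "u0 = \<bar>ln (snd p) - ln (snd q)\<bar>"
  have sexU: "sing_const * exp (- (R / 2 / d0)) \<le> U"
    unfolding U_def T_def using ex sing_const_pos by (intro mult_left_mono) auto
  have forcing: "\<bar>ln (\<bar>sin (pi * (fst p + real k * \<omega>))\<bar> + 0) - ln (\<bar>sin (pi * (fst q + real k * \<omega>))\<bar> + 0)\<bar>
      \<le> T + 2 * max 0 (sing_height \<omega> (fst p) k - R / 2) + 2 * max 0 (sing_height \<omega> (fst q) k - R / 2)" for k
  proof -
    have "\<bar>\<bar>sin (pi * (fst p + real k * \<omega>))\<bar> - \<bar>sin (pi * (fst q + real k * \<omega>))\<bar>\<bar>
       \<le> pi * circle_norm ((fst p + real k * \<omega>) - (fst q + real k * \<omega>))"
      by (rule abs_sin_pi_diff_le)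
    also have "\<dots> \<le> pi * \<tau>" using t(1) by (intro mult_left_mono) auto
    finally have "\<bar>ln \<bar>sin (pi * (fst p + real k * \<omega>))\<bar> - ln \<bar>sin (pi * (fst q + real k * \<omega>))\<bar>\<bar>
      \<le> 2 * (pi * \<tau>) * exp R + 2 * max 0 (- ln \<bar>sin (pi * (fst p + real k * \<omega>))\<bar> - R / 2)
        + 2 * max 0 (- ln \<bar>sin (pi * (fst q + real k * \<omega>))\<bar> - R / 2)"
      using generic_base_sin_pos[OF p(1), of k] generic_base_sin_pos[OF q(1), of k] h R0
      by (intro log_forcing_gap_le) auto
    then show ?thesis using sq unfolding eRp by (simp add: sing_height_def T_def)
  qed
  show ?thesis
    using eventually_const_le_mult[OF \<open>T > 0\<close>, of u0] eventually_sum_excess_le[OF p(1) \<open>T > 0\<close>, of "R / 2"]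
      eventually_sum_excess_le[OF q(1) \<open>T > 0\<close>, of "R / 2"]
  proof eventually_elim
    case (elim n)
    have U2: "real n * (sing_const * exp (- (R / 2 / d0)) + T) \<le> real n * (U + T)"
      using sexU by (intro mult_left_mono) auto
    have "\<gamma> * real (fibre_gap_count \<omega> \<alpha> 0 \<delta> p q n) \<le> u0 + (\<Sum>k<n. \<bar>ln (\<bar>sin (pi * (fst p + real k * \<omega>))\<bar> + 0)
        - ln (\<bar>sin (pi * (fst q + real k * \<omega>))\<bar> + 0)\<bar>)"
    proof -
      have "\<gamma> * real (fibre_gap_count \<omega> \<alpha> 0 \<delta> p q n) +
          \<bar>ln (fibre_orbit \<omega> \<alpha> 0 (fst p) (snd p) n) - ln (fibre_orbit \<omega> \<alpha> 0 (fst q) (snd q) n)\<bar>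
        \<le> u0 + (\<Sum>k<n. \<bar>ln (\<bar>sin (pi * (fst p + real k * \<omega>))\<bar> + 0)
        - ln (\<bar>sin (pi * (fst q + real k * \<omega>))\<bar> + 0)\<bar>)"
        unfolding u0_def
        by (rule fibre_gap_count_potential)
          (use assms generic_base_sin_pos[OF p(1)] generic_base_sin_pos[OF q(1)]
            fibre_orbit_pinched_bounds[of \<alpha>] in \<open>auto\<close>)
      then show ?thesis by linarith
    qed
    also have "\<dots> \<le> u0 + (\<Sum>k<n. T + 2 * max 0 (sing_height \<omega> (fst p) k - R / 2)
        + 2 * max 0 (sing_height \<omega> (fst q) k - R / 2))"
      using forcing by (intro add_left_mono sum_mono)
    also have "\<dots> = u0 + (real n * T + 2 * (\<Sum>k<n. max 0 (sing_height \<omega> (fst p) k - R / 2))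
       + 2 * (\<Sum>k<n. max 0 (sing_height \<omega> (fst q) k - R / 2)))"
      by (simp add: sum.distrib sum_distrib_left)
    \<comment> \<open>The initial distance \<open>u0\<close> and the Lipschitz part cost T per step
      each, and each of the two orbits contributes twice its mean excess U + T; hence the constants
      6 and 4.\<close>
    also have "\<dots> \<le> real n * T + (real n * T + 2 * (real n * (U + T)) + 2 * (real n * (U + T)))"
      using elim U2 by linarith
    also have "\<dots> = real n * (6 * T + 4 * U)" by (simp add: algebra_simps)
    also have "\<dots> = real n * ((6 + 4 * sing_const * (2 * pi) powr (1 / (2 * d0))) * \<tau> powr r)"
      by (simp add: U_def T_def algebra_simps)
    finally show ?case .
  qed
qed

lemma upper_ac_pinched_finite:
  assumes "\<alpha> > 0"
  shows "upper_ac (submetric annulus_metric (generic_base \<omega> \<times> {0..1})) (pinched_map \<omega> \<alpha>) < \<infinity>"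
proof -
  define P where "P = max 2 (4 * d0)"
  have "P > 0" by (simp add: P_def)
  define B where "B = 6 + 4 * sing_const * (2 * pi) powr (1 / (2 * d0))"
  have "B > 0" using sing_const_pos by (simp add: B_def add_pos_pos)
  have "upper_ac (submetric annulus_metric (generic_base \<omega> \<times> {0..1})) (pinched_map \<omega> \<alpha>) \<le> ereal P"
    unfolding pinched_eq_perturbed
  proof (rule upper_ac_le)
    fix \<delta> :: real assume "\<delta> > 0"
    obtain \<gamma> where \<gamma>: "\<gamma> > 0" "\<gamma> \<le> 1"
      "\<And>x x'. 0 < x' \<Longrightarrow> x \<le> 1 \<Longrightarrow> x - x' \<ge> \<delta> \<Longrightarrow> log_drop (\<alpha> * x) - log_drop (\<alpha> * x') \<ge> \<gamma>"
      using log_drop_gap[OF assms \<open>\<delta> > 0\<close>] by metis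
    \<comment> \<open>Chosen such that cells of width \<eta> = a \<nu>^P lie below \<delta>, satisfy
      the restriction on \<tau>, and make B \<eta>^(1/P) at most \<gamma> \<nu> / 2.\<close>
    define a where "a = min (min \<delta> 1) (min (1 / (2 * pi)\<^sup>2) ((\<gamma> / (2 * B)) powr P))"
    have a: "a > 0" "a \<le> \<delta>" "a \<le> 1" "a \<le> 1 / (2 * pi)\<^sup>2" "a \<le> (\<gamma> / (2 * B)) powr P"
      using \<open>\<delta> > 0\<close> \<gamma>(1) \<open>B > 0\<close> by (auto simp: a_def min_le_iff_disj)
    show "\<exists>C>0. \<forall>\<nu>\<in>{0<..<1}. \<exists>N. Sep (submetric annulus_metric (generic_base \<omega> \<times> {0..1}))
        (perturbed_map \<omega> \<alpha> 0) \<delta> \<nu> \<le> enat N \<and> real N \<le> C * \<nu> powr (- P)"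
    proof (intro exI[of _ "4 / a"] conjI ballI)
      fix \<nu> :: real assume \<nu>: "\<nu> \<in> {0<..<1}"
      define \<eta> where "\<eta> = a * \<nu> powr P"
      have "\<nu> powr P \<le> 1" using \<nu> \<open>P > 0\<close> by (intro powr_le1) auto
      then have \<eta>: "0 < \<eta>" "\<eta> \<le> a"
        using a(1) \<nu> by (auto simp: \<eta>_def intro!: mult_left_le)
      have eta_r: "B * \<eta> powr (1 / P) \<le> \<gamma> * (\<nu> / 2)"
      proof -
        have "\<eta> powr (1 / P) \<le> ((\<gamma> / (2 * B)) powr P * \<nu> powr P) powr (1 / P)"
          unfolding \<eta>_def using a \<open>P > 0\<close> by (intro powr_mono2 mult_right_mono) auto
        also have "\<dots> = \<gamma> / (2 * B) * \<nu>"
          using \<open>P > 0\<close> \<gamma>(1) \<open>B > 0\<close> \<nu> by (simp add: powr_mult powr_powr)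
        finally have "B * \<eta> powr (1 / P) \<le> B * (\<gamma> / (2 * B) * \<nu>)"
          using \<open>B > 0\<close> by (intro mult_left_mono) auto
        then show ?thesis using \<open>B > 0\<close> by simp
      qed
      have "Sep (submetric annulus_metric (generic_base \<omega> \<times> {0..1})) (perturbed_map \<omega> \<alpha> 0) \<delta> \<nu>
         \<le> enat (2 * (nat \<lfloor>1 / \<eta>\<rfloor> + 1))"
      proof (rule Sep_le_if_close_not_separated[OF _ \<eta>(1)])
        show "generic_base \<omega> \<times> {0..1::real} \<subseteq> {0..<1} \<times> {0..1}" by (auto simp: generic_base_def)
        fix p q :: "real \<times> real"
        assume pq: "p \<in> generic_base \<omega> \<times> {0..1}" "q \<in> generic_base \<omega> \<times> {0..1}"
          "(snd p = 0) = (snd q = 0)" "circle_norm (fst p - fst q) < \<eta>"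
        have base: "fst p \<in> {0..<1}" "fst q \<in> {0..<1}" using pq by (auto simp: generic_base_def)
        have lt: "circle_norm (fst p - fst q) < \<delta>" using pq \<eta> a by linarith
        have "\<forall>\<^sub>F n in sequentially. real (fibre_gap_count \<omega> \<alpha> 0 \<delta> p q n) \<le> real n * (\<nu> / 2)"
        proof (cases "snd p = 0")
          case True
          then show ?thesis using pq \<open>\<delta> > 0\<close> \<nu> by (simp add: fibre_gap_count_zero_fibres)
        next
          case False
          have "\<forall>\<^sub>F n in sequentially. \<gamma> * real (fibre_gap_count \<omega> \<alpha> 0 \<delta> p q n)
              \<le> real n * (B * \<eta> powr (1 / P))"
            unfolding B_def P_def
            by (rule eventually_fibre_gap_count_le) (use assms \<gamma> False pq \<eta> a in auto)
          then show ?thesis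
          proof eventually_elim
            case (elim n)
            have "real n * (B * \<eta> powr (1 / P)) \<le> real n * (\<gamma> * (\<nu> / 2))"
              using eta_r by (intro mult_left_mono) auto
            then have "\<gamma> * real (fibre_gap_count \<omega> \<alpha> 0 \<delta> p q n) \<le> \<gamma> * (real n * (\<nu> / 2))"
              using elim by (simp add: ac_simps)
            then show ?case using \<gamma>(1) mult_le_cancel_left_pos by blast
          qed
        qed
        then show "\<not> separated_points (submetric annulus_metric (generic_base \<omega> \<times> {0..1}))
            (perturbed_map \<omega> \<alpha> 0) \<delta> \<nu> p q"
          by (intro not_separated_points[where b = "\<nu> / 2"])
            (use sep_count_eq_fibre_gap_count[OF base lt] \<nu> in auto)
      qed
      moreover have "real (2 * (nat \<lfloor>1 / \<eta>\<rfloor> + 1)) \<le> 4 / \<eta>"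
        by (rule real_bin_count_le) (use \<eta> a in auto)
      moreover have "4 / \<eta> = 4 / a * \<nu> powr (- P)" by (simp add: \<eta>_def powr_minus field_simps)
      ultimately show "\<exists>N. Sep (submetric annulus_metric (generic_base \<omega> \<times> {0..1}))
          (perturbed_map \<omega> \<alpha> 0) \<delta> \<nu> \<le> enat N \<and> real N \<le> 4 / a * \<nu> powr (- P)"
        by metis
    qed (use a in auto)
  qed
  then show ?thesis by (rule order.strict_trans1) simp
qed

end

section \<open>Positivity of the lower amorphic complexity\<close>

text \<open>Lindley's recursion for the content of a queue: since the last time m at which it was
  empty the increments simply add up. The second alternative is that no reset has occurred since n0;
  a reset at n itself corresponds to the empty sum.\<close>

lemma queue_bound_from:
  fixes W b :: "nat \<Rightarrow> real"
  assumes "\<And>k. W (Suc k) \<le> max (W k + b k) 0" "n0 \<le> n"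
  shows "(\<exists>m\<in>{n0..n}. W n \<le> sum b {m..<n}) \<or> W n \<le> W n0 + sum b {n0..<n}"
  using assms(2)
proof (induction n rule: dec_induct)
  case (step n)
  have sum_Suc: "sum b {m..<Suc n} = sum b {m..<n} + b n" if "m \<le> n" for m
    using that by simp
  consider "W (Suc n) \<le> 0" | "W (Suc n) \<le> W n + b n" using assms(1)[of n] by (auto simp: max_def split: if_splits)
  then show ?case
  proof cases
    case 1
    then show ?thesis using step by (intro disjI1 bexI[of _ "Suc n"]) auto
  next
    case 2
    from step.IH show ?thesis
    proof
      assume "\<exists>m\<in>{n0..n}. W n \<le> sum b {m..<n}"
      then obtain m where "m \<in> {n0..n}" "W n \<le> sum b {m..<n}" by blast
      then show ?thesis using 2 sum_Suc[of m] by (intro disjI1 bexI[of _ m]) auto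
    next
      assume "W n \<le> W n0 + sum b {n0..<n}"
      then show ?thesis using 2 sum_Suc[of n0] step by (intro disjI2) auto
    qed
  qed
qed simp

lemma queue_bound:
  fixes W b :: "nat \<Rightarrow> real"
  assumes "\<And>k. W (Suc k) \<le> max (W k + b k) 0" "W 0 \<le> 0"
  shows "\<exists>m\<le>n. W n \<le> sum b {m..<n}"
  using queue_bound_from[of W b 0 n] assms by force

lemma queue_busy:
  fixes W b :: "nat \<Rightarrow> real"
  assumes "\<And>k. W (Suc k) \<le> max (W k + b k) 0" "n0 \<le> n" "\<And>k. n0 < k \<Longrightarrow> k \<le> n \<Longrightarrow> W k > 0"
  shows "W n \<le> W n0 + sum b {n0..<n}"
  using assms(2,3)
proof (induction n rule: dec_induct)
  case (step n)
  have "W (Suc n) > 0" using step by simp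
  then have "W (Suc n) \<le> W n + b n" using assms(1)[of n] by (auto simp: max_def split: if_splits)
  moreover have "W n \<le> W n0 + sum b {n0..<n}" using step by auto
  ultimately show ?case using step by simp
qed simp

text \<open>The times preceded by some segment with average load above \<open>e\<close> are the busy times of a
  queue, and each busy time serves an amount \<open>e\<close> of the total load.\<close>

lemma card_overloaded_le:
  fixes g :: "nat \<Rightarrow> real"
  assumes "e > 0" "\<And>i. 0 \<le> g i"
  shows "e * real (card {n. n < N \<and> (\<exists>m\<le>n. 0 < (\<Sum>i\<in>{m..<n}. g i - e))}) \<le> (\<Sum>i<N. g i)"
proof -
  define U where "U = rec_nat (0::real) (\<lambda>n u. max 0 (u + (g n - e)))"
  have U_Suc: "U (Suc n) = max 0 (U n + (g n - e))" and U_0: "U 0 = 0" for n by (simp_all add: U_def)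
  have U_nonneg: "0 \<le> U n" for n by (cases n) (simp_all add: U_Suc U_0)
  have seg: "(\<Sum>i\<in>{m..<n}. g i - e) \<le> U n" if "m \<le> n" for m n
    using that
  proof (induction n rule: dec_induct)
    case (step n)
    then show ?case by (simp add: U_Suc)
  qed (simp add: U_nonneg)
  \<comment> \<open>Content plus served load never exceeds the load that has arrived. Busy times are
    read off after the step, at \<open>Suc k\<close>, which accounts for the shift by one in the
    inclusion below.\<close>
  have bal: "U n + e * real (card {k. k < n \<and> U (Suc k) > 0}) \<le> (\<Sum>i<n. g i)" for n
  proof (induction n)
    case (Suc n)
    have eq: "{k. k < Suc n \<and> U (Suc k) > 0} =
       (if U (Suc n) > 0 then insert n {k. k < n \<and> U (Suc k) > 0} else {k. k < n \<and> U (Suc k) > 0})"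
      by (auto simp: less_Suc_eq)
    show ?case
    proof (cases "U (Suc n) > 0")
      case True
      then have "U (Suc n) = U n + (g n - e)" by (auto simp: U_Suc max_def split: if_splits)
      then show ?thesis using Suc True unfolding eq by (simp add: ring_distribs)
    next
      case False
      then have "U (Suc n) = 0" using U_nonneg[of "Suc n"] by simp
      then show ?thesis using Suc False assms(2)[of n] U_nonneg[of n] unfolding eq by simp
    qed
  qed (simp add: U_0)
  have "{n. n < N \<and> (\<exists>m\<le>n. 0 < (\<Sum>i\<in>{m..<n}. g i - e))} \<subseteq> Suc ` {k. k < N \<and> U (Suc k) > 0}"
  proof
    fix n assume n: "n \<in> {n. n < N \<and> (\<exists>m\<le>n. 0 < (\<Sum>i\<in>{m..<n}. g i - e))}"
    then have "U n > 0" using seg[of _ n] by force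
    then obtain k where "n = Suc k" using U_0 by (cases n) auto
    then show "n \<in> Suc ` {k. k < N \<and> U (Suc k) > 0}" using n \<open>U n > 0\<close> by auto
  qed
  then have "card {n. n < N \<and> (\<exists>m\<le>n. 0 < (\<Sum>i\<in>{m..<n}. g i - e))} \<le> card (Suc ` {k. k < N \<and> U (Suc k) > 0})"
    by (intro card_mono) auto
  also have "\<dots> = card {k. k < N \<and> U (Suc k) > 0}" by (simp add: card_image)
  finally have "e * real (card {n. n < N \<and> (\<exists>m\<le>n. 0 < (\<Sum>i\<in>{m..<n}. g i - e))})
      \<le> e * real (card {k. k < N \<and> U (Suc k) > 0})"
    using assms(1) by simp
  then show ?thesis using bal[of N] U_nonneg[of N] by linarith
qed

text \<open>The logarithmic depth of the fibre orbit below the level \<open>1 / \<alpha>\<close>, up to which \<open>tanh\<close> expands.\<close>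

definition fibre_depth :: "real \<Rightarrow> real \<Rightarrow> real \<Rightarrow> nat \<Rightarrow> real" where
  "fibre_depth \<omega> \<alpha> \<theta> k = max 0 (- ln (fibre_orbit \<omega> \<alpha> 0 \<theta> 1 k) - ln \<alpha>)"

lemma fibre_orbit_ge_if_depth_le_0:
  assumes "fibre_depth \<omega> \<alpha> \<theta> k \<le> 0" "\<alpha> > 0" "0 < fibre_orbit \<omega> \<alpha> 0 \<theta> 1 k"
  shows "1 / \<alpha> \<le> fibre_orbit \<omega> \<alpha> 0 \<theta> 1 k"
proof -
  have "ln (1 / \<alpha>) \<le> ln (fibre_orbit \<omega> \<alpha> 0 \<theta> 1 k)"
    using assms by (simp add: fibre_depth_def ln_div)
  then show ?thesis using assms ln_le_cancel_iff[of "1 / \<alpha>" "fibre_orbit \<omega> \<alpha> 0 \<theta> 1 k"] by simp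
qed

text \<open>From tanh y \<ge> y / (1 + y) \<ge> min y 1 / 2: below the level 1 / \<alpha> a step
  expands by at least \<alpha> / 2, above it tanh is at least 1/2. The factor 1/2 is the term ln 2
  in both cases.\<close>

lemma neg_ln_fibre_orbit_Suc:
  assumes "\<theta> \<in> generic_base \<omega>" "\<alpha> > 0"
  shows "- ln (fibre_orbit \<omega> \<alpha> 0 \<theta> 1 (Suc k)) \<le> fibre_depth \<omega> \<alpha> \<theta> k + ln 2 + sing_height \<omega> \<theta> k"
proof -
  define X where "X = fibre_orbit \<omega> \<alpha> 0 \<theta> 1 k"
  have "X > 0" unfolding X_def
    using generic_base_sin_pos[OF assms(1)] assms(2) by (intro fibre_orbit_pos) auto
  then have y: "\<alpha> * X > 0" using assms by simp
  have "min (\<alpha> * X) 1 / 2 \<le> \<alpha> * X / (1 + \<alpha> * X)"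
  proof -
    have "min v 1 / 2 \<le> v / (1 + v)" if "0 < v" for v :: real
    proof (cases "v \<le> 1")
      case True
      then have "v / 2 \<le> v / (1 + v)" using that by (intro divide_left_mono) auto
      then show ?thesis using True by simp
    next
      case False
      then show ?thesis by (simp add: field_simps)
    qed
    then show ?thesis using y .
  qed
  also have "\<dots> \<le> tanh (\<alpha> * X)" using y by (intro tanh_lower) simp
  finally have "ln (min (\<alpha> * X) 1 / 2) \<le> ln (tanh (\<alpha> * X))" using y by (subst ln_le_cancel_iff) auto
  moreover have "ln (min (\<alpha> * X) 1 / 2) = - max 0 (- ln X - ln \<alpha>) - ln 2"
    using y \<open>X > 0\<close> assms(2) ln_ge_zero_iff[OF y] ln_le_zero_iff[OF y] by (auto simp: min_def max_def ln_div ln_mult)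
  ultimately have "- ln (tanh (\<alpha> * X)) \<le> fibre_depth \<omega> \<alpha> \<theta> k + ln 2"
    by (simp add: fibre_depth_def X_def)
  moreover have "ln (fibre_orbit \<omega> \<alpha> 0 \<theta> 1 (Suc k)) = ln (tanh (\<alpha> * X)) - sing_height \<omega> \<theta> k"
    using y generic_base_sin_pos[OF assms(1), of k] by (simp add: X_def[symmetric] sing_height_def ln_mult_pos)
  ultimately show ?thesis by simp
qed

text \<open>The depth is dominated by a queue with arrivals \<open>sing_height\<close> and service
  rate \<open>ln \<alpha> - ln 2\<close>.\<close>

lemma fibre_depth_Suc:
  assumes "\<theta> \<in> generic_base \<omega>" "\<alpha> > 0"
  shows "fibre_depth \<omega> \<alpha> \<theta> (Suc k) \<le> max (fibre_depth \<omega> \<alpha> \<theta> k + (sing_height \<omega> \<theta> k - (ln \<alpha> - ln 2))) 0"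
  using neg_ln_fibre_orbit_Suc[OF assms, of k] unfolding fibre_depth_def[of \<omega> \<alpha> \<theta> "Suc k"] by simp

lemma fibre_depth_0:
  assumes "\<alpha> \<ge> 1"
  shows "fibre_depth \<omega> \<alpha> \<theta> 0 \<le> 0"
  using assms by (simp add: fibre_depth_def)

text \<open>Both \<open>tanh y \<le> y\<close> and sin \<le> 1 enter: a pinched orbit cannot recover
  faster than by a factor \<alpha> per step.\<close>

lemma fibre_orbit_growth_le:
  assumes "\<alpha> \<ge> 0" "0 \<le> x" "x \<le> 1"
  shows "fibre_orbit \<omega> \<alpha> 0 y x (n + j) \<le> \<alpha> ^ j * fibre_orbit \<omega> \<alpha> 0 y x n"
proof (induction j)
  case (Suc j)
  have nn: "0 \<le> fibre_orbit \<omega> \<alpha> 0 y x (n + j)" using assms by (rule fibre_orbit_pinched_bounds)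
  have "fibre_orbit \<omega> \<alpha> 0 y x (n + Suc j) \<le> tanh (\<alpha> * fibre_orbit \<omega> \<alpha> 0 y x (n + j)) * 1"
    using nn assms by (simp del: mult_1_right) (intro mult_left_mono, auto)
  also have "\<dots> \<le> \<alpha> * fibre_orbit \<omega> \<alpha> 0 y x (n + j)" using nn assms by (simp add: tanh_le_self)
  also have "\<dots> \<le> \<alpha> * (\<alpha> ^ j * fibre_orbit \<omega> \<alpha> 0 y x n)" using Suc assms by (intro mult_left_mono)
  finally show ?case by simp
qed simp

lemma circle_norm_eq_self: 
  assumes "0 \<le> v" "v \<le> 1/2"
  shows "circle_norm v = v"
proof (rule antisym)
  show "circle_norm v \<le> v" using circle_norm_le_abs[of v] assms by simp
  obtain m where m: "circle_norm v = \<bar>v - of_int m\<bar>" by (rule circle_norm_obtain)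
  have "m \<le> 0 \<or> m \<ge> 1" by linarith
  then have "v \<le> \<bar>v - of_int m\<bar>"
  proof
    assume "1 \<le> m"
    then have "(1::real) \<le> of_int m" by simp
    then show ?thesis using assms by linarith
  qed (use assms in \<open>auto simp: abs_if\<close>)
  then show "v \<le> circle_norm v" by (simp add: m)
qed

section \<open>Recovery after a close passage\<close>

context diophantine_rotation
begin

text \<open>If the orbit is within 2 s of the integers at time k, a distance below s at another time
  i of the window would put \<open>\<bar>i - k\<bar> * \<omega>\<close> within less than 3 s of an
  integer, which the Diophantine bound excludes for gaps up to J.\<close>

lemma sing_height_window:
  assumes near: "circle_norm (y + real k * \<omega>) \<le> 2 * s" and "s > 0"
    and J: "3 * s \<le> c * real J powr (- d0)" and i: "i \<noteq> k" "k \<le> i + J" "i \<le> k + J"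
  shows "sing_height \<omega> y i \<le> - ln s"
proof (rule sing_height_le[OF \<open>s > 0\<close>])
  define g where "g = nat \<bar>int i - int k\<bar>"
  have g: "1 \<le> g" "g \<le> J" using i by (auto simp: g_def)
  have "3 * s \<le> c * real J powr (- d0)" by (rule J)
  also have "\<dots> \<le> c * real g powr (- d0)"
    using g c_pos d0_pos by (intro mult_left_mono powr_mono2') auto
  also have "\<dots> \<le> circle_norm (real g * \<omega>)" by (rule diophantine_bound[OF g(1)])
  also have "circle_norm (real g * \<omega>) = circle_norm ((y + real i * \<omega>) - (y + real k * \<omega>))"
  proof (cases "k \<le> i")
    case True
    then show ?thesis by (simp add: g_def algebra_simps of_nat_diff nat_diff_distrib')
  next
    case False
    then have "real g * \<omega> = (y + real k * \<omega>) - (y + real i * \<omega>)"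
      by (simp add: g_def algebra_simps of_nat_diff nat_diff_distrib')
    then show ?thesis by (simp only: circle_norm_diff_commute)
  qed
  also have "\<dots> \<le> circle_norm (y + real i * \<omega>) + circle_norm (y + real k * \<omega>)"
    by (rule circle_norm_triangle_diff)
  finally show "s \<le> circle_norm (y + real i * \<omega>)" using near by simp
qed

text \<open>With all heights at most l the cut-off at l changes nothing, so the bound for truncated
  sums applies to the full heights.\<close>

lemma sum_bounded_heights_le:
  assumes "m \<le> n" "\<And>i. m \<le> i \<Longrightarrow> i < n \<Longrightarrow> sing_height \<omega> y i \<le> real l"
  shows "(\<Sum>i\<in>{m..<n}. sing_height \<omega> y i - a) \<le> real l - (a - sing_const) * (real n - real m)"
proof -
  have "(\<Sum>i\<in>{m..<n}. sing_height \<omega> y i) = (\<Sum>i\<in>{m..<n}. min (max 0 (sing_height \<omega> y i - 0)) (real l))"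
    using assms sing_height_nonneg by (intro sum.cong) (auto simp: max_def min_def)
  also have "\<dots> \<le> real l + (real n - real m) * (sing_const * exp (- (0 / d0)))"
    by (rule sum_truncated_excess_le[OF assms(1)])
  finally show ?thesis using assms(1) by (simp add: sum_subtractf algebra_simps of_nat_diff)
qed

text \<open>Depth above H at time n means that the net load since the last reset exceeds H. The
  heights cut off at H account for at most H plus \<open>sing_const\<close> per step, so the excess
  \<open>g\<close> over H must overload a queue whose service rate is what remains.\<close>

lemma card_deep_le:
  assumes "\<theta> \<in> generic_base \<omega>" "\<alpha> \<ge> 1" and a: "ln \<alpha> - ln 2 \<ge> sing_const + 1"
  shows "real (card {n. n < N \<and> real H < fibre_depth \<omega> \<alpha> \<theta> n})
     \<le> (\<Sum>i<N. max 0 (sing_height \<omega> \<theta> i - real H))"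
proof -
  define e where "e = ln \<alpha> - ln 2 - sing_const"
  define g where "g i = max 0 (sing_height \<omega> \<theta> i - real H)" for i
  have "e \<ge> 1" using a by (simp add: e_def)
  have "{n. n < N \<and> real H < fibre_depth \<omega> \<alpha> \<theta> n} \<subseteq> {n. n < N \<and> (\<exists>m\<le>n. 0 < (\<Sum>i\<in>{m..<n}. g i - e))}"
  proof clarify
    fix n assume n: "n < N" "real H < fibre_depth \<omega> \<alpha> \<theta> n"
    obtain m where m: "m \<le> n" "fibre_depth \<omega> \<alpha> \<theta> n \<le> (\<Sum>i\<in>{m..<n}. sing_height \<omega> \<theta> i - (ln \<alpha> - ln 2))"
      using queue_bound[of "fibre_depth \<omega> \<alpha> \<theta>" "\<lambda>i. sing_height \<omega> \<theta> i - (ln \<alpha> - ln 2)" n]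
        fibre_depth_Suc[OF assms(1)] fibre_depth_0[OF assms(2)] assms(2) by auto
    have "(\<Sum>i\<in>{m..<n}. sing_height \<omega> \<theta> i) = (\<Sum>i\<in>{m..<n}. min (max 0 (sing_height \<omega> \<theta> i - 0)) (real H) + g i)"
      using sing_height_nonneg by (intro sum.cong) (auto simp: max_def min_def g_def)
    also have "\<dots> = (\<Sum>i\<in>{m..<n}. min (max 0 (sing_height \<omega> \<theta> i - 0)) (real H)) + sum g {m..<n}"
      by (rule sum.distrib)
    also have "\<dots> \<le> real H + (real n - real m) * sing_const + sum g {m..<n}"
      using sum_truncated_excess_le[OF m(1), of \<theta> 0 H] by simp
    finally have heights: "(\<Sum>i\<in>{m..<n}. sing_height \<omega> \<theta> i) \<le> real H + (real n - real m) * sing_const + sum g {m..<n}" .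
    have "(\<Sum>i\<in>{m..<n}. sing_height \<omega> \<theta> i - (ln \<alpha> - ln 2))
        = (\<Sum>i\<in>{m..<n}. sing_height \<omega> \<theta> i) - (real n - real m) * (e + sing_const)"
      using m(1) by (simp add: sum_subtractf of_nat_diff e_def)
    moreover have "(\<Sum>i\<in>{m..<n}. g i - e) = sum g {m..<n} - (real n - real m) * e"
      using m(1) by (simp add: sum_subtractf of_nat_diff)
    moreover have "(real n - real m) * (e + sing_const) = (real n - real m) * e + (real n - real m) * sing_const"
      by (rule distrib_left)
    ultimately have "0 < (\<Sum>i\<in>{m..<n}. g i - e)"
      using m(2) n(2) heights by linarith
    then show "\<exists>m\<le>n. 0 < (\<Sum>i\<in>{m..<n}. g i - e)" using m by blast
  qed
  then have "card {n. n < N \<and> real H < fibre_depth \<omega> \<alpha> \<theta> n}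
     \<le> card {n. n < N \<and> (\<exists>m\<le>n. 0 < (\<Sum>i\<in>{m..<n}. g i - e))}"
    by (intro card_mono) auto
  also have "real \<dots> \<le> e * real (card {n. n < N \<and> (\<exists>m\<le>n. 0 < (\<Sum>i\<in>{m..<n}. g i - e))})"
    using \<open>e \<ge> 1\<close> by (simp add: mult_le_cancel_right1)
  also have "\<dots> \<le> (\<Sum>i<N. g i)"
    by (rule card_overloaded_le) (use \<open>e \<ge> 1\<close> in \<open>auto simp: g_def\<close>)
  finally show ?thesis by (simp add: g_def)
qed

text \<open>When \<open>\<theta>\<close> passes so close to the singularity that its fibre orbit is pinched for the next \<open>J\<close>
  steps, the orbit of \<open>\<theta>'\<close>, passing at distance \<open>s\<close>, recovers within these \<open>J\<close> steps, provided
  it was not too deep at the beginning of the preceding window of length \<open>H\<close>.\<close>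

lemma gap_after_visit:
  assumes good: "\<theta> \<in> generic_base \<omega>" "\<theta>' \<in> generic_base \<omega>"
    and \<alpha>: "\<alpha> \<ge> 1" "ln \<alpha> - ln 2 \<ge> sing_const + 1"
    and s: "0 < s" "s \<le> 1/4" "- ln s \<le> real l"
    and J: "J = 3 * l + 2" "3 * s \<le> c * real J powr (- d0)" "3 * s \<le> c * real H powr (- d0)"
    and \<rho>: "\<rho> \<le> s" "pi * \<rho> * \<alpha> ^ Suc J \<le> 1/2"
    and diff: "\<theta>' = \<theta> + s + of_int i0"
    and visit: "0 < \<theta> + real k * \<omega> - of_int m" "\<theta> + real k * \<omega> - of_int m < \<rho>"
    and H: "H \<le> k" "fibre_depth \<omega> \<alpha> \<theta>' (k - H) \<le> real H"
  obtains j where "j \<le> J"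
    "1 / (2 * \<alpha>) \<le> \<bar>fibre_orbit \<omega> \<alpha> 0 \<theta> 1 (k + 1 + j) - fibre_orbit \<omega> \<alpha> 0 \<theta>' 1 (k + 1 + j)\<bar>"
proof -
  define X where "X = fibre_orbit \<omega> \<alpha> 0 \<theta> 1"
  define Z where "Z = fibre_orbit \<omega> \<alpha> 0 \<theta>' 1"
  define W where "W = fibre_depth \<omega> \<alpha> \<theta>'"
  define b where "b i = sing_height \<omega> \<theta>' i - (ln \<alpha> - ln 2)" for i
  have \<alpha>0: "\<alpha> > 0" using \<alpha> by simp
  define u where "u = \<theta> + real k * \<omega> - of_int m"
  have u: "0 < u" "u < \<rho>" using visit by (simp_all add: u_def)
  \<comment> \<open>The visit of \<theta> lies on the positive side, so the offset s adds to it: the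
    distance of \<theta>' is u + s, at least s and at most 2 s. A visit from the other side could
    bring \<theta>' closer than s.\<close>
  have "\<theta>' + real k * \<omega> = (u + s) + of_int (m + i0)" by (simp add: u_def diff)
  then have near_eq: "circle_norm (\<theta>' + real k * \<omega>) = u + s"
    using circle_norm_add_of_int[of "u + s" "m + i0"] circle_norm_eq_self[of "u + s"] u s \<rho> by simp
  then have near: "circle_norm (\<theta>' + real k * \<omega>) \<le> 2 * s" using u \<rho> by simp
  have hk: "sing_height \<omega> \<theta>' k \<le> real l"
    using sing_height_le[of s \<theta>' k \<omega>] near_eq u s by simp
  have hwin: "sing_height \<omega> \<theta>' i \<le> real l" if "i \<noteq> k" "k \<le> i + M" "i \<le> k + M" "M = J \<or> M = H" for i M
  proof -
    have "3 * s \<le> c * real M powr (- d0)" using J that(4) by auto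
    then have "sing_height \<omega> \<theta>' i \<le> - ln s"
      by (rule sing_height_window[OF near s(1)]) (use that in auto)
    then show ?thesis using s by simp
  qed
  have stepW: "W (Suc n) \<le> max (W n + b n) 0" for n
    unfolding W_def b_def by (rule fibre_depth_Suc[OF good(2) \<alpha>0])
  have seg: "sum b {m..<n} \<le> real l - (real n - real m)"
    if mn: "m \<le> n" and hs: "\<And>i. m \<le> i \<Longrightarrow> i < n \<Longrightarrow> sing_height \<omega> \<theta>' i \<le> real l" for m n
  proof -
    have "sum b {m..<n} \<le> real l - (ln \<alpha> - ln 2 - sing_const) * (real n - real m)"
      unfolding b_def using mn hs by (rule sum_bounded_heights_le)
    moreover have "1 * (real n - real m) \<le> (ln \<alpha> - ln 2 - sing_const) * (real n - real m)"
      using \<alpha>(2) mn by (intro mult_right_mono) auto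
    ultimately show ?thesis by simp
  qed
  \<comment> \<open>If the depth was reset within the window, at most l has accumulated since.
    Otherwise the initial depth, at most H, has been paid off during the H steps at net rate at
    least 1.\<close>
  have Wk: "W k \<le> real l"
  proof -
    have before: "sum b {m..<k} \<le> real l - (real k - real m)" if "k - H \<le> m" "m \<le> k" for m
      using that H by (intro seg hwin[where M = H]) auto
    from queue_bound_from[of W b "k - H" k, OF stepW] show ?thesis
    proof
      assume "\<exists>m\<in>{k - H..k}. W k \<le> sum b {m..<k}"
      then obtain m where "m \<in> {k - H..k}" "W k \<le> sum b {m..<k}" by blast
      then show ?thesis using before[of m] by simp
    next
      assume "W k \<le> W (k - H) + sum b {k - H..<k}"
      then show ?thesis using before[of "k - H"] H by (simp add: W_def of_nat_diff)
    qed simp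
  qed
  have ln2: "ln 2 \<le> (1::real)" using ln_le_minus_one[of "2::real"] by simp
  have WSk: "W (Suc k) \<le> 2 * real l + 1"
  proof -
    have "W (Suc k) \<le> max (W k + b k) 0" by (rule stepW)
    also have "\<dots> \<le> 2 * real l + 1"
      using Wk hk \<alpha>(2) sing_const_pos by (auto simp: b_def)
    finally show ?thesis .
  qed
  \<comment> \<open>Origin of J = 3 l + 2: the depth after the passage is at most 2 l + 1, and J
    further steps without reset change it by at most l - J, which would leave it at most -1.\<close>
  have "\<exists>j\<le>J. W (k + 1 + j) \<le> 0"
  proof (rule ccontr)
    assume "\<not> ?thesis"
    then have pos: "W (k + 1 + j) > 0" if "j \<le> J" for j using that by (meson not_le)
    have "W (k + 1 + J) \<le> W (k + 1) + sum b {k + 1..<k + 1 + J}"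
    proof (rule queue_busy[of W b "k + 1" "k + 1 + J", OF stepW])
      fix i assume "k + 1 < i" "i \<le> k + 1 + J"
      then show "W i > 0" using pos[of "i - (k + 1)"] by simp
    qed simp
    also have "\<dots> \<le> W (k + 1) + (real l - real J)"
      using seg[of "k + 1" "k + 1 + J"] hwin[where M = J] by simp
    also have "\<dots> \<le> 0" using WSk by (simp add: J)
    finally show False using pos[of J] by simp
  qed
  then obtain j where j: "j \<le> J" "W (k + 1 + j) \<le> 0" by blast
  have "Z (k + 1 + j) > 0"
    unfolding Z_def using generic_base_sin_pos[OF good(2)] \<alpha>0 by (intro fibre_orbit_pos) auto
  then have Zbig: "1 / \<alpha> \<le> Z (k + 1 + j)"
    using fibre_orbit_ge_if_depth_le_0[of \<omega> \<alpha> \<theta>' "k + 1 + j"] j \<alpha>0 by (simp add: W_def Z_def)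
  have "tanh (\<alpha> * X k) * \<bar>sin (pi * (\<theta> + real k * \<omega>))\<bar> \<le> 1 * \<bar>sin (pi * (\<theta> + real k * \<omega>))\<bar>"
    by (rule mult_right_mono[OF less_imp_le[OF tanh_real_lt_1] abs_ge_zero])
  then have "X (k + 1) \<le> 1 * \<bar>sin (pi * (\<theta> + real k * \<omega>))\<bar>" by (simp add: X_def)
  also have "\<dots> \<le> pi * circle_norm (\<theta> + real k * \<omega>)" using abs_sin_pi_le by simp
  also have "circle_norm (\<theta> + real k * \<omega>) \<le> \<rho>"
    using circle_norm_le[of "\<theta> + real k * \<omega>" m] u by (simp add: u_def)
  finally have X1: "X (k + 1) \<le> pi * \<rho>" by simp
  have "X (k + 1 + j) \<le> \<alpha> ^ j * X (k + 1)"
    unfolding X_def using \<alpha> by (intro fibre_orbit_growth_le) auto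
  also have "\<dots> \<le> \<alpha> ^ J * (pi * \<rho>)"
    using X1 \<alpha> j fibre_orbit_pinched_bounds(1)[of \<alpha> 1 \<omega> \<theta> "k + 1"]
    by (intro mult_mono power_increasing) (auto simp: X_def)
  \<comment> \<open>The hypothesis on \<rho> contains one more power of \<alpha> than J steps of
    growth, so that the pinched orbit stays below half of the level 1 / \<alpha> reached by the
    other one.\<close>
  also have "\<dots> \<le> 1 / (2 * \<alpha>)"
    using \<rho>(2) \<alpha>0 by (simp add: field_simps)
  finally have "X (k + 1 + j) \<le> 1 / (2 * \<alpha>)" .
  moreover have "1 / \<alpha> = 1 / (2 * \<alpha>) + 1 / (2 * \<alpha>)" by (simp add: field_simps)
  ultimately show thesis using j(1) Zbig by (intro that[of j]) (auto simp: X_def Z_def)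
qed

text \<open>Visits have frequency at least 1 / K up to a bounded error. Those whose preceding window
  starts too deep have frequency at most 3 / (8 K); every other visit produces a gap within J + 1
  steps.\<close>

lemma eventually_gap_count_ge:
  assumes good: "\<theta> \<in> generic_base \<omega>" "\<theta>' \<in> generic_base \<omega>"
    and \<alpha>: "\<alpha> \<ge> 1" "ln \<alpha> - ln 2 \<ge> sing_const + 1"
    and s: "0 < s" "s \<le> 1/4" "- ln s \<le> real l"
    and J: "J = 3 * l + 2" "3 * s \<le> c * real J powr (- d0)" "3 * s \<le> c * real H powr (- d0)"
    and \<rho>: "\<rho> \<le> s" "pi * \<rho> * \<alpha> ^ Suc J \<le> 1/2"
    and diff: "\<theta>' = \<theta> + s + of_int i0"
    and K: "0 < K" "\<And>y. \<exists>k<K. \<exists>m::int. 0 < y + real k * \<omega> - of_int m \<and> y + real k * \<omega> - of_int m < \<rho>"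
    and H: "sing_const * exp (- (real H / d0)) \<le> 1 / (4 * real K)"
  shows "\<forall>\<^sub>F n in sequentially. real n * (1 / (8 * real K * (real J + 1)))
     \<le> real (fibre_gap_count \<omega> \<alpha> 0 (1 / (2 * \<alpha>)) (\<theta>, 1) (\<theta>', 1) n)"
proof -
  define visit where "visit k \<longleftrightarrow> (\<exists>m::int. 0 < \<theta> + real k * \<omega> - of_int m \<and> \<theta> + real k * \<omega> - of_int m < \<rho>)" for k
  define D where "D n = {k. k < n \<and> 1 / (2 * \<alpha>) \<le> \<bar>fibre_orbit \<omega> \<alpha> 0 \<theta> 1 k - fibre_orbit \<omega> \<alpha> 0 \<theta>' 1 k\<bar>}" for n
  define B where "B n = {i. i < n \<and> real H < fibre_depth \<omega> \<alpha> \<theta>' i}" for n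
  have recur: "\<exists>k\<in>{m..<m + K}. visit k" for m
  proof -
    obtain k i where "k < K" "0 < (\<theta> + real m * \<omega>) + real k * \<omega> - of_int i"
      "(\<theta> + real m * \<omega>) + real k * \<omega> - of_int i < \<rho>"
      using K(2)[of "\<theta> + real m * \<omega>"] by blast
    then show ?thesis unfolding visit_def by (intro bexI[of _ "m + k"] exI[of _ i]) (auto simp: algebra_simps)
  qed
  \<comment> \<open>Counting starts at H, where the preceding window fits. A gap time
    \<open>k + 1 + j\<close> with j \<le> J can stem from at most J + 1 visits k, hence the factor;
    the last visits may place their gaps as late as \<open>n + H + J\<close>.\<close>
  have count: "real (card {k\<in>{H..<H + n}. visit k}) \<le> real (card (B n)) + (real J + 1) * real (card (D (n + (H + J + 1))))" for n
  proof -
    have sub: "{k\<in>{H..<H + n}. visit k} \<subseteq> (\<lambda>i. i + H) ` B n \<union> (\<Union>j\<in>{..J}. (\<lambda>i. i - (j + 1)) ` D (n + (H + J + 1)))"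
    proof
      fix k assume k: "k \<in> {k\<in>{H..<H + n}. visit k}"
      show "k \<in> (\<lambda>i. i + H) ` B n \<union> (\<Union>j\<in>{..J}. (\<lambda>i. i - (j + 1)) ` D (n + (H + J + 1)))"
      proof (cases "k - H \<in> B n")
        case True
        then show ?thesis using k by (intro UnI1 image_eqI[of _ _ "k - H"]) auto
      next
        case False
        then have deep: "fibre_depth \<omega> \<alpha> \<theta>' (k - H) \<le> real H" using k by (auto simp: B_def)
        obtain m where m: "0 < \<theta> + real k * \<omega> - of_int m" "\<theta> + real k * \<omega> - of_int m < \<rho>"
          using k by (auto simp: visit_def)
        obtain j where j: "j \<le> J" "1 / (2 * \<alpha>) \<le> \<bar>fibre_orbit \<omega> \<alpha> 0 \<theta> 1 (k + 1 + j) - fibre_orbit \<omega> \<alpha> 0 \<theta>' 1 (k + 1 + j)\<bar>"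
          using gap_after_visit[OF good \<alpha> s J \<rho> diff m _ deep] k by auto
        then have "k + 1 + j \<in> D (n + (H + J + 1))" using k by (auto simp: D_def)
        then have "k \<in> (\<lambda>i. i - (j + 1)) ` D (n + (H + J + 1))" by (intro image_eqI[of _ _ "k + 1 + j"]) auto
        then show ?thesis using j(1) by blast
      qed
    qed
    have finB: "finite (B n)" and finD: "finite (D m)" for m by (auto simp: B_def D_def)
    have "card {k\<in>{H..<H + n}. visit k} \<le> card ((\<lambda>i. i + H) ` B n \<union> (\<Union>j\<in>{..J}. (\<lambda>i. i - (j + 1)) ` D (n + (H + J + 1))))"
      using finB finD by (intro card_mono[OF _ sub]) auto
    also have "\<dots> \<le> card ((\<lambda>i. i + H) ` B n) + card (\<Union>j\<in>{..J}. (\<lambda>i. i - (j + 1)) ` D (n + (H + J + 1)))"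
      by (rule card_Un_le)
    also have "\<dots> \<le> card (B n) + (\<Sum>j\<in>{..J}. card ((\<lambda>i. i - (j + 1)) ` D (n + (H + J + 1))))"
      using finB by (intro add_mono card_image_le card_UN_le) auto
    also have "\<dots> \<le> card (B n) + (\<Sum>j\<in>{..J}. card (D (n + (H + J + 1))))"
      using finD by (intro add_left_mono sum_mono card_image_le)
    finally have "real (card {k\<in>{H..<H + n}. visit k}) \<le> real (card (B n) + (\<Sum>j\<in>{..J}. card (D (n + (H + J + 1)))))"
      by (rule of_nat_mono)
    then show ?thesis by (simp add: algebra_simps)
  qed
  have "\<forall>\<^sub>F n in sequentially. (\<Sum>k<n. max 0 (sing_height \<omega> \<theta>' k - real H))
     \<le> real n * (sing_const * exp (- (real H / d0)) + 1 / (8 * real K))"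
    using K by (intro eventually_sum_excess_le good) auto
  moreover have "\<forall>\<^sub>F n in sequentially. 8 * real K + (real H + real J + 1) \<le> real n"
    using eventually_ge_at_top[of "8 * K + (H + J + 1)"] by eventually_elim simp
  ultimately have main: "\<forall>\<^sub>F n in sequentially. (real n + (real H + real J + 1)) / (8 * real K)
      \<le> (real J + 1) * real (card (D (n + (H + J + 1))))"
  proof eventually_elim
    case (elim n)
    have "real (card (B n)) \<le> (\<Sum>k<n. max 0 (sing_height \<omega> \<theta>' k - real H))"
      unfolding B_def by (rule card_deep_le[OF good(2) \<alpha>])
    also have "\<dots> \<le> real n * (sing_const * exp (- (real H / d0)) + 1 / (8 * real K))" using elim by simp
    also have "\<dots> \<le> real n * (1 / (4 * real K) + 1 / (8 * real K))" using H by (intro mult_left_mono add_right_mono) auto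
    also have "\<dots> = 3 * (real n / (8 * real K))" by (simp add: field_simps)
    finally have b: "real (card (B n)) \<le> 3 * (real n / (8 * real K))" .
    have v: "8 * (real n / (8 * real K)) - 1 \<le> real (card {k\<in>{H..<H + n}. visit k})"
      using card_visits_ge[of K visit n H] K(1) recur by simp
    \<comment> \<open>In units of n / (8 K) there are at least 8 visits less one single visit, and
      at most 3 deep times. As the unit is at least 1, more than 2 units remain, which covers the
      length n + H + J + 1 \<le> 2 n.\<close>
    have "1 \<le> real n / (8 * real K)" using elim(2) K(1) by (simp add: field_simps)
    moreover have "(real n + (real H + real J + 1)) / (8 * real K) \<le> (real n + real n) / (8 * real K)"
      using elim(2) by (intro divide_right_mono) auto
    moreover have "(real n + real n) / (8 * real K) = 2 * (real n / (8 * real K))" by simp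
    ultimately show ?case using count[of n] v b by linarith
  qed
  have "\<forall>\<^sub>F n in sequentially. real (n + (H + J + 1)) * (1 / (8 * real K * (real J + 1)))
      \<le> real (fibre_gap_count \<omega> \<alpha> 0 (1 / (2 * \<alpha>)) (\<theta>, 1) (\<theta>', 1) (n + (H + J + 1)))"
    using main
  proof eventually_elim
    case (elim n)
    have "real (n + (H + J + 1)) * (1 / (8 * real K * (real J + 1)))
      = (real n + (real H + real J + 1)) / (8 * real K) / (real J + 1)" by (simp add: add.assoc)
    also have "\<dots> \<le> real (card (D (n + (H + J + 1))))"
      using elim by (simp only: pos_divide_le_eq[of "real J + 1"] mult.commute[of _ "real J + 1"])
    finally show ?case by (simp add: fibre_gap_count_def D_def)
  qed
  then show ?thesis using eventually_sequentially_seg[of _ "H + J + 1"] by (rule iffD1[rotated])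
qed

end

text \<open>Take d0-th roots and compare the linear left side with the quadratic lower bound for exp
  (x / d0). The explicit threshold for x later becomes the bound on s.\<close>

lemma powr_le_exp:
  fixes x \<kappa> d0 :: real
  assumes "d0 > 0" "C > 0" "\<kappa> > 0" "x > 0" "2 * \<kappa> * d0\<^sup>2 / C powr (1 / d0) \<le> x"
  shows "(\<kappa> * x) powr d0 \<le> C * exp x"
proof -
  define D where "D = C powr (1 / d0)"
  have D: "D > 0" using assms(2) by (simp add: D_def)
  have "2 * \<kappa> * d0\<^sup>2 \<le> x * D" using assms(5) D by (simp add: D_def[symmetric] pos_divide_le_eq)
  then have "\<kappa> * x * (2 * d0\<^sup>2) \<le> D * x\<^sup>2"
    using mult_right_mono[of "2 * \<kappa> * d0\<^sup>2" "x * D" x] assms(4) by (simp add: power2_eq_square ac_simps)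
  then have "\<kappa> * x \<le> D * ((x / d0)\<^sup>2 / 2)"
    using assms(1) by (simp add: power_divide field_simps)
  also have "\<dots> \<le> D * exp (x / d0)"
  proof (rule mult_left_mono)
    have "0 \<le> x / d0" using assms by simp
    then show "(x / d0)\<^sup>2 / 2 \<le> exp (x / d0)"
      using exp_lower_Taylor_quadratic[of "x / d0"] by linarith
  qed (use D in simp)
  finally have "(\<kappa> * x) powr d0 \<le> (D * exp (x / d0)) powr d0"
    using assms by (intro powr_mono2) auto
  also have "\<dots> = C * exp x"
    using assms by (simp add: D_def powr_mult powr_powr exp_powr_real)
  finally show ?thesis .
qed

lemma generic_base_dense:
  assumes "0 \<le> a" "a < b" "b \<le> 1"
  obtains \<theta> where "\<theta> \<in> generic_base \<omega>" "a < \<theta>" "\<theta> < b"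
proof -
  have "\<not> {a<..<b} \<subseteq> {0..<1} - generic_base \<omega>"
  proof
    assume "{a<..<b} \<subseteq> {0..<1} - generic_base \<omega>"
    then have "negligible {a<..<b}"
      using generic_base_full_measure negligible_iff_null_sets negligible_subset by blast
    then show False using open_not_negligible[of "{a<..<b}"] assms by simp
  qed
  then show thesis using that assms by fastforce
qed

section \<open>Choice of scales and construction of separated sets\<close>

context diophantine_rotation
begin

text \<open>In terms of x = - ln s the times l, J and H can be chosen linear in x, while 1 / \<rho>
  and hence K are exponential in x. The gap frequency 1 / (8 K (J + 1)) is therefore at least a
  power of s.\<close>

lemma gap_frequency_parameters:
  assumes "\<alpha> \<ge> 1" "ln \<alpha> \<ge> 1"
  obtains s0 Q where "0 < s0" "s0 \<le> 1/4" "Q > 0"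
    "\<And>s. 0 < s \<Longrightarrow> s \<le> s0 \<Longrightarrow> \<exists>l J H K \<rho>. - ln s \<le> real l \<and> J = 3 * l + 2 \<and>
       3 * s \<le> c * real J powr (- d0) \<and> 3 * s \<le> c * real H powr (- d0) \<and> \<rho> \<le> s \<and>
       pi * \<rho> * \<alpha> ^ Suc J \<le> 1/2 \<and> 0 < K \<and>
       (\<forall>y. \<exists>k<K. \<exists>m::int. 0 < y + real k * \<omega> - of_int m \<and> y + real k * \<omega> - of_int m < \<rho>) \<and>
       sing_const * exp (- (real H / d0)) \<le> 1 / (4 * real K) \<and>
       s powr Q \<le> 1 / (8 * real K * (real J + 1))"
proof -
  define A where "A = ln \<alpha>"
  \<comment> \<open>Growth rates in x: K \<le> exp (\<kappa> x), from the visiting time with ln (2 /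
    \<rho>) \<le> (4 + 9 A) x, and H, J \<le> \<kappa>' x. The threshold x0 makes
    \<open>powr_le_exp\<close> applicable with constant c / 3, so both windows are free of second
    visits; x0 \<ge> 2 absorbs additive constants.\<close>
  define \<kappa> where "\<kappa> = \<bar>ln (8 / c)\<bar> + (1 + d0) * (4 + 9 * A)"
  define \<kappa>' where "\<kappa>' = d0 * (\<bar>ln (4 * sing_const)\<bar> + \<kappa>) + 8"
  define x0 where "x0 = max 2 (2 * \<kappa>' * d0\<^sup>2 / (c / 3) powr (1 / d0))"
  have A: "A \<ge> 1" using assms by (simp add: A_def)
  have kpos: "\<kappa> > 0" using A d0_pos by (auto simp: \<kappa>_def intro!: add_nonneg_pos mult_pos_pos)
  have k'8: "\<kappa>' \<ge> 8" using d0_pos kpos by (simp add: \<kappa>'_def)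
  \<comment> \<open>Besides exp (\<kappa> x) from K, the frequency loses 8 (J + 1) \<le> 64 x \<le>
    exp (6 x); hence the exponent \<kappa> + 6.\<close>
  show thesis
  proof (rule that[of "exp (- x0)" "\<kappa> + 6"])
    have "exp (- x0) \<le> exp (- 2)" by (simp add: x0_def)
    also have "exp (- 2) \<le> (1/4 :: real)"
    proof -
      have "(4::real) \<le> (1 + 1)\<^sup>2" by simp
      also have "\<dots> \<le> (exp 1)\<^sup>2" using exp_ge_add_one_self[of 1] by (intro power_mono) auto
      also have "\<dots> = exp 2" by (simp flip: exp_of_nat_mult)
      finally show ?thesis by (simp add: exp_minus divide_simps)
    qed
    finally show "exp (- x0) \<le> 1/4" .
    fix s :: real assume s: "0 < s" "s \<le> exp (- x0)"
    define x where "x = - ln s"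
    have sx: "s = exp (- x)" using s by (simp add: x_def)
    have "ln s \<le> ln (exp (- x0))" using s by (subst ln_le_cancel_iff) auto
    then have x: "x \<ge> x0" by (simp add: x_def)
    then have x2: "x \<ge> 2" by (simp add: x0_def)
    define l where "l = nat \<lceil>x\<rceil>"
    have l: "x \<le> real l" "real l \<le> x + 1" using x2 unfolding l_def by linarith+
    define J where "J = 3 * l + 2"
    have J: "real J + 1 \<le> 8 * x" "real J \<ge> 3 * x + 2"
      using l x2 by (simp_all add: J_def)
    \<comment> \<open>Since \<alpha> = exp A, this gives
      \<open>\<rho> * \<alpha> ^ Suc J = 1 / 8\<close>, and pi < 4 turns it into the required bound
      1/2.\<close>
    define \<rho> where "\<rho> = exp (- A * real (Suc J)) / 8"
    have "A * (3 * x) \<ge> 1 * x" using A x2 by (intro mult_mono) auto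
    moreover have "A * real (Suc J) \<ge> A * (3 * x)" using A J by (intro mult_left_mono) auto
    ultimately have AJ: "A * real (Suc J) \<ge> x" by linarith
    have "exp (- A * real (Suc J)) \<le> exp (- x)" using AJ by simp
    then have rho_s: "\<rho> \<le> s" unfolding \<rho>_def sx using exp_gt_zero[of "- x"] by linarith
    have rho_pos: "\<rho> > 0" by (simp add: \<rho>_def)
    have "exp (- x) \<le> exp 0" using x2 by (subst exp_le_cancel_iff) simp
    then have rho1: "\<rho> \<le> 1" using rho_s unfolding sx exp_zero by (rule order_trans[rotated])
    have "\<alpha> = exp A" using assms by (simp add: A_def)
    then have "\<alpha> ^ Suc J = exp (real (Suc J) * A)" by (simp only: exp_of_nat_mult)
    then have "\<rho> * \<alpha> ^ Suc J = 1 / 8"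
      by (simp add: \<rho>_def mult.commute flip: exp_add del: power_Suc of_nat_Suc)
    then have pin: "pi * \<rho> * \<alpha> ^ Suc J \<le> 1/2" using pi_less_4 by (simp only: mult.assoc)
    obtain K where K: "0 < K" "real K \<le> 8 / c * (2 / \<rho>) powr (1 + d0)"
      "\<And>y. \<exists>k<K. \<exists>m::int. 0 < y + real k * \<omega> - of_int m \<and> y + real k * \<omega> - of_int m < \<rho>"
      using visiting_time[OF rho_pos rho1] by metis
    have K_exp: "real K \<le> exp (\<kappa> * x)"
    proof -
      have "ln (16 :: real) \<le> 4"
      proof -
        have "(16::real) \<le> (5/2) ^ 4" by (simp add: eval_nat_numeral)
        also have "\<dots> \<le> exp 1 ^ 4" using exp_lower_Taylor_quadratic[of "1::real"] by (intro power_mono) auto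
        also have "\<dots> = exp 4" by (simp flip: exp_of_nat_mult)
        finally have "ln (16::real) \<le> ln (exp 4)" by (subst ln_le_cancel_iff) auto
        then show ?thesis by simp
      qed
      moreover have "ln (2 / \<rho>) = ln 16 + A * real (Suc J)"
        by (simp add: \<rho>_def ln_div ln_mult exp_minus divide_simps del: of_nat_Suc)
      moreover have "A * real (Suc J) \<le> A * (8 * x)" using A J by (intro mult_left_mono) auto
      moreover have "A * (8 * x) \<le> 9 * A * x" using A x2 by simp
      ultimately have lnr: "ln (2 / \<rho>) \<le> (4 + 9 * A) * x" using x2 by (simp add: ring_distribs)
      have "ln (8 / c * (2 / \<rho>) powr (1 + d0)) = ln (8 / c) + (1 + d0) * ln (2 / \<rho>)"
      proof -
        have "ln (u * v powr p) = ln u + p * ln v" if "0 < u" "0 < v" for u v p :: real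
          using that by (simp add: ln_mult_pos ln_powr)
        moreover have "0 < 8 / c" "0 < 2 / \<rho>" using c_pos rho_pos by simp_all
        ultimately show ?thesis by blast
      qed
      also have "\<dots> \<le> \<bar>ln (8 / c)\<bar> * x + (1 + d0) * ((4 + 9 * A) * x)"
      proof (rule add_mono)
        have "ln (8 / c) \<le> \<bar>ln (8 / c)\<bar> * 1" by simp
        also have "\<dots> \<le> \<bar>ln (8 / c)\<bar> * x" using x2 by (intro mult_left_mono) auto
        finally show "ln (8 / c) \<le> \<bar>ln (8 / c)\<bar> * x" .
      qed (use lnr d0_pos in \<open>auto intro!: mult_left_mono\<close>)
      also have "\<dots> = \<kappa> * x" by (simp add: \<kappa>_def algebra_simps)
      finally have "exp (ln (8 / c * (2 / \<rho>) powr (1 + d0))) \<le> exp (\<kappa> * x)"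
        unfolding exp_le_cancel_iff .
      then have "8 / c * (2 / \<rho>) powr (1 + d0) \<le> exp (\<kappa> * x)"
        using c_pos rho_pos by (subst (asm) exp_ln) auto
      then show ?thesis using K(2) by simp
    qed
    \<comment> \<open>Solves \<open>sing_const * exp (- (H / d0)) \<le> 1 / (4 * K)\<close> with K
      replaced by its bound exp (\<kappa> x).\<close>
    define H where "H = nat \<lceil>d0 * (\<bar>ln (4 * sing_const)\<bar> + \<kappa> * x)\<rceil> + 1"
    have H: "d0 * (\<bar>ln (4 * sing_const)\<bar> + \<kappa> * x) \<le> real H" "real H \<le> d0 * (\<bar>ln (4 * sing_const)\<bar> + \<kappa> * x) + 2"
    proof -
      have "0 \<le> d0 * (\<bar>ln (4 * sing_const)\<bar> + \<kappa> * x)" using d0_pos kpos x2 by simp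
      then show "d0 * (\<bar>ln (4 * sing_const)\<bar> + \<kappa> * x) \<le> real H"
        "real H \<le> d0 * (\<bar>ln (4 * sing_const)\<bar> + \<kappa> * x) + 2" unfolding H_def by linarith+
    qed
    have H_le: "real H \<le> \<kappa>' * x"
    proof -
      have "\<bar>ln (4 * sing_const)\<bar> * 1 \<le> \<bar>ln (4 * sing_const)\<bar> * x" using x2 by (intro mult_left_mono) auto
      then have "d0 * (\<bar>ln (4 * sing_const)\<bar> + \<kappa> * x) \<le> d0 * (\<bar>ln (4 * sing_const)\<bar> * x + \<kappa> * x)"
        using d0_pos by (intro mult_left_mono) auto
      then show ?thesis using H(2) x2 by (simp add: \<kappa>'_def algebra_simps)
    qed
    have J_le: "real J \<le> \<kappa>' * x"
      using J(1) mult_right_mono[OF k'8, of x] x2 by linarith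
    have window: "3 * s \<le> c * real M powr (- d0)" if "real M \<le> \<kappa>' * x" "M > 0" for M
    proof -
      have "(\<kappa>' * x) powr d0 \<le> (c / 3) * exp x"
        by (rule powr_le_exp) (use d0_pos c_pos k'8 x x2 in \<open>auto simp: x0_def\<close>)
      moreover have "real M powr d0 \<le> (\<kappa>' * x) powr d0" using that d0_pos by (intro powr_mono2) auto
      ultimately have "real M powr d0 \<le> (c / 3) * exp x" by linarith
      then show ?thesis using that(2) by (simp add: sx powr_minus exp_minus field_simps)
    qed
    have Hsmall: "sing_const * exp (- (real H / d0)) \<le> 1 / (4 * real K)"
    proof -
      have "ln (4 * sing_const) + \<kappa> * x \<le> real H / d0"
        using H(1) d0_pos abs_ge_self[of "ln (4 * sing_const)"]
        by (intro order_trans[OF add_right_mono, of "ln (4 * sing_const)" "\<bar>ln (4 * sing_const)\<bar>"])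
          (simp_all add: pos_le_divide_eq mult.commute)
      then have "exp (- (real H / d0)) \<le> exp (- (ln (4 * sing_const) + \<kappa> * x))" by simp
      also have "\<dots> = 1 / (4 * sing_const * exp (\<kappa> * x))"
      proof -
        have "exp (ln (4 * sing_const) + \<kappa> * x) = 4 * sing_const * exp (\<kappa> * x)"
          using sing_const_pos by (simp add: exp_add)
        then show ?thesis by (simp only: exp_minus inverse_eq_divide)
      qed
      also have "\<dots> \<le> 1 / (4 * sing_const * real K)"
        using K_exp K(1) sing_const_pos by (intro divide_left_mono mult_left_mono mult_pos_pos) auto
      finally have "sing_const * exp (- (real H / d0)) \<le> sing_const * (1 / (4 * sing_const * real K))"
        using sing_const_pos by (intro mult_left_mono) auto
      then show ?thesis using sing_const_pos by simp
    qed
    have freq: "s powr (\<kappa> + 6) \<le> 1 / (8 * real K * (real J + 1))"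
    proof -
      have e5: "(64::real) \<le> exp 5"
      proof -
        have "(64::real) \<le> (5/2) ^ 5" by (simp add: eval_nat_numeral)
        also have "\<dots> \<le> exp 1 ^ 5" using exp_lower_Taylor_quadratic[of "1::real"] by (intro power_mono) auto
        also have "\<dots> = exp 5" by (simp flip: exp_of_nat_mult)
        finally show ?thesis .
      qed
      have "8 * real K * (real J + 1) \<le> 8 * exp (\<kappa> * x) * (8 * x)"
        using K_exp J x2 by (intro mult_mono) auto
      also have "\<dots> = exp (\<kappa> * x) * (64 * x)" by simp
      also have "\<dots> \<le> exp (\<kappa> * x) * (exp (5 * x) * exp x)"
      proof (intro mult_left_mono mult_mono)
        have "exp 5 \<le> exp (5 * x)" using x2 by simp
        then show "64 \<le> exp (5 * x)" using e5 by linarith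
        show "x \<le> exp x" using exp_ge_add_one_self[of x] by linarith
      qed (use x2 in auto)
      also have "\<dots> = exp ((\<kappa> + 6) * x)" by (simp add: algebra_simps flip: exp_add)
      finally have "1 / exp ((\<kappa> + 6) * x) \<le> 1 / (8 * real K * (real J + 1))"
        using K(1) by (intro divide_left_mono) auto
      moreover have "s powr (\<kappa> + 6) = 1 / exp ((\<kappa> + 6) * x)"
        unfolding sx exp_powr_real by (simp add: exp_minus inverse_eq_divide mult.commute)
      ultimately show ?thesis by simp
    qed
    have "J > 0" "H > 0" by (simp_all add: J_def H_def)
    then show "\<exists>l J H K \<rho>. - ln s \<le> real l \<and> J = 3 * l + 2 \<and>
       3 * s \<le> c * real J powr (- d0) \<and> 3 * s \<le> c * real H powr (- d0) \<and> \<rho> \<le> s \<and>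
       pi * \<rho> * \<alpha> ^ Suc J \<le> 1/2 \<and> 0 < K \<and>
       (\<forall>y. \<exists>k<K. \<exists>m::int. 0 < y + real k * \<omega> - of_int m \<and> y + real k * \<omega> - of_int m < \<rho>) \<and>
       sing_const * exp (- (real H / d0)) \<le> 1 / (4 * real K) \<and>
       s powr (\<kappa> + 6) \<le> 1 / (8 * real K * (real J + 1))"
      using l(1)[unfolded x_def] window[OF J_le] window[OF H_le] rho_s pin K(1,3) Hsmall freq J_def
      by blast
  qed (use kpos in auto)
qed

lemma lower_ac_pinched_pos:
  assumes "\<alpha> \<ge> 1" "ln \<alpha> \<ge> ln 2 + sing_const + 1"
  shows "0 < lower_ac (submetric annulus_metric (generic_base \<omega> \<times> {0..1})) (pinched_map \<omega> \<alpha>)"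
proof -
  let ?m = "submetric annulus_metric (generic_base \<omega> \<times> {0..1})" and ?f = "perturbed_map \<omega> \<alpha> 0"
  have "(0::real) < ln 2" by simp
  then have "ln \<alpha> \<ge> 1" using assms(2) sing_const_pos by linarith
  obtain s0 Q where Q: "0 < s0" "s0 \<le> 1/4" "Q > 0"
    "\<And>s. 0 < s \<Longrightarrow> s \<le> s0 \<Longrightarrow> \<exists>l J H K \<rho>. - ln s \<le> real l \<and> J = 3 * l + 2 \<and>
       3 * s \<le> c * real J powr (- d0) \<and> 3 * s \<le> c * real H powr (- d0) \<and> \<rho> \<le> s \<and>
       pi * \<rho> * \<alpha> ^ Suc J \<le> 1/2 \<and> 0 < K \<and>
       (\<forall>y. \<exists>k<K. \<exists>m::int. 0 < y + real k * \<omega> - of_int m \<and> y + real k * \<omega> - of_int m < \<rho>) \<and>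
       sing_const * exp (- (real H / d0)) \<le> 1 / (4 * real K) \<and>
       s powr Q \<le> 1 / (8 * real K * (real J + 1))"
    using gap_frequency_parameters[OF assms(1) \<open>ln \<alpha> \<ge> 1\<close>] by blast
  \<comment> \<open>Base points more than s0 apart are then separated by the base alone, closer ones
    by the fibre gaps of size 1 / (2 \<alpha>).\<close>
  define \<delta> where "\<delta> = min (1 / (2 * \<alpha>)) s0"
  have "\<delta> > 0" using assms Q by (simp add: \<delta>_def)
  have shifted: "separated_points ?m ?f \<delta> (s powr Q) (\<theta>, 1) (\<theta>', 1)"
    if good: "\<theta> \<in> generic_base \<omega>" "\<theta>' \<in> generic_base \<omega>" and s: "0 < s" "s \<le> s0"
      and diff: "\<theta>' = \<theta> + s + of_int i0" for \<theta> \<theta>' s i0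
  proof (rule separated_pointsI)
    obtain l J H K \<rho> where P: "- ln s \<le> real l" "J = 3 * l + 2"
       "3 * s \<le> c * real J powr (- d0)" "3 * s \<le> c * real H powr (- d0)" "\<rho> \<le> s"
       "pi * \<rho> * \<alpha> ^ Suc J \<le> 1/2" "0 < K"
       "\<And>y. \<exists>k<K. \<exists>m::int. 0 < y + real k * \<omega> - of_int m \<and> y + real k * \<omega> - of_int m < \<rho>"
       "sing_const * exp (- (real H / d0)) \<le> 1 / (4 * real K)"
       "s powr Q \<le> 1 / (8 * real K * (real J + 1))"
      using Q(4)[OF s] by blast
    have \<alpha>: "ln \<alpha> - ln 2 \<ge> sing_const + 1" using assms by simp
    have s4: "s \<le> 1/4" using s Q by simp
    have base: "fst (\<theta>, 1::real) \<in> {0..<1}" "fst (\<theta>', 1::real) \<in> {0..<1}" using good by (auto simp: generic_base_def)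
    show "\<forall>\<^sub>F n in sequentially. real n * s powr Q \<le> real (sep_count ?m ?f \<delta> (\<theta>, 1) (\<theta>', 1) n)"
      using eventually_gap_count_ge[OF good assms(1) \<alpha> s(1) s4 P(1-6) diff P(7-9)]
    proof eventually_elim
      case (elim n)
      have "real n * s powr Q \<le> real n * (1 / (8 * real K * (real J + 1)))"
        using P(10) by (intro mult_left_mono) auto
      also have "\<dots> \<le> real (fibre_gap_count \<omega> \<alpha> 0 (1 / (2 * \<alpha>)) (\<theta>, 1) (\<theta>', 1) n)" by (rule elim)
      also have "\<dots> \<le> real (fibre_gap_count \<omega> \<alpha> 0 \<delta> (\<theta>, 1) (\<theta>', 1) n)"
        unfolding fibre_gap_count_def of_nat_le_iff by (intro card_mono) (auto simp: \<delta>_def)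
      also have "\<dots> \<le> real (sep_count ?m ?f \<delta> (\<theta>, 1) (\<theta>', 1) n)"
        using fibre_gap_count_le_sep_count[OF base] by simp
      finally show ?case .
    qed
  qed
  have sep: "separated_points ?m ?f \<delta> (t powr Q) (\<theta>, 1) (\<theta>', 1)"
    if good: "\<theta> \<in> generic_base \<omega>" "\<theta>' \<in> generic_base \<omega>" and t: "0 < t" "t \<le> 1" "t \<le> circle_norm (\<theta>' - \<theta>)" for \<theta> \<theta>' t
  proof (cases "circle_norm (\<theta>' - \<theta>) \<le> s0")
    case True
    define s where "s = circle_norm (\<theta>' - \<theta>)"
    have s: "0 < s" "s \<le> s0" "t \<le> s" using t True by (auto simp: s_def)
    obtain i where i: "s = \<bar>\<theta>' - \<theta> - of_int i\<bar>" unfolding s_def by (rule circle_norm_obtain)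
    \<comment> \<open>Separation is symmetric, so the roles may be chosen such that the second point
      lies ahead of the first by s.\<close>
    have "separated_points ?m ?f \<delta> (s powr Q) (\<theta>, 1) (\<theta>', 1)"
    proof (cases "0 \<le> \<theta>' - \<theta> - of_int i")
      case True
      then show ?thesis using shifted[OF good s(1,2), of i] i by simp
    next
      case False
      then show ?thesis using shifted[OF good(2,1) s(1,2), of "- i"] i
        by (subst separated_points_commute) simp
    qed
    moreover have "t powr Q \<le> s powr Q" using s t Q by (intro powr_mono2) auto
    ultimately show ?thesis
      unfolding separated_points_def using ereal_less_eq(3) order_trans by blast
  next
    case False
    have base: "fst (\<theta>, 1::real) \<in> {0..<1}" "fst (\<theta>', 1::real) \<in> {0..<1}" using good by (auto simp: generic_base_def)
    have far: "\<delta> \<le> circle_norm (fst (\<theta>, 1::real) - fst (\<theta>', 1::real))"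
      using False by (simp add: \<delta>_def circle_norm_diff_commute)
    have "t powr Q \<le> 1" using t Q by (intro powr_le1) auto
    then show ?thesis
      by (intro separated_pointsI) (simp add: sep_count_eq_all[OF base far] mult_left_le)
  qed
  have "ereal (1 / Q / 2) \<le> lower_ac ?m ?f"
  proof (rule lower_ac_ge[OF \<open>\<delta> > 0\<close>])
    show "(1 / 4 :: real) > 0" by simp
    show "1 / Q > 0" using Q by simp
    show "(1 / 4) powr Q > 0" by simp
    fix \<nu> :: real assume \<nu>: "0 < \<nu>" "\<nu> < (1 / 4) powr Q"
    \<comment> \<open>Points at circle distance at least t = \<nu>^(1/Q) are (\<delta>,
      \<nu>)-separated. They are placed in intervals of length t alternating with gaps of length t;
      the gap after the last interval secures the distance across 0.\<close>
    define t where "t = \<nu> powr (1 / Q)"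
    have tQ: "t powr Q = \<nu>" using \<nu> Q by (simp add: t_def powr_powr)
    have t0: "t > 0" using \<nu> by (simp add: t_def)
    have "t \<le> ((1 / 4) powr Q) powr (1 / Q)" unfolding t_def using \<nu> Q by (intro powr_mono2) auto
    then have t4: "t \<le> 1/4" using Q by (simp add: powr_powr)
    define N where "N = nat \<lfloor>1 / (2 * t)\<rfloor>"
    have "1 / (2 * t) \<ge> 2" using t0 t4 by (simp add: field_simps)
    then have N: "real N \<le> 1 / (2 * t)" "1 / (2 * t) - 1 \<le> real N" unfolding N_def by linarith+
    have "1 / (4 * t) \<ge> 1" using t0 t4 by (simp add: field_simps)
    moreover have "1 / (2 * t) = 1 / (4 * t) + 1 / (4 * t)" using t0 by (simp add: field_simps)
    ultimately have N_low: "1 / (4 * t) \<le> real N" using N(2) by linarith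
    have Nt: "2 * real N * t \<le> 1" using N(1) t0 by (simp add: field_simps)
    have "\<exists>\<theta>. \<theta> \<in> generic_base \<omega> \<and> 2 * real i * t < \<theta> \<and> \<theta> < (2 * real i + 1) * t" if "i < N" for i
    proof -
      have "(2 * real i + 1) * t \<le> 2 * real N * t" using that t0 by (intro mult_right_mono) auto
      then have "0 \<le> 2 * real i * t" "2 * real i * t < (2 * real i + 1) * t" "(2 * real i + 1) * t \<le> 1"
        using t0 Nt by (simp, simp, linarith)
      then show ?thesis by (rule generic_base_dense) blast
    qed
    then obtain \<theta> where \<theta>: "\<And>i. i < N \<Longrightarrow> \<theta> i \<in> generic_base \<omega>"
      "\<And>i. i < N \<Longrightarrow> 2 * real i * t < \<theta> i" "\<And>i. i < N \<Longrightarrow> \<theta> i < (2 * real i + 1) * t" by metis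
    have dist: "t \<le> circle_norm (\<theta> j - \<theta> i)" if "i < j" "j < N" for i j
    proof -
      have "(2 * real i + 2) * t \<le> 2 * real j * t" using that t0 by (intro mult_right_mono) auto
      then have lo: "t \<le> \<theta> j - \<theta> i" using \<theta>(2)[of j] \<theta>(3)[of i] that by (simp add: algebra_simps)
      have "(2 * real j + 2) * t \<le> 2 * real N * t" using that t0 by (intro mult_right_mono) auto
      moreover have "0 \<le> 2 * real i * t" using t0 by simp
      ultimately have hi: "\<theta> j - \<theta> i \<le> 1 - t" using \<theta>(3)[of j] \<theta>(2)[of i] that Nt by (simp add: algebra_simps)
      obtain m where m: "circle_norm (\<theta> j - \<theta> i) = \<bar>\<theta> j - \<theta> i - of_int m\<bar>" by (rule circle_norm_obtain)
      have "m \<le> 0 \<or> m \<ge> 1" by linarith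
      then have "real_of_int m \<le> 0 \<or> real_of_int m \<ge> 1" by auto
      then show ?thesis using lo hi m by linarith
    qed
    have sepij: "separated_points ?m ?f \<delta> \<nu> (\<theta> i, 1) (\<theta> j, 1)" if "i < N" "j < N" "i \<noteq> j" for i j
    proof (cases "i < j")
      case True
      then show ?thesis using sep[OF \<theta>(1)[of i] \<theta>(1)[of j] t0 _ dist[of i j]] that t4 tQ by simp
    next
      case False
      then show ?thesis using sep[OF \<theta>(1)[of j] \<theta>(1)[of i] t0 _ dist[of j i]] that t4 tQ
        by (subst separated_points_commute) simp
    qed
    define T where "T = (\<lambda>i. (\<theta> i, 1::real)) ` {..<N}"
    have "inj_on (\<lambda>i. (\<theta> i, 1::real)) {..<N}"
    proof (rule inj_onI, rule ccontr)
      fix i j assume ij: "i \<in> {..<N}" "j \<in> {..<N}" "(\<theta> i, 1::real) = (\<theta> j, 1)" "i \<noteq> j"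
      then have "circle_norm (\<theta> i - \<theta> j) = 0" "circle_norm (\<theta> j - \<theta> i) = 0" by simp_all
      then show False using dist[of i j] dist[of j i] ij t0 by (cases "i < j") auto
    qed
    then have "card T = N" by (simp add: T_def card_image)
    moreover have "separated_set ?m ?f \<delta> \<nu> T"
      using sepij \<theta>(1) by (fastforce simp: separated_set_def T_def generic_base_def)
    ultimately have "enat N \<le> Sep ?m ?f \<delta> \<nu>" using Sep_ge[of ?m ?f \<delta> \<nu> T] by (simp add: T_def)
    moreover have "1 / 4 * \<nu> powr - (1 / Q) \<le> real N"
      using N_low by (simp add: t_def powr_minus divide_simps)
    ultimately show "\<exists>N. enat N \<le> Sep ?m ?f \<delta> \<nu> \<and> 1 / 4 * \<nu> powr - (1 / Q) \<le> real N" by blast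
  qed
  moreover have "0 < ereal (1 / Q / 2)" using Q by simp
  ultimately show ?thesis unfolding pinched_eq_perturbed by (rule order.strict_trans2[rotated])
qed

end

section \<open>The perturbed maps\<close>

lemma fibre_orbit_add:
  "fibre_orbit \<omega> \<alpha> \<epsilon> y x (n + m) = fibre_orbit \<omega> \<alpha> \<epsilon> (y + real n * \<omega>) (fibre_orbit \<omega> \<alpha> \<epsilon> y x n) m"
  by (induction m) (auto simp: algebra_simps)

text \<open>The forcing may exceed 1 here, so the bounds come from the self-map hypothesis instead
  of the formula.\<close>

lemma fibre_orbit_perturbed_bounds:
  assumes self: "perturbed_map \<omega> \<alpha> \<epsilon> \<in> mspace annulus_metric \<rightarrow> mspace annulus_metric"
    and "y \<in> {0..<1}" "x \<in> {0..1}"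
  shows "0 \<le> fibre_orbit \<omega> \<alpha> \<epsilon> y x n" "fibre_orbit \<omega> \<alpha> \<epsilon> y x n \<le> 1"
proof -
  have "(perturbed_map \<omega> \<alpha> \<epsilon> ^^ n) (y, x) \<in> mspace annulus_metric"
  proof (induction n)
    case (Suc n)
    then show ?case using self by (simp add: Pi_iff del: mspace_annulus)
  qed (use assms in simp)
  moreover have "frac y = y" using assms by (simp add: frac_eq)
  ultimately show "0 \<le> fibre_orbit \<omega> \<alpha> \<epsilon> y x n" "fibre_orbit \<omega> \<alpha> \<epsilon> y x n \<le> 1"
    using perturbed_map_iterate[of n \<omega> \<alpha> \<epsilon> y x] by simp_all
qed

text \<open>The logarithm of the fibre derivative on the zero section. The sums
  \<open>log_rate_sum\<close> are its Birkhoff sums, so the case distinction for \<epsilon> > 0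
  concerns the stability of the zero section.\<close>

definition log_rate :: "real \<Rightarrow> real \<Rightarrow> real \<Rightarrow> real" where
  "log_rate \<alpha> \<epsilon> y = ln (\<alpha> * (\<bar>sin (pi * y)\<bar> + \<epsilon>))"

definition log_rate_sum :: "real \<Rightarrow> real \<Rightarrow> real \<Rightarrow> nat \<Rightarrow> real \<Rightarrow> real" where
  "log_rate_sum \<omega> \<alpha> \<epsilon> n y = (\<Sum>k<n. log_rate \<alpha> \<epsilon> (y + real k * \<omega>))"

lemma log_rate_sum_add:
  "log_rate_sum \<omega> \<alpha> \<epsilon> (n + k) y = log_rate_sum \<omega> \<alpha> \<epsilon> n y + log_rate_sum \<omega> \<alpha> \<epsilon> k (y + real n * \<omega>)"
  by (induction k) (auto simp: log_rate_sum_def algebra_simps)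

lemma abs_ln_sin_diff_le:
  assumes "\<epsilon> > 0"
  shows "\<bar>ln (\<bar>sin (pi * y)\<bar> + \<epsilon>) - ln (\<bar>sin (pi * z)\<bar> + \<epsilon>)\<bar> \<le> pi / \<epsilon> * circle_norm (y - z)"
proof -
  have "\<bar>ln (\<bar>sin (pi * y)\<bar> + \<epsilon>) - ln (\<bar>sin (pi * z)\<bar> + \<epsilon>)\<bar>
      \<le> \<bar>(\<bar>sin (pi * y)\<bar> + \<epsilon>) - (\<bar>sin (pi * z)\<bar> + \<epsilon>)\<bar> / \<epsilon>"
    using assms by (intro abs_ln_diff_le) auto
  also have "\<dots> \<le> pi * circle_norm (y - z) / \<epsilon>"
    using abs_sin_pi_diff_le[of y z] assms by (intro divide_right_mono) auto
  finally show ?thesis by simp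
qed

lemma abs_log_rate_diff_le:
  assumes "\<alpha> > 0" "\<epsilon> > 0"
  shows "\<bar>log_rate \<alpha> \<epsilon> y - log_rate \<alpha> \<epsilon> z\<bar> \<le> pi / \<epsilon> * circle_norm (y - z)"
proof -
  have "log_rate \<alpha> \<epsilon> u = ln \<alpha> + ln (\<bar>sin (pi * u)\<bar> + \<epsilon>)" for u
    using assms by (simp add: log_rate_def ln_mult_pos add_nonneg_pos)
  then show ?thesis using abs_ln_sin_diff_le[OF assms(2), of y z] by simp
qed

lemma log_rate_bounded:
  assumes "\<alpha> > 0" "\<epsilon> > 0"
  obtains M where "M \<ge> 0" "\<And>y. \<bar>log_rate \<alpha> \<epsilon> y\<bar> \<le> M"
proof (rule that[of "\<bar>log_rate \<alpha> \<epsilon> 0\<bar> + pi / \<epsilon> * (1 / 2)"])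
  fix y
  have "pi / \<epsilon> * circle_norm (y - 0) \<le> pi / \<epsilon> * (1 / 2)"
    using assms circle_norm_le_half by (intro mult_left_mono) auto
  then show "\<bar>log_rate \<alpha> \<epsilon> y\<bar> \<le> \<bar>log_rate \<alpha> \<epsilon> 0\<bar> + pi / \<epsilon> * (1 / 2)"
    using abs_log_rate_diff_le[OF assms, of y 0] by linarith
qed (use assms in simp)

lemma abs_log_rate_sum_le:
  assumes "\<And>y. \<bar>log_rate \<alpha> \<epsilon> y\<bar> \<le> M"
  shows "\<bar>log_rate_sum \<omega> \<alpha> \<epsilon> n y\<bar> \<le> real n * M"
  unfolding log_rate_sum_def using sum_norm_bound[of "{..<n}" "\<lambda>k. log_rate \<alpha> \<epsilon> (y + real k * \<omega>)" M] assms by simp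

text \<open>Telescoping: the linear growth at 0 minus the drops caused by the nonlinearity. Small
  drops give growth in the expanding case; in the other case the identity bounds the total drop and
  so the number of large values.\<close>

lemma ln_fibre_orbit:
  assumes "\<alpha> > 0" "\<epsilon> > 0" "x > 0"
  shows "ln (fibre_orbit \<omega> \<alpha> \<epsilon> y x n) = ln x + log_rate_sum \<omega> \<alpha> \<epsilon> n y
    - (\<Sum>k<n. log_drop (\<alpha> * fibre_orbit \<omega> \<alpha> \<epsilon> y x k))"
proof (induction n)
  case (Suc n)
  define X where "X = fibre_orbit \<omega> \<alpha> \<epsilon> y x n"
  define r where "r = \<bar>sin (pi * (y + real n * \<omega>))\<bar> + \<epsilon>"
  have "r > 0" using assms by (simp add: r_def add_nonneg_pos)
  have "X > 0" unfolding X_def using assms by (intro fibre_orbit_pos) (auto simp: add_nonneg_pos)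
  have "ln (fibre_orbit \<omega> \<alpha> \<epsilon> y x (Suc n)) = ln (tanh (\<alpha> * X) * r)"
    by (simp add: X_def r_def)
  also have "\<dots> = ln (tanh (\<alpha> * X)) + ln r"
    using \<open>X > 0\<close> \<open>r > 0\<close> assms by (intro ln_mult_pos) auto
  also have "\<dots> = ln X + log_rate \<alpha> \<epsilon> (y + real n * \<omega>) - log_drop (\<alpha> * X)"
    using \<open>X > 0\<close> \<open>r > 0\<close> assms by (simp add: log_drop_def log_rate_def r_def[symmetric] ln_mult_pos)
  finally show ?case using Suc by (simp add: X_def log_rate_sum_def)
qed (simp add: log_rate_sum_def)

lemma fibre_orbit_lower_step:
  assumes "\<alpha> > 0" "\<epsilon> > 0" "0 \<le> fibre_orbit \<omega> \<alpha> \<epsilon> y x n" "fibre_orbit \<omega> \<alpha> \<epsilon> y x n \<le> 1"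
  shows "\<alpha> * \<epsilon> / (1 + \<alpha>) * fibre_orbit \<omega> \<alpha> \<epsilon> y x n \<le> fibre_orbit \<omega> \<alpha> \<epsilon> y x (Suc n)"
proof -
  define X where "X = fibre_orbit \<omega> \<alpha> \<epsilon> y x n"
  have X: "0 \<le> X" "X \<le> 1" using assms by (simp_all add: X_def)
  have "\<alpha> * X / (1 + \<alpha>) \<le> \<alpha> * X / (1 + \<alpha> * X)"
    using X assms by (intro divide_left_mono mult_pos_pos) (auto intro!: add_pos_nonneg mult_left_le)
  also have "\<dots> \<le> tanh (\<alpha> * X)" using X assms by (intro tanh_lower) simp
  finally have "\<alpha> * X / (1 + \<alpha>) * \<epsilon> \<le> tanh (\<alpha> * X) * (\<bar>sin (pi * (y + real n * \<omega>))\<bar> + \<epsilon>)"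
    using X assms by (intro mult_mono) auto
  then show ?thesis by (simp add: X_def mult.commute mult.left_commute)
qed

lemma abs_diff_le_abs_ln_diff:
  assumes "0 < x" "x \<le> 1" "0 < z" "z \<le> (1::real)"
  shows "\<bar>x - z\<bar> \<le> \<bar>ln x - ln z\<bar>"
proof -
  have *: "u - v \<le> ln u - ln v" if "0 < v" "v \<le> u" "u \<le> 1" for u v :: real
  proof -
    have "ln v - ln u \<le> (v - u) / u" using that by (intro ln_diff_le) auto
    moreover have "u - v \<le> (u - v) / u" using that by (simp add: le_divide_eq mult_left_le)
    moreover have "(v - u) / u = - ((u - v) / u)" by (simp add: minus_divide_left)
    ultimately show ?thesis by linarith
  qed
  show ?thesis using *[of z x] *[of x z] assms by (cases "z \<le> x") auto
qed

text \<open>A block of N steps spent below r loses at most a / 2 to the drops and so expands by at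
  least exp (a / 2). A block that exceeds r cannot fall below d by its end, because each step keeps
  at least the fraction \<beta>. Times inside a block cost a further \<beta>^N.\<close>

lemma eventually_ge_of_expanding_block:
  assumes \<alpha>: "\<alpha> > 0" and \<epsilon>: "\<epsilon> > 0"
    and self: "perturbed_map \<omega> \<alpha> \<epsilon> \<in> mspace annulus_metric \<rightarrow> mspace annulus_metric"
    and N: "N > 0" "a > 0" "\<And>y. a \<le> log_rate_sum \<omega> \<alpha> \<epsilon> N y"
  obtains b where "b > 0"
    "\<And>y x. y \<in> {0..<1} \<Longrightarrow> 0 < x \<Longrightarrow> x \<le> 1 \<Longrightarrow> \<forall>\<^sub>F k in sequentially. b \<le> fibre_orbit \<omega> \<alpha> \<epsilon> y x k"
proof -
  define \<beta> where "\<beta> = min 1 (\<alpha> * \<epsilon> / (1 + \<alpha>))"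
  have \<beta>: "0 < \<beta>" "\<beta> \<le> 1" using \<alpha> \<epsilon> by (auto simp: \<beta>_def)
  \<comment> \<open>Since \<open>log_drop y \<le> y\<close>, N steps below r have total drop at most
    N \<alpha> r = a / 2.\<close>
  define r where "r = a / (2 * real N * \<alpha>)"
  have "r > 0" using N \<alpha> by (simp add: r_def)
  define d where "d = r * \<beta> ^ N"
  have "d > 0" using \<open>r > 0\<close> \<beta> by (simp add: d_def)
  show thesis
  proof (rule that[of "d * \<beta> ^ N"])
    fix y x :: real assume y: "y \<in> {0..<1}" and x: "0 < x" "x \<le> 1"
    define X where "X = fibre_orbit \<omega> \<alpha> \<epsilon> y x"
    have bounds: "0 \<le> X k" "X k \<le> 1" for k
      unfolding X_def using fibre_orbit_perturbed_bounds[OF self y] x by auto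
    have pos: "0 < X k" for k
      unfolding X_def using \<alpha> \<epsilon> x by (intro fibre_orbit_pos) (auto simp: add_nonneg_pos)
    have stepX: "\<beta> * X k \<le> X (Suc k)" for k
    proof -
      have "\<beta> * X k \<le> \<alpha> * \<epsilon> / (1 + \<alpha>) * X k"
        using bounds by (intro mult_right_mono) (auto simp: \<beta>_def)
      also have "\<dots> \<le> X (Suc k)"
        unfolding X_def using \<alpha> \<epsilon> bounds by (intro fibre_orbit_lower_step) (auto simp: X_def)
      finally show ?thesis .
    qed
    have stepsX: "\<beta> ^ i * X k \<le> X (k + i)" for i k
    proof (induction i)
      case (Suc i)
      have "\<beta> ^ Suc i * X k = \<beta> * (\<beta> ^ i * X k)" by simp
      also have "\<dots> \<le> \<beta> * X (k + i)" using Suc \<beta> by (intro mult_left_mono) auto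
      also have "\<dots> \<le> X (k + Suc i)" using stepX[of "k + i"] by simp
      finally show ?case .
    qed simp
    have steps_le: "\<beta> ^ N * X k \<le> X (k + i)" if "i \<le> N" for i k
    proof -
      have "\<beta> ^ N * X k \<le> \<beta> ^ i * X k" using that \<beta> bounds by (intro mult_right_mono power_decreasing) auto
      then show ?thesis using stepsX[of i k] by simp
    qed
    have block: "min (exp (a / 2) * X k) d \<le> X (k + N)" for k
    proof (cases "\<forall>i<N. X (k + i) \<le> r")
      case True
      have eq: "X (k + i) = fibre_orbit \<omega> \<alpha> \<epsilon> (y + real k * \<omega>) (X k) i" for i
        unfolding X_def by (rule fibre_orbit_add)
      have "ln (X (k + N)) = ln (X k) + log_rate_sum \<omega> \<alpha> \<epsilon> N (y + real k * \<omega>) - (\<Sum>i<N. log_drop (\<alpha> * X (k + i)))"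
        unfolding eq by (rule ln_fibre_orbit[OF \<alpha> \<epsilon> pos])
      moreover have "(\<Sum>i<N. log_drop (\<alpha> * X (k + i))) \<le> (\<Sum>i<N. a / (2 * real N))"
      proof (rule sum_mono)
        fix i assume "i \<in> {..<N}"
        then have "\<alpha> * X (k + i) \<le> \<alpha> * r" using True \<alpha> by (intro mult_left_mono) auto
        also have "\<dots> = a / (2 * real N)" using \<alpha> by (simp add: r_def)
        finally show "log_drop (\<alpha> * X (k + i)) \<le> a / (2 * real N)"
          using log_drop_le[of "\<alpha> * X (k + i)"] pos \<alpha> by (smt (verit) mult_pos_pos)
      qed
      moreover have "(\<Sum>i<N. a / (2 * real N)) = a / 2" using N by simp
      ultimately have "ln (X k) + a / 2 \<le> ln (X (k + N))" using N(3)[of "y + real k * \<omega>"] by linarith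
      then have "exp (ln (X k) + a / 2) \<le> exp (ln (X (k + N)))" unfolding exp_le_cancel_iff .
      then have "exp (a / 2) * X k \<le> X (k + N)" using pos by (simp add: exp_add mult.commute)
      then show ?thesis by simp
    next
      case False
      then obtain i where i: "i < N" "r < X (k + i)" by (auto simp: not_le)
      have "d \<le> \<beta> ^ N * X (k + i)" using i \<beta> by (simp add: d_def mult.commute)
      also have "\<dots> \<le> X (k + i + (N - i))" by (rule steps_le) simp
      finally show ?thesis using i by simp
    qed
    have "min (exp (a / 2) ^ j * x) d \<le> X (j * N)" for j
    proof (induction j)
      case 0
      then show ?case by (simp add: X_def)
    next
      case (Suc j)
      have e1: "1 \<le> exp (a / 2)" using N by simp
      have "min (exp (a / 2) ^ Suc j * x) d \<le> min (exp (a / 2) * min (exp (a / 2) ^ j * x) d) d"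
        using e1 \<open>d > 0\<close> mult_right_mono[OF e1, of d] by (auto simp: min_mult_distrib_left min_def)
      also have "\<dots> \<le> min (exp (a / 2) * X (j * N)) d" using Suc by (intro min.mono mult_left_mono) auto
      also have "\<dots> \<le> X (j * N + N)" by (rule block)
      finally show ?case by (simp add: add.commute)
    qed note iter = this
    obtain j0 where j0: "d / x < exp (a / 2) ^ j0"
      using real_arch_pow[of "exp (a / 2)" "d / x"] N by auto
    have late: "d \<le> X (j * N)" if "j \<ge> j0" for j
    proof -
      have "exp (a / 2) ^ j0 \<le> exp (a / 2) ^ j" using that N by (intro power_increasing) auto
      then have "d / x < exp (a / 2) ^ j" using j0 by linarith
      then have "d \<le> exp (a / 2) ^ j * x" using x by (simp add: divide_less_eq less_imp_le)
      then show ?thesis using iter[of j] by simp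
    qed
    show "\<forall>\<^sub>F k in sequentially. d * \<beta> ^ N \<le> fibre_orbit \<omega> \<alpha> \<epsilon> y x k"
      using eventually_ge_at_top[of "j0 * N"]
    proof eventually_elim
      case (elim k)
      have "j0 \<le> k div N" using elim N by (simp add: less_eq_div_iff_mult_less_eq)
      then have "\<beta> ^ N * d \<le> \<beta> ^ N * X (k div N * N)"
        using late[of "k div N"] \<beta> by (intro mult_left_mono) auto
      also have "\<dots> \<le> X (k div N * N + k mod N)" using N by (intro steps_le) (simp add: less_imp_le)
      finally show ?case by (simp add: X_def mult.commute)
    qed
  qed (use \<open>d > 0\<close> \<beta> in simp)
qed

text \<open>Above b the fibre distance controls the logarithmic distance \<open>u\<close>. While the
  fibre distance is at least b \<delta> / 2, u decreases by a fixed amount; below that threshold u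
  is at most \<delta> / 2. So u eventually enters, and never leaves, a range below \<delta>, and it
  dominates the fibre distance.\<close>

lemma eventually_no_gap:
  assumes \<alpha>: "\<alpha> > 0" and \<epsilon>: "\<epsilon> > 0"
    and self: "perturbed_map \<omega> \<alpha> \<epsilon> \<in> mspace annulus_metric \<rightarrow> mspace annulus_metric"
    and "\<delta> > 0" "b > 0"
    and low: "\<And>y x. y \<in> {0..<1} \<Longrightarrow> 0 < x \<Longrightarrow> x \<le> 1 \<Longrightarrow> \<forall>\<^sub>F k in sequentially. b \<le> fibre_orbit \<omega> \<alpha> \<epsilon> y x k"
  obtains \<eta> where "\<eta> > 0"
    "\<And>y z x x'. y \<in> {0..<1} \<Longrightarrow> z \<in> {0..<1} \<Longrightarrow> 0 < x \<Longrightarrow> x \<le> 1 \<Longrightarrow> 0 < x' \<Longrightarrow> x' \<le> 1 \<Longrightarrow>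
      circle_norm (y - z) < \<eta> \<Longrightarrow>
      \<forall>\<^sub>F k in sequentially. \<bar>fibre_orbit \<omega> \<alpha> \<epsilon> y x k - fibre_orbit \<omega> \<alpha> \<epsilon> z x' k\<bar> < \<delta>"
proof -
  obtain \<gamma> where \<gamma>: "\<gamma> > 0"
    "\<And>x x'. 0 < x' \<Longrightarrow> x \<le> 1 \<Longrightarrow> x - x' \<ge> b * \<delta> / 2 \<Longrightarrow> log_drop (\<alpha> * x) - log_drop (\<alpha> * x') \<ge> \<gamma>"
    using log_drop_gap[OF \<alpha>, of "b * \<delta> / 2"] \<open>\<delta> > 0\<close> \<open>b > 0\<close> by (metis half_gt_zero mult_pos_pos)
  \<comment> \<open>Bound for the forcing per step: at most half of the contraction \<gamma>, so
    that descent persists, and at most \<delta> / 4, so that a single overshoot from \<delta> / 2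
    stays below \<delta>. The Lipschitz constant pi / \<epsilon> converts it into a base
    distance.\<close>
  define \<kappa> where "\<kappa> = min (\<gamma> / 2) (\<delta> / 4)"
  have \<kappa>: "\<kappa> > 0" "\<kappa> \<le> \<gamma> / 2" "\<kappa> \<le> \<delta> / 4" using \<gamma>(1) \<open>\<delta> > 0\<close> by (auto simp: \<kappa>_def)
  show thesis
  proof (rule that[of "\<kappa> * \<epsilon> / pi"])
    fix y z x x' :: real
    assume yz: "y \<in> {0..<1}" "z \<in> {0..<1}" and xx: "0 < x" "x \<le> 1" "0 < x'" "x' \<le> 1"
      and close: "circle_norm (y - z) < \<kappa> * \<epsilon> / pi"
    define X where "X = fibre_orbit \<omega> \<alpha> \<epsilon> y x"
    define Z where "Z = fibre_orbit \<omega> \<alpha> \<epsilon> z x'"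
    define u where "u k = \<bar>ln (X k) - ln (Z k)\<bar>" for k
    have le1: "X k \<le> 1" "Z k \<le> 1" for k
      unfolding X_def Z_def using fibre_orbit_perturbed_bounds[OF self] yz xx by auto
    have pos: "0 < X k" "0 < Z k" for k
      unfolding X_def Z_def using \<alpha> \<epsilon> xx by (auto intro!: fibre_orbit_pos simp: add_nonneg_pos)
    have forcing: "\<bar>ln (\<bar>sin (pi * (y + real k * \<omega>))\<bar> + \<epsilon>) - ln (\<bar>sin (pi * (z + real k * \<omega>))\<bar> + \<epsilon>)\<bar> \<le> \<kappa>" for k
    proof -
      have "\<bar>ln (\<bar>sin (pi * (y + real k * \<omega>))\<bar> + \<epsilon>) - ln (\<bar>sin (pi * (z + real k * \<omega>))\<bar> + \<epsilon>)\<bar>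
        \<le> pi / \<epsilon> * circle_norm ((y + real k * \<omega>) - (z + real k * \<omega>))" by (rule abs_ln_sin_diff_le[OF \<epsilon>])
      also have "\<dots> \<le> pi / \<epsilon> * (\<kappa> * \<epsilon> / pi)" using close \<epsilon> by (intro mult_left_mono) auto
      also have "\<dots> = \<kappa>" using \<epsilon> by simp
      finally show ?thesis .
    qed
    have step: "u (Suc k) \<le> u k - \<bar>log_drop (\<alpha> * X k) - log_drop (\<alpha> * Z k)\<bar> + \<kappa>" for k
    proof -
      have "u (Suc k) \<le> u k - \<bar>log_drop (\<alpha> * X k) - log_drop (\<alpha> * Z k)\<bar>
         + \<bar>ln (\<bar>sin (pi * (y + real k * \<omega>))\<bar> + \<epsilon>) - ln (\<bar>sin (pi * (z + real k * \<omega>))\<bar> + \<epsilon>)\<bar>"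
        unfolding u_def X_def Z_def
        by (rule fibre_orbit_log_gap_step) (use \<alpha> \<epsilon> pos[of k] in \<open>auto simp: X_def Z_def add_nonneg_pos\<close>)
      then show ?thesis using forcing[of k] by linarith
    qed
    have descent: "u (Suc k) \<le> u k - \<gamma> / 2" if "b * \<delta> / 2 \<le> \<bar>X k - Z k\<bar>" for k
    proof -
      have "\<gamma> \<le> \<bar>log_drop (\<alpha> * X k) - log_drop (\<alpha> * Z k)\<bar>"
      proof (cases "Z k \<le> X k")
        case True
        then show ?thesis using \<gamma>(2)[of "Z k" "X k"] that pos le1[of k] by simp
      next
        case False
        then show ?thesis using \<gamma>(2)[of "X k" "Z k"] that pos le1[of k] by simp
      qed
      then show ?thesis using step[of k] \<kappa> by linarith
    qed
    have "\<forall>\<^sub>F k in sequentially. b \<le> X k \<and> b \<le> Z k"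
      unfolding X_def Z_def using low[OF yz(1) xx(1,2)] low[OF yz(2) xx(3,4)] by (rule eventually_conj)
    then obtain k0 where k0: "\<And>k. k \<ge> k0 \<Longrightarrow> b \<le> X k \<and> b \<le> Z k"
      by (auto simp: eventually_sequentially)
    have "\<exists>j. \<bar>X (k0 + j) - Z (k0 + j)\<bar> < b * \<delta> / 2"
    proof (rule ccontr)
      assume "\<not> ?thesis"
      then have far: "b * \<delta> / 2 \<le> \<bar>X (k0 + j) - Z (k0 + j)\<bar>" for j by (simp add: not_less)
      have "u (k0 + j) \<le> u k0 - real j * (\<gamma> / 2)" for j
      proof (induction j)
        case (Suc j)
        have "real (Suc j) * (\<gamma> / 2) = real j * (\<gamma> / 2) + \<gamma> / 2" by (simp add: distrib_right)
        then show ?case using Suc descent[OF far[of j]] unfolding add_Suc_right by linarith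
      qed simp
      moreover obtain j where "u k0 < real j * (\<gamma> / 2)" using reals_Archimedean3[of "\<gamma> / 2"] \<gamma>(1) by auto
      moreover have "0 \<le> u (k0 + j)" by (simp add: u_def)
      ultimately show False by (smt (verit))
    qed
    then obtain k1 where k1: "k1 \<ge> k0" "\<bar>X k1 - Z k1\<bar> < b * \<delta> / 2" by (metis le_add1)
    have near: "u k \<le> \<delta> / 2" if "k \<ge> k0" "\<bar>X k - Z k\<bar> < b * \<delta> / 2" for k
    proof -
      have "u k \<le> \<bar>X k - Z k\<bar> / b" unfolding u_def using k0[OF that(1)] \<open>b > 0\<close> by (intro abs_ln_diff_le) auto
      also have "\<dots> \<le> b * \<delta> / 2 / b" using that \<open>b > 0\<close> by (intro divide_right_mono) auto
      finally show ?thesis using \<open>b > 0\<close> by simp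
    qed
    have stay: "u k \<le> \<delta> / 2 + \<kappa>" if "k \<ge> k1" for k
      using that
    proof (induction k rule: dec_induct)
      case base
      show ?case using near[OF k1] \<kappa> by simp
    next
      case (step k)
      show ?case
      proof (cases "\<bar>X k - Z k\<bar> < b * \<delta> / 2")
        case True
        then show ?thesis using near[of k] step k1 \<open>\<And>k. u (Suc k) \<le> _\<close>[of k] by linarith
      next
        case False
        then show ?thesis using descent[of k] step \<gamma>(1) by linarith
      qed
    qed
    show "\<forall>\<^sub>F k in sequentially. \<bar>fibre_orbit \<omega> \<alpha> \<epsilon> y x k - fibre_orbit \<omega> \<alpha> \<epsilon> z x' k\<bar> < \<delta>"
      using eventually_ge_at_top[of k1]
    proof eventually_elim
      case (elim k)
      have "\<bar>X k - Z k\<bar> \<le> u k" unfolding u_def using pos le1 by (intro abs_diff_le_abs_ln_diff) auto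
      then show ?case using stay[OF elim] \<kappa> \<open>\<delta> > 0\<close> by (simp add: X_def Z_def)
    qed
  qed (use \<kappa> \<epsilon> in simp)
qed

section \<open>Zero section without uniform expansion\<close>

context diophantine_rotation
begin

text \<open>The hypothesis supplies only one good point \<open>y0\<close> for each n. Every orbit
  comes \<rho>-close to it within K steps, with K independent of n; the time shift costs at most 2 K
  M, and the Lipschitz bound costs \<eta> per step.\<close>

lemma log_rate_sum_sublinear:
  assumes \<alpha>: "\<alpha> > 0" and \<epsilon>: "\<epsilon> > 0"
    and no_block: "\<And>N a. N > 0 \<Longrightarrow> a > 0 \<Longrightarrow> \<exists>y. log_rate_sum \<omega> \<alpha> \<epsilon> N y < a"
    and "\<eta> > 0"
  obtains C where "C \<ge> 0" "\<And>n y. log_rate_sum \<omega> \<alpha> \<epsilon> n y \<le> C + real n * \<eta>"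
proof -
  obtain M where M: "M \<ge> 0" "\<And>y. \<bar>log_rate \<alpha> \<epsilon> y\<bar> \<le> M" using log_rate_bounded[OF \<alpha> \<epsilon>] by metis
  define \<rho> where "\<rho> = min 1 (\<eta> * \<epsilon> / pi)"
  have \<rho>: "0 < \<rho>" "\<rho> \<le> 1" using \<open>\<eta> > 0\<close> \<epsilon> by (auto simp: \<rho>_def)
  have "pi / \<epsilon> * \<rho> \<le> pi / \<epsilon> * (\<eta> * \<epsilon> / pi)" using \<epsilon> by (intro mult_left_mono) (auto simp: \<rho>_def)
  then have rho_eta: "pi / \<epsilon> * \<rho> \<le> \<eta>" using \<epsilon> by simp
  obtain K :: nat where K: "0 < K" "\<And>y. \<exists>k<K. \<exists>m::int. 0 < y + real k * \<omega> - of_int m \<and> y + real k * \<omega> - of_int m < \<rho>"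
    using visiting_time[OF \<rho>] by metis
  show thesis
  proof (rule that[of "1 + 2 * (real K * M)"])
    fix n :: nat and y :: real
    show "log_rate_sum \<omega> \<alpha> \<epsilon> n y \<le> 1 + 2 * (real K * M) + real n * \<eta>"
    proof (cases "n = 0")
      case True
      then show ?thesis using M(1) by (simp add: log_rate_sum_def)
    next
      case False
      then obtain y0 where y0: "log_rate_sum \<omega> \<alpha> \<epsilon> n y0 < 1" using no_block[of n 1] by auto
      obtain k m where k: "k < K" "0 < (y - y0) + real k * \<omega> - of_int m" "(y - y0) + real k * \<omega> - of_int m < \<rho>"
        using K(2)[of "y - y0"] by blast
      have near: "circle_norm ((y + real k * \<omega>) - y0) \<le> \<rho>"
        using circle_norm_le[of "(y + real k * \<omega>) - y0" m] k by simp
      have term_le: "log_rate \<alpha> \<epsilon> ((y + real k * \<omega>) + real i * \<omega>) \<le> log_rate \<alpha> \<epsilon> (y0 + real i * \<omega>) + \<eta>" for i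
      proof -
        have "\<bar>log_rate \<alpha> \<epsilon> ((y + real k * \<omega>) + real i * \<omega>) - log_rate \<alpha> \<epsilon> (y0 + real i * \<omega>)\<bar>
          \<le> pi / \<epsilon> * circle_norm ((y + real k * \<omega>) - y0)"
          using abs_log_rate_diff_le[OF \<alpha> \<epsilon>, of "(y + real k * \<omega>) + real i * \<omega>" "y0 + real i * \<omega>"] by simp
        also have "\<dots> \<le> pi / \<epsilon> * \<rho>" using near \<epsilon> by (intro mult_left_mono) auto
        finally show ?thesis using rho_eta by linarith
      qed
      have "log_rate_sum \<omega> \<alpha> \<epsilon> n (y + real k * \<omega>) \<le> (\<Sum>i<n. log_rate \<alpha> \<epsilon> (y0 + real i * \<omega>) + \<eta>)"
        unfolding log_rate_sum_def by (intro sum_mono term_le)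
      also have "\<dots> = log_rate_sum \<omega> \<alpha> \<epsilon> n y0 + real n * \<eta>" by (simp add: log_rate_sum_def sum.distrib)
      finally have shifted: "log_rate_sum \<omega> \<alpha> \<epsilon> n (y + real k * \<omega>) \<le> 1 + real n * \<eta>" using y0 by linarith
      have "log_rate_sum \<omega> \<alpha> \<epsilon> n y + log_rate_sum \<omega> \<alpha> \<epsilon> k (y + real n * \<omega>)
        = log_rate_sum \<omega> \<alpha> \<epsilon> k y + log_rate_sum \<omega> \<alpha> \<epsilon> n (y + real k * \<omega>)"
        by (metis log_rate_sum_add add.commute)
      moreover have bound: "\<bar>log_rate_sum \<omega> \<alpha> \<epsilon> k z\<bar> \<le> real K * M" for z
      proof -
        have "\<bar>log_rate_sum \<omega> \<alpha> \<epsilon> k z\<bar> \<le> real k * M" by (rule abs_log_rate_sum_le[OF M(2)])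
        also have "\<dots> \<le> real K * M" using k M by (intro mult_right_mono) auto
        finally show ?thesis .
      qed
      ultimately show ?thesis using shifted bound[of y] bound[of "y + real n * \<omega>"] by linarith
    qed
  qed (use M in simp)
qed

lemma eventually_card_large_le:
  assumes \<alpha>: "\<alpha> > 0" and \<epsilon>: "\<epsilon> > 0"
    and self: "perturbed_map \<omega> \<alpha> \<epsilon> \<in> mspace annulus_metric \<rightarrow> mspace annulus_metric"
    and no_block: "\<And>N a. N > 0 \<Longrightarrow> a > 0 \<Longrightarrow> \<exists>y. log_rate_sum \<omega> \<alpha> \<epsilon> N y < a"
    and y: "y \<in> {0..<1}" and x: "0 < x" "x \<le> 1" and "\<delta> > 0" "\<tau> > 0"
  shows "\<forall>\<^sub>F n in sequentially. real (card {k. k < n \<and> \<delta> \<le> fibre_orbit \<omega> \<alpha> \<epsilon> y x k}) \<le> real n * \<tau>"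
proof -
  define X where "X = fibre_orbit \<omega> \<alpha> \<epsilon> y x"
  define g where "g = log_drop (\<alpha> * \<delta>)"
  have "g > 0" unfolding g_def using \<alpha> \<open>\<delta> > 0\<close> by (intro log_drop_pos) simp
  have pos: "0 < X k" for k
    unfolding X_def using \<alpha> \<epsilon> x by (auto intro!: fibre_orbit_pos simp: add_nonneg_pos)
  have le1: "X k \<le> 1" for k
    unfolding X_def using fibre_orbit_perturbed_bounds[OF self y] x by auto
  obtain C where C: "C \<ge> 0" "\<And>n z. log_rate_sum \<omega> \<alpha> \<epsilon> n z \<le> C + real n * (g * \<tau> / 2)"
    using log_rate_sum_sublinear[OF \<alpha> \<epsilon> no_block, of "g * \<tau> / 2"] \<open>g > 0\<close> \<open>\<tau> > 0\<close>
    by (metis half_gt_zero mult_pos_pos)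
  define r where "r = g + \<bar>ln \<delta>\<bar> + C"
  have "r \<ge> 0" using \<open>g > 0\<close> C by (simp add: r_def)
  have bound: "g * real (card {k. k < n \<and> \<delta> \<le> X k}) \<le> r + real n * (g * \<tau> / 2)" for n
  proof (cases "{k. k < n \<and> \<delta> \<le> X k} = {}")
    case True
    then show ?thesis using \<open>r \<ge> 0\<close> \<open>g > 0\<close> \<open>\<tau> > 0\<close> by (simp only: card.empty) simp
  next
    case False
    \<comment> \<open>The identity for ln X is evaluated at the last large time, where ln (X m)
      \<ge> ln \<delta>; at time n itself it could be arbitrarily negative. Each earlier large time
      uses up a drop of at least g.\<close>
    define m where "m = Max {k. k < n \<and> \<delta> \<le> X k}"
    have m: "m < n" "\<delta> \<le> X m" using Max_in[of "{k. k < n \<and> \<delta> \<le> X k}"] False by (auto simp: m_def)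
    have sub: "{k. k < n \<and> \<delta> \<le> X k} \<subseteq> insert m {k\<in>{..<m}. \<delta> \<le> X k}"
    proof
      fix k assume k: "k \<in> {k. k < n \<and> \<delta> \<le> X k}"
      then have "k \<le> m" unfolding m_def by (intro Max_ge) auto
      then show "k \<in> insert m {k\<in>{..<m}. \<delta> \<le> X k}" using k by auto
    qed
    have "card {k. k < n \<and> \<delta> \<le> X k} \<le> card (insert m {k\<in>{..<m}. \<delta> \<le> X k})"
      using sub by (intro card_mono) auto
    then have c: "real (card {k. k < n \<and> \<delta> \<le> X k}) \<le> 1 + real (card {k\<in>{..<m}. \<delta> \<le> X k})" by simp
    have "g * real (card {k\<in>{..<m}. \<delta> \<le> X k}) = (\<Sum>k\<in>{k\<in>{..<m}. \<delta> \<le> X k}. g)" by simp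
    also have "\<dots> \<le> (\<Sum>k\<in>{k\<in>{..<m}. \<delta> \<le> X k}. log_drop (\<alpha> * X k))"
      using \<alpha> \<open>\<delta> > 0\<close> unfolding g_def by (intro sum_mono log_drop_mono) auto
    also have "\<dots> \<le> (\<Sum>k<m. log_drop (\<alpha> * X k))"
      using pos \<alpha> by (intro sum_mono2) (auto intro!: log_drop_nonneg)
    also have "\<dots> = ln x + log_rate_sum \<omega> \<alpha> \<epsilon> m y - ln (X m)"
      using ln_fibre_orbit[OF \<alpha> \<epsilon> x(1), of \<omega> y m] by (simp add: X_def)
    also have "\<dots> \<le> 0 + (C + real m * (g * \<tau> / 2)) - ln \<delta>"
      using x C(2)[of m y] m \<open>\<delta> > 0\<close> pos[of m] by (intro diff_mono add_mono) auto
    also have "\<dots> \<le> C + real n * (g * \<tau> / 2) + \<bar>ln \<delta>\<bar>"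
    proof -
      have "real m * (g * \<tau> / 2) \<le> real n * (g * \<tau> / 2)"
        using m \<open>g > 0\<close> \<open>\<tau> > 0\<close> by (intro mult_right_mono) auto
      then show ?thesis by linarith
    qed
    finally have "g * real (card {k\<in>{..<m}. \<delta> \<le> X k}) \<le> C + real n * (g * \<tau> / 2) + \<bar>ln \<delta>\<bar>" .
    moreover have "g * real (card {k. k < n \<and> \<delta> \<le> X k}) \<le> g * (1 + real (card {k\<in>{..<m}. \<delta> \<le> X k}))"
      using c \<open>g > 0\<close> by (intro mult_left_mono) auto
    ultimately show ?thesis by (simp add: r_def ring_distribs)
  qed
  have "\<forall>\<^sub>F n in sequentially. r \<le> real n * (g * \<tau> / 2)"
    using \<open>g > 0\<close> \<open>\<tau> > 0\<close> by (intro eventually_const_le_mult) simp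
  then show ?thesis
  proof eventually_elim
    case (elim n)
    have "g * real (card {k. k < n \<and> \<delta> \<le> X k}) \<le> real n * (g * \<tau> / 2) + real n * (g * \<tau> / 2)"
      using bound[of n] elim by linarith
    also have "\<dots> = g * (real n * \<tau>)" by simp
    finally show ?case using \<open>g > 0\<close> by (simp add: X_def)
  qed
qed

text \<open>The width \<eta> is chosen before \<tau>, which later makes the bound on the separated
  sets independent of \<nu>.\<close>

lemma perturbed_gap_density_zero:
  assumes \<alpha>: "\<alpha> \<ge> 0" and \<epsilon>: "\<epsilon> > 0"
    and self: "perturbed_map \<omega> \<alpha> \<epsilon> \<in> mspace annulus_metric \<rightarrow> mspace annulus_metric"
    and \<delta>: "\<delta> > 0"
  obtains \<eta> where "\<eta> > 0"
    "\<And>p q \<tau>. p \<in> {0..<1} \<times> {0..1} \<Longrightarrow> q \<in> {0..<1} \<times> {0..1} \<Longrightarrow> (snd p = 0 \<longleftrightarrow> snd q = 0) \<Longrightarrow>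
      circle_norm (fst p - fst q) < \<eta> \<Longrightarrow> \<tau> > 0 \<Longrightarrow>
      \<forall>\<^sub>F n in sequentially. real (fibre_gap_count \<omega> \<alpha> \<epsilon> \<delta> p q n) \<le> real n * \<tau>"
proof -
  have finitely: "\<forall>\<^sub>F n in sequentially. real (fibre_gap_count \<omega> \<alpha> \<epsilon> \<delta> p q n) \<le> real n * \<tau>"
    if ev: "\<forall>\<^sub>F k in sequentially. \<bar>fibre_orbit \<omega> \<alpha> \<epsilon> (fst p) (snd p) k - fibre_orbit \<omega> \<alpha> \<epsilon> (fst q) (snd q) k\<bar> < \<delta>"
      and "\<tau> > 0" for p q \<tau>
  proof -
    obtain k0 where k0: "\<And>k. k \<ge> k0 \<Longrightarrow>
       \<bar>fibre_orbit \<omega> \<alpha> \<epsilon> (fst p) (snd p) k - fibre_orbit \<omega> \<alpha> \<epsilon> (fst q) (snd q) k\<bar> < \<delta>"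
      using ev by (auto simp: eventually_sequentially)
    have "fibre_gap_count \<omega> \<alpha> \<epsilon> \<delta> p q n \<le> card {..<k0}" for n
      unfolding fibre_gap_count_def using k0 by (intro card_mono) (auto simp: not_less[symmetric])
    then have "real (fibre_gap_count \<omega> \<alpha> \<epsilon> \<delta> p q n) \<le> real k0" for n by simp
    note bound = order_trans[OF this]
    show ?thesis
      by (rule eventually_mono[OF eventually_const_le_mult[OF \<open>\<tau> > 0\<close>, of "real k0"]]) (rule bound)
  qed
  have zero: "\<forall>\<^sub>F n in sequentially. real (fibre_gap_count \<omega> \<alpha> \<epsilon> \<delta> p q n) \<le> real n * \<tau>"
    if "snd p = 0" "snd q = 0" "\<tau> > 0" for p q \<tau>
    using that \<delta> by (simp add: fibre_gap_count_zero_fibres)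
  \<comment> \<open>For \<alpha> = 0 there is no logarithmic rate, but every fibre orbit is 0 after
    one step.\<close>
  consider "\<alpha> = 0" | N a where "\<alpha> > 0" "N > 0" "a > 0" "\<And>y. a \<le> log_rate_sum \<omega> \<alpha> \<epsilon> N y"
    | "\<alpha> > 0" "\<And>N a. N > 0 \<Longrightarrow> a > 0 \<Longrightarrow> \<exists>y. log_rate_sum \<omega> \<alpha> \<epsilon> N y < a"
    using \<alpha> by (metis not_less order_le_less)
  then show thesis
  proof cases
    case 1
    show thesis
    proof (rule that[of 1])
      fix p q \<tau> assume "\<tau> > (0::real)"
      have "\<forall>\<^sub>F k in sequentially. \<bar>fibre_orbit \<omega> \<alpha> \<epsilon> (fst p) (snd p) k - fibre_orbit \<omega> \<alpha> \<epsilon> (fst q) (snd q) k\<bar> < \<delta>"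
        using eventually_gt_at_top[of 0]
      proof eventually_elim
        case (elim k)
        then show ?case using 1 \<delta> by (cases k) auto
      qed
      then show "\<forall>\<^sub>F n in sequentially. real (fibre_gap_count \<omega> \<alpha> \<epsilon> \<delta> p q n) \<le> real n * \<tau>"
        using \<open>\<tau> > 0\<close> by (rule finitely)
    qed simp
  next
    case 2
    obtain b where b: "b > 0"
      "\<And>y x. y \<in> {0..<1} \<Longrightarrow> 0 < x \<Longrightarrow> x \<le> 1 \<Longrightarrow> \<forall>\<^sub>F k in sequentially. b \<le> fibre_orbit \<omega> \<alpha> \<epsilon> y x k"
      by (rule eventually_ge_of_expanding_block[OF 2(1) \<epsilon> self 2(2-4)], rule that)
    obtain \<eta> where \<eta>: "\<eta> > 0"
      "\<And>y z x x'. y \<in> {0..<1} \<Longrightarrow> z \<in> {0..<1} \<Longrightarrow> 0 < x \<Longrightarrow> x \<le> 1 \<Longrightarrow> 0 < x' \<Longrightarrow> x' \<le> 1 \<Longrightarrow>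
        circle_norm (y - z) < \<eta> \<Longrightarrow>
        \<forall>\<^sub>F k in sequentially. \<bar>fibre_orbit \<omega> \<alpha> \<epsilon> y x k - fibre_orbit \<omega> \<alpha> \<epsilon> z x' k\<bar> < \<delta>"
      by (rule eventually_no_gap[OF 2(1) \<epsilon> self \<delta> b(1)]) (assumption | rule b(2) | rule that)+
    show thesis
    proof (rule that[OF \<eta>(1)])
      fix p q :: "real \<times> real" and \<tau> assume pq: "p \<in> {0..<1} \<times> {0..1::real}" "q \<in> {0..<1} \<times> {0..1::real}"
        "snd p = 0 \<longleftrightarrow> snd q = 0" "circle_norm (fst p - fst q) < \<eta>" and "\<tau> > (0::real)"
      show "\<forall>\<^sub>F n in sequentially. real (fibre_gap_count \<omega> \<alpha> \<epsilon> \<delta> p q n) \<le> real n * \<tau>"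
      proof (cases "snd p = 0")
        case True
        then show ?thesis using pq \<open>\<tau> > 0\<close> by (intro zero) auto
      next
        case False
        then show ?thesis using pq \<open>\<tau> > 0\<close> by (intro finitely \<eta>(2)) auto
      qed
    qed
  next
    case 3
    \<comment> \<open>No closeness of the base points is involved here: a gap of size \<delta>
      requires one of the two nonnegative orbits to be at least \<delta>, which happens with density
      zero.\<close>
    show thesis
    proof (rule that[of 1])
      fix p q :: "real \<times> real" and \<tau> assume pq: "p \<in> {0..<1} \<times> {0..1::real}" "q \<in> {0..<1} \<times> {0..1::real}"
        "snd p = 0 \<longleftrightarrow> snd q = 0" and "\<tau> > (0::real)"
      let ?X = "fibre_orbit \<omega> \<alpha> \<epsilon> (fst p) (snd p)" and ?Z = "fibre_orbit \<omega> \<alpha> \<epsilon> (fst q) (snd q)"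
      show "\<forall>\<^sub>F n in sequentially. real (fibre_gap_count \<omega> \<alpha> \<epsilon> \<delta> p q n) \<le> real n * \<tau>"
      proof (cases "snd p = 0")
        case True
        then show ?thesis using pq \<open>\<tau> > 0\<close> by (intro zero) auto
      next
        case False
        have nonneg: "0 \<le> ?X k" "0 \<le> ?Z k" for k
          using pq by (auto intro!: fibre_orbit_perturbed_bounds[OF self])
        have "\<forall>\<^sub>F n in sequentially. real (card {k. k < n \<and> \<delta> \<le> ?X k}) \<le> real n * (\<tau> / 2)"
          using pq False \<open>\<tau> > 0\<close> by (intro eventually_card_large_le[OF 3(1) \<epsilon> self 3(2)] \<delta>) auto
        moreover have "\<forall>\<^sub>F n in sequentially. real (card {k. k < n \<and> \<delta> \<le> ?Z k}) \<le> real n * (\<tau> / 2)"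
          using pq False \<open>\<tau> > 0\<close> by (intro eventually_card_large_le[OF 3(1) \<epsilon> self 3(2)] \<delta>) auto
        ultimately show ?thesis
        proof eventually_elim
          case (elim n)
          have "fibre_gap_count \<omega> \<alpha> \<epsilon> \<delta> p q n \<le> card ({k. k < n \<and> \<delta> \<le> ?X k} \<union> {k. k < n \<and> \<delta> \<le> ?Z k})"
            unfolding fibre_gap_count_def
          proof (rule card_mono)
            show "{k. k < n \<and> \<delta> \<le> \<bar>?X k - ?Z k\<bar>} \<subseteq> {k. k < n \<and> \<delta> \<le> ?X k} \<union> {k. k < n \<and> \<delta> \<le> ?Z k}"
            proof
              fix k assume "k \<in> {k. k < n \<and> \<delta> \<le> \<bar>?X k - ?Z k\<bar>}"
              then show "k \<in> {k. k < n \<and> \<delta> \<le> ?X k} \<union> {k. k < n \<and> \<delta> \<le> ?Z k}"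
                using nonneg[of k] by (auto simp: abs_real_def split: if_splits)
            qed
          qed auto
          also have "\<dots> \<le> card {k. k < n \<and> \<delta> \<le> ?X k} + card {k. k < n \<and> \<delta> \<le> ?Z k}" by (rule card_Un_le)
          finally have "real (fibre_gap_count \<omega> \<alpha> \<epsilon> \<delta> p q n)
              \<le> real (card {k. k < n \<and> \<delta> \<le> ?X k}) + real (card {k. k < n \<and> \<delta> \<le> ?Z k})" by linarith
          then show ?case using elim by simp
        qed
      qed
    qed simp
  qed
qed

lemma perturbed_has_ac_0:
  assumes "\<alpha> \<ge> 0" "\<epsilon> > 0"
    and self: "perturbed_map \<omega> \<alpha> \<epsilon> \<in> mspace annulus_metric \<rightarrow> mspace annulus_metric"
  shows "has_ac annulus_metric (perturbed_map \<omega> \<alpha> \<epsilon>) 0"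
proof -
  have sub: "submetric annulus_metric ({0..<1} \<times> {0..1}) = annulus_metric"
    using submetric_mspace[of annulus_metric] by simp
  have "upper_ac annulus_metric (perturbed_map \<omega> \<alpha> \<epsilon>) \<le> ereal 0"
  proof (rule upper_ac_le)
    fix \<delta> :: real assume "\<delta> > 0"
    obtain \<eta>0 where \<eta>0: "\<eta>0 > 0"
      "\<And>p q \<tau>. p \<in> {0..<1} \<times> {0..1} \<Longrightarrow> q \<in> {0..<1} \<times> {0..1} \<Longrightarrow> (snd p = 0 \<longleftrightarrow> snd q = 0) \<Longrightarrow>
      circle_norm (fst p - fst q) < \<eta>0 \<Longrightarrow> \<tau> > 0 \<Longrightarrow>
      \<forall>\<^sub>F n in sequentially. real (fibre_gap_count \<omega> \<alpha> \<epsilon> \<delta> p q n) \<le> real n * \<tau>"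
      by (rule perturbed_gap_density_zero[OF assms \<open>\<delta> > 0\<close>], rule that)
    define \<eta> where "\<eta> = min \<eta>0 \<delta>"
    have \<eta>: "\<eta> > 0" "\<eta> \<le> \<eta>0" "\<eta> \<le> \<delta>" using \<eta>0(1) \<open>\<delta> > 0\<close> by (auto simp: \<eta>_def)
    define C where "C = 2 * (nat \<lfloor>1 / \<eta>\<rfloor> + 1)"
    show "\<exists>C>0. \<forall>\<nu>\<in>{0<..<1}. \<exists>N. Sep annulus_metric (perturbed_map \<omega> \<alpha> \<epsilon>) \<delta> \<nu> \<le> enat N \<and>
        real N \<le> C * \<nu> powr (- 0)"
    proof (intro exI[of _ "real C"] conjI ballI)
      fix \<nu> :: real assume \<nu>: "\<nu> \<in> {0<..<1}"
      have "Sep (submetric annulus_metric ({0..<1} \<times> {0..1})) (perturbed_map \<omega> \<alpha> \<epsilon>) \<delta> \<nu> \<le> enat C"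
        unfolding C_def
      proof (rule Sep_le_if_close_not_separated[OF order_refl \<eta>(1)])
        fix p q :: "real \<times> real"
        assume pq: "p \<in> {0..<1} \<times> {0..1}" "q \<in> {0..<1} \<times> {0..1}" "(snd p = 0) = (snd q = 0)"
          "circle_norm (fst p - fst q) < \<eta>"
        have base: "fst p \<in> {0..<1}" "fst q \<in> {0..<1}" using pq by auto
        have lt: "circle_norm (fst p - fst q) < \<delta>" using pq \<eta> by linarith
        have "\<forall>\<^sub>F n in sequentially. real (fibre_gap_count \<omega> \<alpha> \<epsilon> \<delta> p q n) \<le> real n * (\<nu> / 2)"
          using pq \<eta> \<nu> by (intro \<eta>0(2)) auto
        then show "\<not> separated_points (submetric annulus_metric ({0..<1} \<times> {0..1}))
            (perturbed_map \<omega> \<alpha> \<epsilon>) \<delta> \<nu> p q"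
          by (intro not_separated_points[where b = "\<nu> / 2"])
            (use sep_count_eq_fibre_gap_count[OF base lt] \<nu> in auto)
      qed
      then show "\<exists>N. Sep annulus_metric (perturbed_map \<omega> \<alpha> \<epsilon>) \<delta> \<nu> \<le> enat N \<and> real N \<le> real C * \<nu> powr (- 0)"
        using \<nu> unfolding sub by (intro exI[of _ C]) simp
    qed (simp add: C_def)
  qed
  then have "upper_ac annulus_metric (perturbed_map \<omega> \<alpha> \<epsilon>) \<le> 0" by (simp add: zero_ereal_def)
  moreover have "0 \<le> lower_ac annulus_metric (perturbed_map \<omega> \<alpha> \<epsilon>)"
    by (rule lower_ac_nonneg[of "(0, 0)"]) simp
  moreover have "lower_ac annulus_metric (perturbed_map \<omega> \<alpha> \<epsilon>) \<le> upper_ac annulus_metric (perturbed_map \<omega> \<alpha> \<epsilon>)"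
    by (rule lower_ac_le_upper_ac)
  ultimately show ?thesis
    unfolding has_ac_def by (metis antisym order_trans)
qed

end

theorem theorem6p1:
  fixes \<omega> :: real
  assumes "\<omega> \<in> {0..<1}" and "diophantine \<omega>"
  shows "(\<exists>\<alpha>0\<ge>0. \<forall>\<alpha>\<ge>\<alpha>0. \<exists>\<Omega>\<subseteq>{0..<1}.
            {0..<1} - \<Omega> \<in> null_sets lebesgue \<and>
            rotation \<omega> ` \<Omega> = \<Omega> \<and>
            0 < lower_ac (submetric annulus_metric (\<Omega> \<times> {0..1})) (pinched_map \<omega> \<alpha>) \<and>
            lower_ac (submetric annulus_metric (\<Omega> \<times> {0..1})) (pinched_map \<omega> \<alpha>)
              \<le> upper_ac (submetric annulus_metric (\<Omega> \<times> {0..1})) (pinched_map \<omega> \<alpha>) \<and>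
            upper_ac (submetric annulus_metric (\<Omega> \<times> {0..1})) (pinched_map \<omega> \<alpha>) < \<infinity>)
       \<and> (\<forall>\<epsilon>>0. \<forall>\<alpha>\<ge>0.
            perturbed_map \<omega> \<alpha> \<epsilon> \<in> mspace annulus_metric \<rightarrow> mspace annulus_metric \<longrightarrow>
            has_ac annulus_metric (perturbed_map \<omega> \<alpha> \<epsilon>) 0)"
proof -
  obtain c d0 where cd: "c > 0" "d0 > 0"
    "\<And>n::nat. n \<ge> 1 \<Longrightarrow> c * real n powr (- d0) \<le> mdist circle_metric (frac (real n * \<omega>)) 0"
    using assms(2) by (auto simp: diophantine_def)
  interpret diophantine_rotation \<omega> c d0
  proof
    fix n :: nat assume "1 \<le> n"
    then show "c * real n powr (- d0) \<le> circle_norm (real n * \<omega>)"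
      using cd(3)[of n] circle_norm_frac_diff[of "real n * \<omega>" 0] by (simp add: mdist_circle)
  qed (use cd in auto)
  \<comment> \<open>From here on the expansion rate ln \<alpha> - ln 2 exceeds the mean height bound
    \<open>sing_const\<close> by at least 1.\<close>
  define \<alpha>0 where "\<alpha>0 = exp (ln 2 + sing_const + 1)"
  have "\<exists>\<Omega>\<subseteq>{0..<1}.
            {0..<1} - \<Omega> \<in> null_sets lebesgue \<and>
            rotation \<omega> ` \<Omega> = \<Omega> \<and>
            0 < lower_ac (submetric annulus_metric (\<Omega> \<times> {0..1})) (pinched_map \<omega> \<alpha>) \<and>
            lower_ac (submetric annulus_metric (\<Omega> \<times> {0..1})) (pinched_map \<omega> \<alpha>)
              \<le> upper_ac (submetric annulus_metric (\<Omega> \<times> {0..1})) (pinched_map \<omega> \<alpha>) \<and>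
            upper_ac (submetric annulus_metric (\<Omega> \<times> {0..1})) (pinched_map \<omega> \<alpha>) < \<infinity>"
    if "\<alpha> \<ge> \<alpha>0" for \<alpha>
  proof (intro exI[of _ "generic_base \<omega>"] conjI)
    have "0 < ln (2::real)" by simp
    then have "exp 0 \<le> \<alpha>0" unfolding \<alpha>0_def using sing_const_pos by (subst exp_le_cancel_iff) linarith
    then have \<alpha>: "\<alpha> \<ge> 1" using that by simp
    have "\<alpha>0 > 0" by (simp add: \<alpha>0_def)
    then have "ln \<alpha>0 \<le> ln \<alpha>" using that by (subst ln_le_cancel_iff) linarith+
    then have "ln 2 + sing_const + 1 \<le> ln \<alpha>" by (simp add: \<alpha>0_def)
    then show "0 < lower_ac (submetric annulus_metric (generic_base \<omega> \<times> {0..1})) (pinched_map \<omega> \<alpha>)"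
      using \<alpha> by (intro lower_ac_pinched_pos)
    show "upper_ac (submetric annulus_metric (generic_base \<omega> \<times> {0..1})) (pinched_map \<omega> \<alpha>) < \<infinity>"
      using \<alpha> by (intro upper_ac_pinched_finite) simp
    show "generic_base \<omega> \<subseteq> {0..<1}" by (auto simp: generic_base_def)
  qed (simp_all only: generic_base_full_measure rotation_generic_base lower_ac_le_upper_ac)
  moreover have "0 \<le> \<alpha>0" by (simp add: \<alpha>0_def)
  ultimately show ?thesis using perturbed_has_ac_0 by blast
qed

end
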